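(* Consider the random LSV maps $(T_\omega)_{\omega\in\Omega}$ of the context, with $\operatorname{ess\,sup}_{\omega}\beta(\omega)<1$ and $\gamma\in(0,1)$ such that $b_0:=\mathbb P(\beta(\omega)\le\gamma)>0$. Let $p\ge1$ and let $g_1,g_2:M\to\mathbb R$ be Lipschitz continuous. There exists $\tilde\varepsilon\in(0,1/2)$ depending only on the random dynamical system such that for any $\varepsilon\in(0,\tilde\varepsilon]$, any integers $0\le s\le i<j$, and for $\mathbb P$-a.e. $\omega\in\Omega$, $$\Big\|\Big[L_{\sigma^i\omega}^{j-i}\big(g_2\,L_{\sigma^s\omega}^{i-s}(g_1)\big)\Big]_{\sigma^j\omega}\Big\|_{L^p(\mu_{\sigma^j\omega})}\le C_p(1+\|g_1\|_{\mathrm{Lip}})(1+\|g_2\|_{\mathrm{Lip}})\,(1+N_\varepsilon(\sigma^i\omega))^{\frac1p(1\vee(1/\gamma-1))}\,(j-i)^{-\frac1p(\frac1\gamma-1)},$$ where $C_p>0$ is a constant depending only on the random dynamical system and $p$.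
   Context: $(\Omega,\mathcal F,\mathbb P)$ is a probability space with an invertible ergodic $\mathbb P$-preserving transformation $\sigma$. $M=[0,1]$, $m$ is Lebesgue measure. For $\beta\in(0,1)$ the LSV map is $T_\beta(x)=x(1+2^\beta x^\beta)$ for $0\le x<1/2$ and $T_\beta(x)=2x-1$ for $1/2\le x\le1$. $\beta:\Omega\to(0,1)$ is measurable, $T_\omega:=T_{\beta(\omega)}$, $T_\omega^n:=T_{\sigma^{n-1}\omega}\circ\cdots\circ T_{\sigma\omega}\circ T_\omega$. $\mathcal L_\omega$ is the transfer operator of $T_\omega$ with respect to $m$: $\mathcal L_\omega\varphi(x)=\sum_{T_\omega(y)=x}\varphi(y)/T_\omega'(y)$; $\mathcal L_\omega^n:=\mathcal L_{\sigma^{n-1}\omega}\circ\cdots\circ\mathcal L_\omega$. The cocycle has a unique random absolutely continuous invariant measure $(\mu_\omega)_{\omega}$: $d\mu_\omega=h_\omega\,dm$, $(T_\omega)_*\mu_\omega=\mu_{\sigma\omega}$ for $\mathbb P$-a.e. $\omega$, with $h_\omega=\lim_{n\to\infty}\mathcal L_{\sigma^{-n}\omega}^n1$ in $L^1(m)$. $L_\omega:L^1(\mu_\omega)\to L^1(\mu_{\sigma\omega})$ is $L_\omega\varphi=\mathcal L_\omega(\varphi h_\omega)/h_{\sigma\omega}$, $L_\omega^n:=L_{\sigma^{n-1}\omega}\circ\cdots\circ L_\omega$, $L_\omega^0=\mathrm{Id}$. $[g]_\omega:=g-\mu_\omega(g)$; $\|\cdot\|_{\mathrm{Lip}}$ is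 the usual Lipschitz norm (supremum norm plus Lipschitz constant); $a\vee b=\max(a,b)$. For $\delta\in\{\sigma,\sigma^{-1}\}$ let $S_n^\delta(\omega)=\sum_{i=0}^{n-1}\psi(\delta^i\omega)$, where $\psi(\omega)=\mathbf 1_{(0,\gamma]}(\beta(\omega))$. For $\varepsilon\in(0,1/2)$, $$N_\varepsilon(\omega)=\max_{\delta\in\{\sigma,\sigma^{-1}\}}\max\Big(\big\{n\ge1:\ n^{-1}S_n^\delta(\omega)\notin[b_0(1-\varepsilon),b_0(1+\varepsilon)]\big\}\cup\{0\}\Big),$$ which is finite for $\mathbb P$-a.e. $\omega$. "Random dynamical system" refers to the data $(\Omega,\mathcal F,\mathbb P,\sigma)$, $\beta(\cdot)$ and $\gamma$. *)

theory Defs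
  imports "HOL-Probability.Probability"
begin

definition ergodic_automorphism :: "'a measure \<Rightarrow> ('a \<Rightarrow> 'a) \<Rightarrow> bool" where
  "ergodic_automorphism P \<sigma> \<longleftrightarrow>
     bij_betw \<sigma> (space P) (space P) \<and>
     \<sigma> \<in> measurable P P \<and>
     inv_into (space P) \<sigma> \<in> measurable P P \<and>
     distr P P \<sigma> = P \<and>
     (\<forall>A\<in>sets P. \<sigma> -` A \<inter> space P = A \<longrightarrow> measure P A = 0 \<or> measure P A = 1)"

text \<open>The composition \<open>A (\<sigma>\<^sup>n\<^sup>-\<^sup>1 \<omega>) \<circ> \<dots> \<circ> A (\<sigma> \<omega>) \<circ> A \<omega>\<close> along the orbit of \<open>\<omega>\<close>.\<close>

primrec cocycle :: "('a \<Rightarrow> 'a) \<Rightarrow> ('a \<Rightarrow> 'b \<Rightarrow> 'b) \<Rightarrow> nat \<Rightarrow> 'a \<Rightarrow> 'b \<Rightarrow> 'b" where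
  "cocycle \<sigma> A 0 \<omega> = id"
| "cocycle \<sigma> A (Suc n) \<omega> = A ((\<sigma> ^^ n) \<omega>) \<circ> cocycle \<sigma> A n \<omega>"

text \<open>Functions on \<open>M = [0,1]\<close> are functions on the reals of which only the values on
  \<open>{0..1}\<close> matter.\<close>

definition unit_lebesgue :: "real measure" where
  "unit_lebesgue = restrict_space lborel {0..1}"

definition lsv :: "real \<Rightarrow> real \<Rightarrow> real" where
  "lsv b x = (if x < 1/2 then x * (1 + 2 powr b * x powr b) else 2 * x - 1)"

text \<open>The derivative of the LSV map branch by branch; at the discontinuity \<open>1/2\<close>, where no
  derivative exists, it is that of the right branch, and at \<open>0\<close> and \<open>1\<close> it is one-sided.\<close>

definition lsv_deriv :: "real \<Rightarrow> real \<Rightarrow> real" where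
  "lsv_deriv b x = (if x < 1/2 then 1 + 2 powr b * (1 + b) * x powr b else 2)"

lemma has_real_derivative_lsv_left:
  assumes b: "0 < b" and x: "0 \<le> x" "x < 1/2"
  shows "(lsv b has_real_derivative lsv_deriv b x) (at x within {0..<1/2})"
proof -
  have "((\<lambda>x. x * (1 + 2 powr b * x powr b)) has_real_derivative
      1 + 2 powr b * (1 + b) * x powr b) (at x within {0..<1/2})"
  proof (cases "x = 0")
    case True
    have "((\<lambda>y::real. 1 + 2 powr b * y powr b) \<longlongrightarrow> 1 + 2 powr b * 0 powr b) (at 0 within {0..<1/2})"
      by (intro tendsto_intros tendsto_powr') (use b in \<open>auto simp: eventually_at_filter\<close>)
    then have "((\<lambda>y::real. 1 + 2 powr b * y powr b) \<longlongrightarrow> 1) (at 0 within {0..<1/2})"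
      by simp
    then have "((\<lambda>y::real. (y * (1 + 2 powr b * y powr b) - 0) / (y - 0)) \<longlongrightarrow> 1) (at 0 within {0..<1/2})"
      by (rule Lim_transform_eventually) (simp add: eventually_at_filter)
    then show ?thesis
      using b True by (simp add: has_field_derivative_iff)
  next
    case False
    with x have "0 < x" by simp
    then show ?thesis
      by (auto intro!: derivative_eq_intros simp: algebra_simps powr_diff)
  qed
  then have "(lsv b has_real_derivative 1 + 2 powr b * (1 + b) * x powr b) (at x within {0..<1/2})"
    by (rule has_field_derivative_transform_within[where d = 1]) (use x in \<open>auto simp: lsv_def\<close>)
  then show ?thesis
    using x by (simp add: lsv_deriv_def)
qed

lemma has_real_derivative_lsv_right:
  assumes "1/2 \<le> x" "x \<le> 1"
  shows "(lsv b has_real_derivative lsv_deriv b x) (at x within {1/2..1})"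
proof -
  have "((\<lambda>x. 2 * x - 1) has_real_derivative 2) (at x within {1/2..1})"
    by (auto intro!: derivative_eq_intros)
  then have "(lsv b has_real_derivative 2) (at x within {1/2..1})"
    by (rule has_field_derivative_transform_within[where d = 1]) (use assms in \<open>auto simp: lsv_def\<close>)
  then show ?thesis
    using assms by (simp add: lsv_deriv_def)
qed

definition lsv_transfer :: "real \<Rightarrow> (real \<Rightarrow> real) \<Rightarrow> real \<Rightarrow> real" where
  "lsv_transfer b \<phi> x = (\<Sum>y\<in>{y\<in>{0..1}. lsv b y = x}. \<phi> y / lsv_deriv b y)"

definition fiber_measure :: "('a \<Rightarrow> real \<Rightarrow> real) \<Rightarrow> 'a \<Rightarrow> real measure" where
  "fiber_measure h \<omega> = density unit_lebesgue (\<lambda>x. ennreal (h \<omega> x))"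

text \<open>\<open>h \<omega>\<close> represents, for almost every \<open>\<omega>\<close>, the density of the random absolutely continuous
  invariant measure: it is the \<open>L\<^sup>1\<close>-limit of the \<open>n\<close>-step transfer operators
  started at \<open>\<sigma>\<^sup>-\<^sup>n \<omega>\<close>, applied to the constant function \<open>1\<close>.\<close>

definition random_acim_density ::
    "'a measure \<Rightarrow> ('a \<Rightarrow> 'a) \<Rightarrow> ('a \<Rightarrow> real) \<Rightarrow> ('a \<Rightarrow> real \<Rightarrow> real) \<Rightarrow> bool" where
  "random_acim_density P \<sigma> \<beta> h \<longleftrightarrow>
     (AE \<omega> in P.
        integrable unit_lebesgue (h \<omega>) \<and>
        distr (fiber_measure h \<omega>) unit_lebesgue (lsv (\<beta> \<omega>)) = fiber_measure h (\<sigma> \<omega>) \<and>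
        (\<lambda>n. \<integral>\<^sup>+ x. ennreal \<bar>cocycle \<sigma> (\<lambda>\<omega>. lsv_transfer (\<beta> \<omega>)) n
                 ((inv_into (space P) \<sigma> ^^ n) \<omega>) (\<lambda>_. 1) x - h \<omega> x\<bar> \<partial>unit_lebesgue)
          \<longlonglongrightarrow> 0)"

text \<open>The transfer operator normalised by the densities, from \<open>L\<^sup>1(\<mu>\<^sub>\<omega>)\<close> to
  \<open>L\<^sup>1(\<mu>\<^sub>\<sigma>\<^sub>\<omega>)\<close>.\<close>

definition normalised_transfer ::
    "('a \<Rightarrow> 'a) \<Rightarrow> ('a \<Rightarrow> real) \<Rightarrow> ('a \<Rightarrow> real \<Rightarrow> real) \<Rightarrow> 'a \<Rightarrow> (real \<Rightarrow> real) \<Rightarrow> real \<Rightarrow> real" where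
  "normalised_transfer \<sigma> \<beta> h \<omega> \<phi> x = lsv_transfer (\<beta> \<omega>) (\<lambda>y. \<phi> y * h \<omega> y) x / h (\<sigma> \<omega>) x"

definition centred :: "'b measure \<Rightarrow> ('b \<Rightarrow> real) \<Rightarrow> 'b \<Rightarrow> real" where
  "centred M g x = g x - (\<integral>y. g y \<partial>M)"

definition in_Lp :: "'b measure \<Rightarrow> real \<Rightarrow> ('b \<Rightarrow> real) \<Rightarrow> bool" where
  "in_Lp M p f \<longleftrightarrow> f \<in> borel_measurable M \<and> integrable M (\<lambda>x. \<bar>f x\<bar> powr p)"

definition Lp_norm :: "'b measure \<Rightarrow> real \<Rightarrow> ('b \<Rightarrow> real) \<Rightarrow> real" where
  "Lp_norm M p f = (\<integral>x. \<bar>f x\<bar> powr p \<partial>M) powr (1 / p)"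

definition lipschitz_fun :: "(real \<Rightarrow> real) \<Rightarrow> bool" where
  "lipschitz_fun g \<longleftrightarrow> (\<exists>K. K-lipschitz_on {0..1} g)"

definition lip_norm :: "(real \<Rightarrow> real) \<Rightarrow> real" where
  "lip_norm g = (SUP x\<in>{0..1}. \<bar>g x\<bar>) + Inf {K. K-lipschitz_on {0..1} g}"

definition visit_sum :: "('a \<Rightarrow> real) \<Rightarrow> real \<Rightarrow> ('a \<Rightarrow> 'a) \<Rightarrow> nat \<Rightarrow> 'a \<Rightarrow> real" where
  "visit_sum \<beta> \<gamma> \<delta> n \<omega> = (\<Sum>i<n. indicator {0<..\<gamma>} (\<beta> ((\<delta> ^^ i) \<omega>)))"

definition visit_prob :: "'a measure \<Rightarrow> ('a \<Rightarrow> real) \<Rightarrow> real \<Rightarrow> real" where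
  "visit_prob P \<beta> \<gamma> = measure P {\<omega> \<in> space P. \<beta> \<omega> \<le> \<gamma>}"

definition last_deviation ::
    "'a measure \<Rightarrow> ('a \<Rightarrow> real) \<Rightarrow> real \<Rightarrow> real \<Rightarrow> ('a \<Rightarrow> 'a) \<Rightarrow> 'a \<Rightarrow> nat" where
  "last_deviation P \<beta> \<gamma> \<epsilon> \<delta> \<omega> =
     Max ({n. 1 \<le> n \<and> visit_sum \<beta> \<gamma> \<delta> n \<omega> / real n
                  \<notin> {visit_prob P \<beta> \<gamma> * (1 - \<epsilon>)..visit_prob P \<beta> \<gamma> * (1 + \<epsilon>)}} \<union> {0})"

text \<open>Almost surely the sets of deviation times are finite, by the ergodic theorem; \<open>Max\<close> has
  no meaning on the remaining null set.\<close>

definition deviation_time ::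
    "'a measure \<Rightarrow> ('a \<Rightarrow> 'a) \<Rightarrow> ('a \<Rightarrow> real) \<Rightarrow> real \<Rightarrow> real \<Rightarrow> 'a \<Rightarrow> nat" where
  "deviation_time P \<sigma> \<beta> \<gamma> \<epsilon> \<omega> =
     max (last_deviation P \<beta> \<gamma> \<epsilon> \<sigma> \<omega>)
         (last_deviation P \<beta> \<gamma> \<epsilon> (inv_into (space P) \<sigma>) \<omega>)"

end

theory Submission
  imports Defs
begin

text \<open>
  Write \<open>s = 1/\<gamma> - 1\<close> and \<open>n = j - i\<close>. Since \<open>h\<close> is invariant and the normalised operators are
  contractions of the supremum norm, the function \<open>F\<close> whose norm is to be bounded is uniformly bounded,
  so the \<open>L\<^sup>p\<close> estimate follows from an \<open>L\<^sup>1\<close> estimate, which is a statement of memory loss for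
  the plain transfer operators: the images of \<open>q\<close> and of \<open>m(q) h\<close> after \<open>n\<close> steps differ by
  \<open>O(n\<^sup>-\<^sup>s)\<close> in \<open>L\<^sup>1(m)\<close>. Here \<open>q\<close> is one of four nonnegative functions obtained by adding constants
  to \<open>g\<^sub>1\<close> and \<open>g\<^sub>2\<close>, and each is bounded by a multiple of \<open>h\<close>. As \<open>h\<close> is the limit of the
  images of the constant \<open>1\<close> started far in the past, it may be replaced by such an image, so that
  everything takes place on a one-sided sequence of maps (\<open>memory_loss_limit\<close>).

  Regularity. Call a positive density regular with exponent \<open>K\<close> if \<open>\<bar>d log f\<bar> \<le> K \<bar>d log x\<bar>\<close>. For
  \<open>K \<ge> 2\<close> the left branch preserves this on \<open>(0,1)\<close>, and the right branch halves the exponent.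
  Hence a constant, at most half of the density, may be subtracted on \<open>Y = [1/2,1)\<close> from a regular density:
  this doubles the exponent on \<open>Y\<close>, and one more application of the operator restores regularity
  (\<open>regular_subtract\<close>, \<open>regular_lsv_transfer\<close>).

  Excursions. A point that stays in \<open>[0,1/2)\<close> during a time window with \<open>k\<close> parameters \<open>\<le> \<gamma>\<close> is at most
  of order \<open>k\<^sup>-\<^sup>1\<^sup>/\<^sup>\<gamma>\<close>, because \<open>x\<^sup>-\<^sup>\<gamma>\<close> drops by a fixed amount at each of them. Summing over the
  time of the last visit to \<open>Y\<close>, where densities are bounded, the mass of the image of \<open>1\<close> that stays away
  from \<open>Y\<close> for another \<open>l\<close> steps is \<open>O(l\<^sup>-\<^sup>s)\<close>, provided that parameters \<open>\<le> \<gamma>\<close> have positive frequency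
  in all windows concerned (\<open>staying_mass_bound\<close>). The mass that does enter \<open>Y\<close> spreads out: it
  contributes a fixed proportion of itself to a lower bound on \<open>Y\<close> (\<open>entered_mass_lower_bound\<close>,
  \<open>evolve_one_lower_bound\<close>).

  Coupling. Two regular densities of equal mass \<open>U\<close>, both dominated by a multiple of the image of \<open>1\<close>,
  are compared at times \<open>a\<close> growing geometrically with ratio \<open>1 + O(\<delta>)\<close>. The part that stays away from \<open>Y\<close>
  throughout a window of length \<open>\<delta>a\<close> is \<open>O(a\<^sup>-\<^sup>s)\<close>. Either this is comparable with \<open>U\<close>, and
  nothing needs to be done, or the same fixed proportion \<open>\<theta>\<close> of \<open>U\<close> can be removed from both. If
  \<open>\<delta>\<close> is so small that \<open>(1 - \<theta>)(1 + 3\<delta>)\<^sup>s \<le> 1\<close>, then \<open>U = O(a\<^sup>-\<^sup>s)\<close> propagates from step to step, without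
  any loss in the exponent (\<open>memory_loss\<close>).

  Frequencies. Counted from the base time, the windows that matter begin at or before \<open>a\<close>, possibly in the
  past, and end at \<open>a + l\<close> with \<open>l \<ge> \<delta>a\<close>. After time \<open>N\<^sub>\<epsilon>\<close> the Birkhoff averages in both
  directions are within a factor \<open>1 \<plusminus> \<epsilon>\<close> of their mean, so for \<open>\<epsilon>\<close> small compared with \<open>\<delta>\<close> all these windows
  contain a positive proportion of parameters \<open>\<le> \<gamma>\<close> (\<open>visits_linear_lower_bound\<close>). Starting the coupling
  at a multiple of \<open>1 + N\<^sub>\<epsilon>\<close> costs the factor \<open>(1 + N\<^sub>\<epsilon>)\<^sup>s\<close>. That \<open>N\<^sub>\<epsilon>\<close> is finite almost surely
  is the ergodic theorem for an indicator, derived from the maximal ergodic inequality.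
\<close>

section \<open>The branches of the LSV maps\<close>

abbreviation leb :: "real measure" where
  "leb \<equiv> unit_lebesgue"

lemma space_unit_lebesgue [simp]: "space leb = {0..1}"
  by (simp add: unit_lebesgue_def space_restrict_space)

lemma sets_unit_lebesgue: "sets leb = sets (restrict_space borel {0..1})"
  unfolding unit_lebesgue_def by (rule sets_restrict_space_cong) simp

lemma prob_space_unit_lebesgue: "prob_space leb"
  by (rule prob_spaceI) (simp add: unit_lebesgue_def space_restrict_space emeasure_restrict_space)

lemma measurable_unit_lebesgue [measurable]: "(\<lambda>x. x) \<in> borel_measurable leb"
  unfolding unit_lebesgue_def by (rule measurable_restrict_space1) simp

lemma borel_measurable_unit_lebesgueI:
  "f \<in> borel_measurable borel \<Longrightarrow> f \<in> borel_measurable leb"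
  unfolding unit_lebesgue_def by (rule measurable_restrict_space1) simp

lemma lsv_deriv_pos: "0 < b \<Longrightarrow> 0 \<le> x \<Longrightarrow> 0 < lsv_deriv b x"
  by (auto simp: lsv_deriv_def intro!: add_pos_nonneg)

lemma lsv_left_eq: "0 \<le> x \<Longrightarrow> x < 1/2 \<Longrightarrow> lsv b x = x * (1 + (2 * x) powr b)"
  by (simp add: lsv_def powr_mult)

lemma lsv_left_strict_mono:
  assumes b: "0 < b" and "0 \<le> x" "x < y" "y < 1/2"
  shows "lsv b x < lsv b y"
proof -
  have "(2 * x) powr b < (2 * y) powr b"
    using assms by (intro powr_less_mono2) auto
  then have "x * (1 + (2 * x) powr b) < y * (1 + (2 * y) powr b)"
    using assms by (intro mult_strict_mono) (auto intro: add_pos_nonneg)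
  then show ?thesis using assms by (simp add: lsv_left_eq)
qed

lemma lsv_left_bounds:
  assumes b: "0 < b" and x: "0 \<le> x" "x < 1/2"
  shows "x \<le> lsv b x" "lsv b x < 1"
proof -
  have *: "(2 * x) powr b < 1"
  proof (cases "x = 0")
    case False
    then have "(2 * x) powr b < 1 powr b" using assms by (intro powr_less_mono2) auto
    then show ?thesis by simp
  qed (use b in simp)
  show "x \<le> lsv b x"
    using x by (simp add: lsv_left_eq algebra_simps)
  have "x * (1 + (2 * x) powr b) \<le> x * 2" using * x by (intro mult_left_mono) auto
  then show "lsv b x < 1" using x by (simp add: lsv_left_eq)
qed

lemma bij_betw_lsv_left:
  assumes b: "0 < b"
  shows "bij_betw (lsv b) {0..<1/2} {0..<1}"
proof -
  have inj: "inj_on (lsv b) {0..<1/2}"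
    using lsv_left_strict_mono[OF b] by (intro linorder_inj_onI) force+
  have "z \<in> lsv b ` {0..<1/2}" if z: "0 \<le> z" "z < 1" for z
  proof -
    let ?G = "\<lambda>y::real. y * (1 + (2 * y) powr b)"
    have "continuous_on {0..1/2} ?G"
      using b by (intro continuous_intros continuous_on_powr') auto
    then obtain y where y: "0 \<le> y" "y \<le> 1/2" "?G y = z"
      using IVT'[of ?G 0 z "1/2"] z by auto
    have "?G (1/2) = 1" by simp
    then have "y \<noteq> 1/2" using z y(3) by force
    with y have "y < 1/2" by simp
    then show ?thesis using y by (auto simp: lsv_left_eq intro!: rev_image_eqI[of y])
  qed
  then have "{0..<1} \<subseteq> lsv b ` {0..<1/2}" by auto
  moreover have "lsv b ` {0..<1/2} \<subseteq> {0..<1}"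
    using lsv_left_bounds[OF b] by (force intro: order_trans[OF _ lsv_left_bounds(1)[OF b]])
  ultimately have "lsv b ` {0..<1/2} = {0..<1}" by (rule equalityI[rotated])
  then show ?thesis using inj by (simp add: bij_betw_def)
qed

definition left_inverse :: "real \<Rightarrow> real \<Rightarrow> real" where
  "left_inverse b x = (if x \<in> {0..<1} then inv_into {0..<1/2} (lsv b) x else 0)"

lemma left_inverse:
  assumes "0 < b" "0 \<le> x" "x < 1"
  shows "0 \<le> left_inverse b x" "left_inverse b x < 1/2" "lsv b (left_inverse b x) = x"
proof -
  have *: "lsv b ` {0..<1/2} = {0..<1}"
    using bij_betw_lsv_left[OF assms(1)] by (simp add: bij_betw_def)
  then have "x \<in> lsv b ` {0..<1/2}" using assms by auto
  from inv_into_into[OF this] f_inv_into_f[OF this] show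
    "0 \<le> left_inverse b x" "left_inverse b x < 1/2" "lsv b (left_inverse b x) = x"
    using assms by (auto simp: left_inverse_def)
qed

lemma left_inverse_lsv:
  assumes "0 < b" "0 \<le> y" "y < 1/2"
  shows "left_inverse b (lsv b y) = y"
  using bij_betw_inv_into_left[OF bij_betw_lsv_left[OF assms(1)], of y] lsv_left_bounds[OF assms] assms
  by (auto simp: left_inverse_def)

lemma left_inverse_pos: "0 < b \<Longrightarrow> 0 < x \<Longrightarrow> x < 1 \<Longrightarrow> 0 < left_inverse b x"
  using left_inverse[of b x] by (cases "left_inverse b x = 0") (auto simp: lsv_def)

lemma left_inverse_strict_mono:
  assumes "0 < b" "0 \<le> x" "x < y" "y < 1"
  shows "left_inverse b x < left_inverse b y"
proof (rule ccontr)
  assume "\<not> ?thesis"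
  then have "left_inverse b y \<le> left_inverse b x" by simp
  moreover have "left_inverse b y \<noteq> left_inverse b x"
    using left_inverse[of b x] left_inverse[of b y] assms by force
  ultimately have "lsv b (left_inverse b y) < lsv b (left_inverse b x)"
    using left_inverse[of b x] left_inverse[of b y] assms by (intro lsv_left_strict_mono) auto
  then show False using left_inverse[of b x] left_inverse[of b y] assms by simp
qed

lemma left_inverse_measurable:
  assumes "0 < b"
  shows "left_inverse b \<in> measurable leb leb"
proof -
  have "mono_on {0..<1} (left_inverse b)"
    using left_inverse_strict_mono[OF assms] by (intro mono_onI) (metis atLeastLessThan_iff order_le_less order_refl)
  then have "left_inverse b \<in> borel_measurable (restrict_space borel {0..<1})"
    by (rule borel_measurable_mono_on_fnc)
  then have "(\<lambda>x. indicator {0..<1} x *\<^sub>R left_inverse b x) \<in> borel_measurable borel"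
    by (subst (asm) borel_measurable_restrict_space_iff) auto
  also have "(\<lambda>x. indicator {0..<1} x *\<^sub>R left_inverse b x) = left_inverse b"
    by (auto simp: left_inverse_def indicator_def)
  finally have "left_inverse b \<in> borel_measurable leb"
    by (rule borel_measurable_unit_lebesgueI)
  moreover have "left_inverse b \<in> space leb \<rightarrow> {0..1}"
    using left_inverse[OF assms] by (force simp: left_inverse_def)
  ultimately have "left_inverse b \<in> measurable leb (restrict_space borel {0..1})"
    by (rule measurable_restrict_space2[rotated])
  then show ?thesis
    using measurable_cong_sets[OF refl sets_unit_lebesgue] by blast
qed

lemma measurable_into_unit_lebesgueI:
  assumes "f \<in> borel_measurable M" "\<And>x. x \<in> space M \<Longrightarrow> f x \<in> {0..1}"
  shows "f \<in> measurable M leb"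
proof -
  have "f \<in> measurable M (restrict_space borel {0..1})"
    using assms by (intro measurable_restrict_space2) auto
  then show ?thesis
    using measurable_cong_sets[OF refl sets_unit_lebesgue] by blast
qed

lemma lsv_range: "0 < b \<Longrightarrow> x \<in> {0..1} \<Longrightarrow> lsv b x \<in> {0..1}"
  using lsv_left_bounds[of b x] by (cases "x < 1/2") (auto simp: lsv_def[of b x])

lemma lsv_measurable:
  assumes "0 < b" shows "lsv b \<in> measurable leb leb"
proof (rule measurable_into_unit_lebesgueI)
  have "lsv b \<in> borel_measurable borel" unfolding lsv_def by measurable
  then show "lsv b \<in> borel_measurable leb" by (rule borel_measurable_unit_lebesgueI)
qed (use lsv_range[OF assms] in simp)

lemma lsv_deriv_measurable [measurable]: "lsv_deriv b \<in> borel_measurable leb"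
proof -
  have "lsv_deriv b \<in> borel_measurable borel" unfolding lsv_deriv_def by measurable
  then show ?thesis by (rule borel_measurable_unit_lebesgueI)
qed

definition left_transfer :: "real \<Rightarrow> (real \<Rightarrow> real) \<Rightarrow> real \<Rightarrow> real" where
  "left_transfer b f x = (if x \<in> {0..<1} then f (left_inverse b x) / lsv_deriv b (left_inverse b x) else 0)"

definition right_transfer :: "(real \<Rightarrow> real) \<Rightarrow> real \<Rightarrow> real" where
  "right_transfer f x = (if x \<in> {0..1} then f ((x + 1) / 2) / 2 else 0)"

lemma lsv_transfer_eq:
  assumes b: "0 < b"
  shows "lsv_transfer b f x = left_transfer b f x + right_transfer f x"
proof -
  have lsv_right: "lsv b y = 2 * y - 1" if "1/2 \<le> y" for y using that by (simp add: lsv_def)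
  have sp: "{y\<in>{0..1}. lsv b y = x} =
      (if x \<in> {0..<1} then {left_inverse b x} else {}) \<union> (if x \<in> {0..1} then {(x + 1) / 2} else {})"
    (is "?A = ?B")
  proof (intro set_eqI iffI)
    fix y assume y: "y \<in> ?A"
    show "y \<in> ?B"
    proof (cases "y < 1/2")
      case True
      then show ?thesis using y left_inverse_lsv[OF b, of y] lsv_left_bounds[OF b, of y] by auto
    next
      case False
      then show ?thesis using y by (auto simp: lsv_def)
    qed
  next
    fix y assume "y \<in> ?B"
    then show "y \<in> ?A"
      using left_inverse[OF b, of x] by (auto split: if_splits simp: lsv_right)
  qed
  have ne: "x \<in> {0..<1} \<Longrightarrow> left_inverse b x \<noteq> (x + 1) / 2"
    using left_inverse[OF b, of x] by auto
  have d: "x \<in> {0..1} \<Longrightarrow> lsv_deriv b ((x + 1) / 2) = 2" by (auto simp: lsv_deriv_def)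
  show ?thesis
    unfolding lsv_transfer_def sp left_transfer_def right_transfer_def
    using ne d by auto
qed

lemma left_transfer_measurable:
  assumes b: "0 < b" and f [measurable]: "f \<in> borel_measurable leb"
  shows "left_transfer b f \<in> borel_measurable leb"
proof -
  note [measurable] = left_inverse_measurable[OF b]
  show ?thesis unfolding left_transfer_def by measurable
qed

lemma right_transfer_measurable:
  assumes f [measurable]: "f \<in> borel_measurable leb"
  shows "right_transfer f \<in> borel_measurable leb"
proof -
  have [measurable]: "(\<lambda>x. (x + 1) / 2) \<in> measurable leb leb"
    by (rule measurable_into_unit_lebesgueI) auto
  show ?thesis unfolding right_transfer_def by measurable
qed

lemma lsv_transfer_measurable:
  assumes "0 < b" "f \<in> borel_measurable leb"
  shows "lsv_transfer b f \<in> borel_measurable leb"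
proof -
  have "lsv_transfer b f = (\<lambda>x. left_transfer b f x + right_transfer f x)"
    using lsv_transfer_eq[OF assms(1)] by blast
  then show ?thesis
    using left_transfer_measurable[OF assms] right_transfer_measurable[OF assms(2)] by simp
qed

lemma nn_integral_unit_lebesgue:
  "(\<integral>\<^sup>+x. f x \<partial>leb) = (\<integral>\<^sup>+x. f x * indicator {0..1} x \<partial>lborel)"
  unfolding unit_lebesgue_def by (rule nn_integral_restrict_space) simp

lemma unit_lebesgue_set_measurable:
  fixes f :: "real \<Rightarrow> real"
  assumes "f \<in> borel_measurable leb"
  shows "set_borel_measurable borel {0..1::real} f"
proof -
  have "f \<in> borel_measurable (restrict_space borel {0..1})"
    using assms measurable_cong_sets[OF sets_unit_lebesgue refl] by blast
  then show ?thesis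
    unfolding set_borel_measurable_def by (subst (asm) borel_measurable_restrict_space_iff) auto
qed

text \<open>
  The change of variables \<open>x = T y\<close> on \<open>[0,1/2]\<close>. The formula of the left branch is extended to negative
  arguments through \<open>max 0\<close>, since the substitution rule asks for two-sided derivatives at the end points.
\<close>

lemma nn_integral_left_transfer:
  assumes b: "0 < b" and f: "f \<in> borel_measurable leb"
    and g: "g \<in> borel_measurable leb"
  shows "(\<integral>\<^sup>+x. ennreal (left_transfer b f x * g x) \<partial>leb)
    = (\<integral>\<^sup>+x. ennreal (indicator {0..<1/2} x * f x * g (lsv b x)) \<partial>leb)"
proof -
  define T where "T = (\<lambda>y::real. y * (1 + (2 * max 0 y) powr b))"
  define T' where "T' = (\<lambda>y::real. 1 + (1 + b) * (2 * max 0 y) powr b)"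
  let ?F = "\<lambda>x. left_transfer b f x * g x"
  have der: "(T has_real_derivative T' y) (at y)" if y: "y \<in> {0..1/2}" for y
  proof (cases "y = 0")
    case True
    have "((\<lambda>y::real. 1 + (2 * max 0 y) powr b) \<longlongrightarrow> 1 + (2 * max 0 0) powr b) (at 0)"
      using b by (intro tendsto_intros tendsto_powr' tendsto_max) auto
    then have "((\<lambda>y::real. 1 + (2 * max 0 y) powr b) \<longlongrightarrow> 1) (at 0)" by simp
    then have "((\<lambda>y::real. (T y - 0) / (y - 0)) \<longlongrightarrow> 1) (at 0)"
      by (rule Lim_transform_eventually) (simp add: eventually_at_filter T_def)
    then show ?thesis
      using b True by (simp add: has_field_derivative_iff T_def T'_def)
  next
    case False
    with y have y: "0 < y" by simp
    have "((\<lambda>y. y * (1 + (2 * y) powr b)) has_real_derivative T' y) (at y)"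
      using y by (auto intro!: derivative_eq_intros simp: T'_def algebra_simps powr_diff)
    then show ?thesis
      by (rule DERIV_cong_ev[THEN iffD1, rotated 3])
         (use y in \<open>auto simp: T_def eventually_nhds intro!: exI[of _ "{0<..}"]\<close>)
  qed
  have T: "T 0 = 0" "T (1/2) = 1" by (auto simp: T_def)
  have Fm: "set_borel_measurable borel {T 0..T (1/2)} ?F"
    unfolding T by (intro unit_lebesgue_set_measurable borel_measurable_times
      left_transfer_measurable b f g)
  have "continuous_on {0..1/2} T'"
    unfolding T'_def using b by (intro continuous_intros continuous_on_powr') auto
  note cont = this
  have "(\<integral>\<^sup>+x. ennreal (?F x) * indicator {0..1} x \<partial>lborel) =
      (\<integral>\<^sup>+x. ?F x * indicator {T 0..T (1/2)} x \<partial>lborel)"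
    by (intro nn_integral_cong) (simp add: indicator_def T)
  also have "\<dots> =
      (\<integral>\<^sup>+x. ennreal (?F (T x) * T' x * indicator {0..1/2} x) \<partial>lborel)"
    by (intro nn_integral_substitution Fm der cont) (use b in \<open>auto simp: T'_def intro!: add_nonneg_nonneg mult_nonneg_nonneg\<close>)
  also have "\<dots> = (\<integral>\<^sup>+x. ennreal (indicator {0..<1/2} x * f x * g (lsv b x)) * indicator {0..1} x \<partial>lborel)"
  proof (rule nn_integral_cong_AE)
    have "AE x in lborel. x \<noteq> (1/2::real)" by (rule AE_lborel_singleton)
    then show "AE x in lborel. ennreal (?F (T x) * T' x * indicator {0..1/2} x) =
        ennreal (indicator {0..<1/2} x * f x * g (lsv b x)) * indicator {0..1} x"
    proof (rule AE_mp, intro AE_I2 impI)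
      fix x :: real assume ne: "x \<noteq> 1/2"
      show "ennreal (?F (T x) * T' x * indicator {0..1/2} x) =
        ennreal (indicator {0..<1/2} x * f x * g (lsv b x)) * indicator {0..1} x"
      proof (cases "x \<in> {0..<1/2}")
        case True
        then have "T x = lsv b x" "T' x = lsv_deriv b x"
          by (auto simp: T_def T'_def lsv_left_eq lsv_deriv_def powr_mult)
        moreover have "left_inverse b (lsv b x) = x" using True b by (intro left_inverse_lsv) auto
        moreover have "lsv b x \<in> {0..<1}" using True b lsv_left_bounds[of b x] by auto
        ultimately have "?F (T x) * T' x = f x * g (lsv b x)"
          using lsv_deriv_pos[OF b, of x] True by (simp add: left_transfer_def)
        then show ?thesis using True by simp
      next
        case False
        then show ?thesis using ne by (auto simp: indicator_def)
      qed
    qed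
  qed
  finally show ?thesis unfolding nn_integral_unit_lebesgue .
qed

lemma nn_integral_right_transfer:
  assumes f: "f \<in> borel_measurable leb"
    and g: "g \<in> borel_measurable leb"
  shows "(\<integral>\<^sup>+x. ennreal (right_transfer f x * g x) \<partial>leb)
    = (\<integral>\<^sup>+x. ennreal (indicator {1/2..1} x * f x * g (lsv b x)) \<partial>leb)"
proof -
  let ?F = "\<lambda>x. right_transfer f x * g x" and ?T = "\<lambda>x::real. 2 * x - 1"
  have Fm: "set_borel_measurable borel {?T (1/2)..?T 1} ?F"
    by (simp, intro unit_lebesgue_set_measurable borel_measurable_times
      right_transfer_measurable f g)
  have "(\<integral>\<^sup>+x. ennreal (?F x) * indicator {0..1} x \<partial>lborel) =
      (\<integral>\<^sup>+x. ?F x * indicator {?T (1/2)..?T 1} x \<partial>lborel)"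
    by (intro nn_integral_cong) (simp add: indicator_def)
  also have "\<dots> =
      (\<integral>\<^sup>+x. ennreal (?F (?T x) * 2 * indicator {1/2..1} x) \<partial>lborel)"
    by (intro nn_integral_substitution Fm) (auto intro!: derivative_eq_intros)
  also have "\<dots> = (\<integral>\<^sup>+x. ennreal (indicator {1/2..1} x * f x * g (lsv b x)) * indicator {0..1} x \<partial>lborel)"
    by (intro nn_integral_cong) (auto simp: indicator_def right_transfer_def lsv_def)
  finally show ?thesis unfolding nn_integral_unit_lebesgue .
qed

section \<open>Transport of densities\<close>

interpretation leb: prob_space leb
  by (rule prob_space_unit_lebesgue)

text \<open>Densities are not normalised: the parts of a probability density are densities as well.\<close>

definition is_density :: "(real \<Rightarrow> real) \<Rightarrow> bool" where
  "is_density f \<longleftrightarrow> integrable leb f \<and> (\<forall>x\<in>{0..1}. 0 \<le> f x)"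

lemma is_densityD:
  assumes "is_density f"
  shows "integrable leb f" "f \<in> borel_measurable leb"
    "x \<in> {0..1} \<Longrightarrow> 0 \<le> f x"
  using assms by (auto simp: is_density_def)

lemma is_densityI_nn_integral:
  assumes "f \<in> borel_measurable leb" "\<And>x. x \<in> {0..1} \<Longrightarrow> 0 \<le> f x"
    and "(\<integral>\<^sup>+x. ennreal (f x) \<partial>leb) < \<infinity>"
  shows "is_density f"
  unfolding is_density_def using assms by (auto intro!: integrableI_nonneg AE_I2)

lemma nn_integral_density_finite:
  "is_density f \<Longrightarrow> (\<integral>\<^sup>+x. ennreal (f x) \<partial>leb) < \<infinity>"
  by (subst nn_integral_eq_integral) (auto simp: is_density_def intro!: AE_I2)

lemma integral_density_nonneg: "is_density f \<Longrightarrow> 0 \<le> (\<integral>x. f x \<partial>leb)"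
  by (intro integral_nonneg_AE AE_I2) (auto simp: is_density_def)

lemma is_density_add: "is_density f \<Longrightarrow> is_density g \<Longrightarrow> is_density (\<lambda>x. f x + g x)"
  by (auto simp: is_density_def)

lemma is_density_cmult: "is_density f \<Longrightarrow> 0 \<le> c \<Longrightarrow> is_density (\<lambda>x. c * f x)"
  by (auto simp: is_density_def)

lemma is_density_const: "0 \<le> c \<Longrightarrow> is_density (\<lambda>_. c)"
  by (auto simp: is_density_def)

lemma sets_unit_lebesgueI: "A \<in> sets borel \<Longrightarrow> A \<subseteq> {0..1} \<Longrightarrow> A \<in> sets leb"
  by (auto simp: sets_unit_lebesgue sets_restrict_space_iff)

lemma AE_unit_lebesgue_interior: "AE x in leb. x \<in> {0<..<1}"
proof -
  have "AE x in lborel. x \<in> {0..1} \<longrightarrow> x \<in> {0<..<1::real}"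
    using AE_lborel_singleton[of 0] AE_lborel_singleton[of 1] by eventually_elim auto
  then show ?thesis
    unfolding unit_lebesgue_def by (subst AE_restrict_space_iff) auto
qed

lemma left_transfer_nonneg:
  "0 < b \<Longrightarrow> (\<And>x. x \<in> {0..1} \<Longrightarrow> 0 \<le> f x) \<Longrightarrow> 0 \<le> left_transfer b f x"
  using left_inverse[of b x] lsv_deriv_pos[of b "left_inverse b x"]
  by (auto simp: left_transfer_def intro!: divide_nonneg_pos)

lemma right_transfer_nonneg:
  "(\<And>x. x \<in> {0..1} \<Longrightarrow> 0 \<le> f x) \<Longrightarrow> 0 \<le> right_transfer f x"
  by (auto simp: right_transfer_def)

text \<open>
  The set \<open>A\<close> is kept because the mass that remains on the left for a long time is followed through
  the left branch alone.
\<close>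

lemma left_transfer_mass:
  assumes b: "0 < b" and f: "is_density f" and A: "A \<in> sets leb"
  shows "is_density (left_transfer b f)"
    and "(\<integral>x. left_transfer b f x * indicator A x \<partial>leb)
      = (\<integral>x. indicator {0..<1/2} x * f x * indicator A (lsv b x) \<partial>leb)"
proof -
  note [measurable] = is_densityD(2)[OF f] left_transfer_measurable[OF b is_densityD(2)[OF f]]
    lsv_measurable[OF b]
  have half [measurable]: "{0..<1/2} \<in> sets leb" by (rule sets_unit_lebesgueI) auto
  note [measurable] = A
  have nn: "0 \<le> left_transfer b f x" for x
    using b is_densityD(3)[OF f] by (rule left_transfer_nonneg)
  have "(\<integral>\<^sup>+x. ennreal (left_transfer b f x * 1) \<partial>leb)
      = (\<integral>\<^sup>+x. ennreal (indicator {0..<1/2} x * f x * 1) \<partial>leb)"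
    by (rule nn_integral_left_transfer[OF b, where g = "\<lambda>_. 1"]) measurable
  also have "\<dots> \<le> (\<integral>\<^sup>+x. ennreal (f x) \<partial>leb)"
    using is_densityD(3)[OF f] by (intro nn_integral_mono) (auto simp: indicator_def)
  also have "\<dots> < \<infinity>" by (rule nn_integral_density_finite[OF f])
  finally show "is_density (left_transfer b f)"
    using nn by (intro is_densityI_nn_integral) auto
  show "(\<integral>x. left_transfer b f x * indicator A x \<partial>leb)
      = (\<integral>x. indicator {0..<1/2} x * f x * indicator A (lsv b x) \<partial>leb)"
    using nn is_densityD(3)[OF f]
    by (subst (1 2) integral_eq_nn_integral)
       (auto intro!: AE_I2 arg_cong[where f = enn2real] nn_integral_left_transfer[OF b])
qed

lemma right_transfer_mass:
  assumes f: "is_density f"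
  shows "is_density (right_transfer f)"
    and "(\<integral>x. right_transfer f x \<partial>leb)
      = (\<integral>x. f x * indicator {1/2..<1} x \<partial>leb)"
proof -
  note [measurable] = is_densityD(2)[OF f] right_transfer_measurable[OF is_densityD(2)[OF f]]
  have half [measurable]: "{1/2..<1} \<in> sets leb" "{1/2..1} \<in> sets leb"
    by (rule sets_unit_lebesgueI; auto)+
  have nn: "0 \<le> right_transfer f x" for x
    using is_densityD(3)[OF f] by (rule right_transfer_nonneg)
  have eq: "(\<integral>\<^sup>+x. ennreal (right_transfer f x * 1) \<partial>leb)
      = (\<integral>\<^sup>+x. ennreal (indicator {1/2..1} x * f x * 1) \<partial>leb)"
    by (rule nn_integral_right_transfer[where g = "\<lambda>_. 1"]) measurable
  also have "\<dots> \<le> (\<integral>\<^sup>+x. ennreal (f x) \<partial>leb)"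
    using is_densityD(3)[OF f] by (intro nn_integral_mono) (auto simp: indicator_def)
  also have "\<dots> < \<infinity>" by (rule nn_integral_density_finite[OF f])
  finally show "is_density (right_transfer f)"
    using nn by (intro is_densityI_nn_integral) auto
  have "(\<integral>\<^sup>+x. ennreal (indicator {1/2..1} x * f x * 1) \<partial>leb)
      = (\<integral>\<^sup>+x. ennreal (f x * indicator {1/2..<1} x) \<partial>leb)"
    by (rule nn_integral_cong_AE) (use AE_unit_lebesgue_interior in \<open>eventually_elim, auto simp: indicator_def\<close>)
  with eq show "(\<integral>x. right_transfer f x \<partial>leb)
      = (\<integral>x. f x * indicator {1/2..<1} x \<partial>leb)"
    using nn is_densityD(3)[OF f]
    by (subst (1 2) integral_eq_nn_integral) (auto intro!: AE_I2)
qed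

lemma integral_split_halves:
  fixes f :: "real \<Rightarrow> real"
  assumes f: "integrable leb f"
  shows "(\<integral>x. f x \<partial>leb) = (\<integral>x. f x * indicator {0..<1/2} x \<partial>leb)
    + (\<integral>x. f x * indicator {1/2..<1} x \<partial>leb)"
proof -
  have "{0..<1/2} \<in> sets leb" "{1/2..<1} \<in> sets leb"
    by (rule sets_unit_lebesgueI; auto)+
  note i = integrable_real_mult_indicator[OF this(1) f] integrable_real_mult_indicator[OF this(2) f]
  have "(\<integral>x. f x \<partial>leb)
      = (\<integral>x. f x * indicator {0..<1/2} x + f x * indicator {1/2..<1} x \<partial>leb)"
    using i f by (intro integral_cong_AE)
      (auto intro: borel_measurable_integrable Bochner_Integration.integrable_add
        intro!: eventually_mono[OF AE_unit_lebesgue_interior] simp: indicator_def)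
  also have "\<dots> = (\<integral>x. f x * indicator {0..<1/2} x \<partial>leb)
    + (\<integral>x. f x * indicator {1/2..<1} x \<partial>leb)"
    using i by (rule Bochner_Integration.integral_add)
  finally show ?thesis .
qed

lemma left_transfer_mass_total:
  assumes b: "0 < b" and f: "is_density f"
  shows "(\<integral>x. left_transfer b f x \<partial>leb) = (\<integral>x. f x * indicator {0..<1/2} x \<partial>leb)"
proof -
  have "(\<integral>x. left_transfer b f x * indicator {0..1} x \<partial>leb)
      = (\<integral>x. indicator {0..<1/2} x * f x * indicator {0..1} (lsv b x) \<partial>leb)"
    by (rule left_transfer_mass(2)[OF b f]) (rule sets_unit_lebesgueI; auto)
  moreover have "(\<integral>x. left_transfer b f x * indicator {0..1} x \<partial>leb)
      = (\<integral>x. left_transfer b f x \<partial>leb)"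
    by (intro Bochner_Integration.integral_cong) auto
  moreover have "(\<integral>x. indicator {0..<1/2} x * f x * indicator {0..1} (lsv b x) \<partial>leb)
      = (\<integral>x. f x * indicator {0..<1/2} x \<partial>leb)"
    using lsv_range[OF b] by (intro Bochner_Integration.integral_cong) auto
  ultimately show ?thesis by simp
qed

lemma lsv_transfer_density:
  assumes b: "0 < b" and f: "is_density f"
  shows "is_density (lsv_transfer b f)"
    and "(\<integral>x. lsv_transfer b f x \<partial>leb) = (\<integral>x. f x \<partial>leb)"
proof -
  have eq: "lsv_transfer b f = (\<lambda>x. left_transfer b f x + right_transfer f x)"
    using lsv_transfer_eq[OF b] by blast
  have l: "is_density (left_transfer b f)"
    by (rule left_transfer_mass(1)[OF b f sets.empty_sets])
  note r = right_transfer_mass(1)[OF f]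
  show "is_density (lsv_transfer b f)"
    unfolding eq by (rule is_density_add[OF l r])
  show "(\<integral>x. lsv_transfer b f x \<partial>leb) = (\<integral>x. f x \<partial>leb)"
    unfolding eq using is_densityD(1)[OF l] is_densityD(1)[OF r]
    by (simp add: left_transfer_mass_total[OF b f] right_transfer_mass(2)[OF f]
        integral_split_halves[OF is_densityD(1)[OF f]])
qed

lemma lsv_transfer_linear:
  "lsv_transfer b (\<lambda>x. c * f x + d * g x) y = c * lsv_transfer b f y + d * lsv_transfer b g y"
  by (simp add: lsv_transfer_def sum.distrib sum_distrib_left add_divide_distrib)

lemma lsv_transfer_mono:
  assumes "0 < b" "\<And>x. x \<in> {0..1} \<Longrightarrow> f x \<le> g x"
  shows "lsv_transfer b f y \<le> lsv_transfer b g y"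
  unfolding lsv_transfer_def
  using assms(2) by (intro sum_mono divide_right_mono less_imp_le[OF lsv_deriv_pos[OF assms(1)]]) auto

text \<open>Only interior points contribute to the values at interior points.\<close>

lemma lsv_transfer_mono_interior:
  assumes b: "0 < b" and y: "y \<in> {0<..<1}" and le: "\<And>x. x \<in> {0<..<1} \<Longrightarrow> f x \<le> g x"
  shows "lsv_transfer b f y \<le> lsv_transfer b g y"
proof -
  have "x \<in> {0<..<1}" if "x \<in> {0..1}" "lsv b x = y" for x
    using that y by (cases "x = 0"; cases "x = 1") (auto simp: lsv_def)
  then show ?thesis
    unfolding lsv_transfer_def
    using lsv_deriv_pos[OF b] le by (intro sum_mono divide_right_mono) (auto intro: less_imp_le)
qed

lemma lsv_transfer_cong_interior:
  assumes b: "0 < b" and y: "y \<in> {0<..<1}" and eq: "\<And>x. x \<in> {0<..<1} \<Longrightarrow> f x = g x"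
  shows "lsv_transfer b f y = lsv_transfer b g y"
  using lsv_transfer_mono_interior[OF b y, of f g] lsv_transfer_mono_interior[OF b y, of g f] eq
  by force

section \<open>Regular densities\<close>

text \<open>
  Regularity with exponent \<open>K\<close> says that \<open>log f\<close> is \<open>K\<close>-Lipschitz in the variable \<open>log x\<close>. It is stated as
  a Harnack inequality, which is meaningful without derivatives and admits zeros only for \<open>f = 0\<close>;
  the distance \<open>\<bar>log x - log y\<bar>\<close> appears as the logarithm of \<open>ratio x y\<close>.
\<close>

definition ratio :: "real \<Rightarrow> real \<Rightarrow> real" where
  "ratio x y = max (x / y) (y / x)"

definition regular :: "nat \<Rightarrow> real set \<Rightarrow> (real \<Rightarrow> real) \<Rightarrow> bool" where
  "regular K S f \<longleftrightarrow> (\<forall>x\<in>S. \<forall>y\<in>S. 0 \<le> f x \<and> f x \<le> f y * ratio x y ^ K)"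

lemma ratio_commute: "ratio x y = ratio y x"
  by (simp add: ratio_def max.commute)

lemma ratio_ge_1: "0 < x \<Longrightarrow> 0 < y \<Longrightarrow> 1 \<le> ratio x y"
  by (auto simp: ratio_def le_max_iff_disj)

lemma ratio_eq: "0 < x \<Longrightarrow> x \<le> y \<Longrightarrow> ratio x y = y / x"
  by (auto simp: ratio_def max_def field_simps) (smt (verit) mult_mono)

lemma regularI:
  assumes "S \<subseteq> {0<..}" "\<And>x. x \<in> S \<Longrightarrow> 0 \<le> f x"
    and "\<And>x y. x \<in> S \<Longrightarrow> y \<in> S \<Longrightarrow> x < y \<Longrightarrow> f x \<le> f y * (y / x) ^ K \<and> f y \<le> f x * (y / x) ^ K"
  shows "regular K S f"
  unfolding regular_def
proof (intro ballI conjI)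
  fix x y assume xy: "x \<in> S" "y \<in> S"
  then have pos: "0 < x" "0 < y" using assms(1) by auto
  consider "x < y" | "x = y" | "y < x" by linarith
  then show "f x \<le> f y * ratio x y ^ K"
  proof cases
    case 2 then show ?thesis using pos by (simp add: ratio_eq)
  next
    case 1 then show ?thesis using assms(3)[OF xy] pos by (simp add: ratio_eq)
  next
    case 3 then show ?thesis using assms(3)[OF xy(2,1)] pos by (simp add: ratio_eq ratio_commute[of x])
  qed
qed (use assms in auto)

lemma regularD:
  assumes "regular K S f" "x \<in> S" "y \<in> S"
  shows "0 \<le> f x" "f x \<le> f y * ratio x y ^ K"
  using assms by (auto simp: regular_def)

lemma regular_subset: "regular K S f \<Longrightarrow> T \<subseteq> S \<Longrightarrow> regular K T f"
  by (auto simp: regular_def)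

lemma regular_exponent_mono:
  assumes "regular K S f" "K \<le> L" "S \<subseteq> {0<..}"
  shows "regular L S f"
  unfolding regular_def
proof (intro ballI conjI)
  fix x y assume xy: "x \<in> S" "y \<in> S"
  have "f x \<le> f y * ratio x y ^ K" using regularD[OF assms(1) xy] by simp
  also have "\<dots> \<le> f y * ratio x y ^ L"
    using xy assms regularD[OF assms(1) xy(2,1)]
    by (intro mult_left_mono power_increasing ratio_ge_1) auto
  finally show "f x \<le> f y * ratio x y ^ L" .
qed (use regularD[OF assms(1)] in auto)

lemma regular_add: "regular K S f \<Longrightarrow> regular K S g \<Longrightarrow> regular K S (\<lambda>x. f x + g x)"
  unfolding regular_def by (fastforce simp: distrib_right intro: add_mono)

lemma regular_cmult: "regular K S f \<Longrightarrow> 0 \<le> c \<Longrightarrow> regular K S (\<lambda>x. c * f x)"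
  unfolding regular_def by (auto simp: mult.assoc intro: mult_left_mono)

lemma regular_mult:
  assumes "regular K S f" "regular L S g"
  shows "regular (K + L) S (\<lambda>x. f x * g x)"
  unfolding regular_def
proof (intro ballI conjI)
  fix x y assume xy: "x \<in> S" "y \<in> S"
  have "f x * g x \<le> (f y * ratio x y ^ K) * (g y * ratio x y ^ L)"
    using regularD[OF assms(1) xy] regularD[OF assms(2) xy] by (intro mult_mono) auto
  then show "f x * g x \<le> f y * g y * ratio x y ^ (K + L)" by (simp add: power_add mult_ac)
qed (use regularD[OF assms(1)] regularD[OF assms(2)] in auto)

lemma regular_const: "0 \<le> c \<Longrightarrow> S \<subseteq> {0<..} \<Longrightarrow> regular K S (\<lambda>_. c)"
  by (auto simp: regular_def intro!: mult_left_mono[of 1 _ c, simplified] one_le_power ratio_ge_1)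

text \<open>
  With \<open>R = ratio x y ^ K\<close>, the required inequality \<open>R f(y) - c \<le> R\<^sup>2 (f(y) - c)\<close> factors as
  \<open>0 \<le> (R - 1) (R (f(y) - c) - c)\<close>, and \<open>c \<le> f(y) - c\<close>.
\<close>

lemma regular_subtract:
  assumes f: "regular K S f" and S: "S \<subseteq> {0<..}" and c: "\<And>x. x \<in> S \<Longrightarrow> c \<le> f x / 2"
  shows "regular (2 * K) S (\<lambda>x. f x - c)"
  unfolding regular_def
proof (intro ballI conjI)
  fix x y assume xy: "x \<in> S" "y \<in> S"
  show "0 \<le> f x - c" using c[OF xy(1)] regularD(1)[OF f xy] by linarith
  define R where "R = ratio x y ^ K"
  have R: "1 \<le> R" unfolding R_def using xy S by (intro one_le_power ratio_ge_1) auto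
  have fx: "f x \<le> f y * R" using regularD(2)[OF f xy] by (simp add: R_def)
  have cy: "c \<le> f y - c" "0 \<le> f y - c" using c[OF xy(2)] regularD(1)[OF f xy(2,1)] by linarith+
  have "(f y - c) * 1 \<le> (f y - c) * R" using R cy by (intro mult_left_mono)
  then have "f y - c \<le> (f y - c) * R" by (simp only: mult_1_right)
  with cy(1) have "c \<le> (f y - c) * R" by (rule order_trans)
  then have "0 \<le> (R - 1) * ((f y - c) * R - c)" using R by (intro mult_nonneg_nonneg) auto
  then have "f y * R - c \<le> (f y - c) * (R * R)" by (simp add: algebra_simps)
  with fx show "f x - c \<le> (f y - c) * ratio x y ^ (2 * K)"
    by (simp add: R_def power_add[symmetric] mult_2)
qed

text \<open>A Lipschitz function becomes regular after adding a constant, as \<open>y - x \<le> (y - x) / x\<close> on \<open>(0,1)\<close>.\<close>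

lemma regular_lipschitz_shift:
  assumes g: "L-lipschitz_on {0..1} g" and a: "\<And>x. x \<in> {0..1} \<Longrightarrow> L \<le> g x + a"
  shows "regular 1 {0<..<1} (\<lambda>x. g x + a)"
proof (rule regularI)
  have L: "0 \<le> L" using lipschitz_on_nonneg[OF g] .
  show "0 \<le> g x + a" if "x \<in> {0<..<1}" for x using a[of x] L that by auto
  fix x y :: real assume xy: "x \<in> {0<..<1}" "y \<in> {0<..<1}" "x < y"
  then have "\<bar>g x - g y\<bar> \<le> L * (y - x)"
    using lipschitz_onD[OF g, of x y] by (auto simp: dist_real_def)
  moreover have "L * (y - x) \<le> L * ((y - x) / x)"
    using xy L by (intro mult_left_mono) (auto simp: pos_le_divide_eq intro: mult_left_le)
  moreover have "L * ((y - x) / x) \<le> (g z + a) * ((y - x) / x)" if "z \<in> {0..1}" for z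
    using a[OF that] xy by (intro mult_right_mono) auto
  from this[of x] this[of y] have
    "L * ((y - x) / x) \<le> (g x + a) * ((y - x) / x)" "L * ((y - x) / x) \<le> (g y + a) * ((y - x) / x)"
    using xy by auto
  moreover have "(y - x) / x = y / x - 1" using xy by (simp add: field_simps)
  ultimately have "\<bar>g x - g y\<bar> \<le> (g x + a) * (y / x - 1)" and "\<bar>g x - g y\<bar> \<le> (g y + a) * (y / x - 1)"
    by (metis order_trans)+
  then show "g x + a \<le> (g y + a) * (y / x) ^ 1 \<and> g y + a \<le> (g x + a) * (y / x) ^ 1"
    by (simp add: right_diff_distrib) linarith
qed auto

text \<open>
  On the left branch \<open>T p = p (1 + (2p)\<^sup>b)\<close>, so \<open>T q / T p\<close> exceeds \<open>q / p\<close> by the factor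
  \<open>r = (1 + t) / (1 + s)\<close>, where \<open>s\<close> and \<open>t\<close> are \<open>(2p)\<^sup>b\<close> and \<open>(2q)\<^sup>b\<close>. The quotient of the derivatives is at most
  \<open>r\<^sup>2\<close>. The gain \<open>r ^ K\<close> thus pays for the distortion of the branch exactly when \<open>K \<ge> 2\<close>.
\<close>

lemma regular_left_transfer:
  assumes b: "0 < b" "b \<le> 1" and K: "2 \<le> K" and f: "regular K {0<..<1/2} f"
  shows "regular K {0<..<1} (left_transfer b f)"
proof (rule regularI)
  fix x assume x: "x \<in> {0<..<1::real}"
  then have "left_inverse b x \<in> {0<..<1/2}"
    using left_inverse[of b x] left_inverse_pos[of b x] b by auto
  then show "0 \<le> left_transfer b f x"
    using x lsv_deriv_pos[of b "left_inverse b x"] b regularD(1)[OF f]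
    by (auto simp: left_transfer_def intro!: divide_nonneg_pos)
next
  fix x y assume xy: "x \<in> {0<..<1}" "y \<in> {0<..<1::real}" "x < y"
  define p q where "p = left_inverse b x" and "q = left_inverse b y"
  have pq: "0 < p" "p < q" "q < 1/2" "lsv b p = x" "lsv b q = y"
    unfolding p_def q_def
    using xy b left_inverse[of b x] left_inverse[of b y] left_inverse_pos[of b x]
      left_inverse_strict_mono[of b x y] by auto
  define s t where "s = (2 * p) powr b" and "t = (2 * q) powr b"
  have st: "0 \<le> s" "s \<le> t" unfolding s_def t_def using pq b by (auto intro!: powr_mono2)
  have ex: "x = p * (1 + s)" "y = q * (1 + t)"
    using pq lsv_left_eq[of p b] lsv_left_eq[of q b] by (auto simp: s_def t_def)
  have d: "lsv_deriv b p = 1 + (1 + b) * s" "lsv_deriv b q = 1 + (1 + b) * t"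
    using pq by (auto simp: lsv_deriv_def s_def t_def powr_mult)
  have dpos: "0 < 1 + (1 + b) * s" "0 < 1 + (1 + b) * t"
    using b st by (auto intro!: add_pos_nonneg)
  have rat: "ratio p q = q / p" "ratio q p = q / p" using pq by (auto simp: ratio_eq ratio_commute[of q])
  have fp: "f p \<le> f q * (q / p) ^ K" and fq: "f q \<le> f p * (q / p) ^ K" and nn: "0 \<le> f p" "0 \<le> f q"
    using regularD[OF f, of p q] regularD[OF f, of q p] pq rat by auto
  have yx: "(y / x) ^ K = (q / p) ^ K * ((1 + t) / (1 + s)) ^ K"
    unfolding ex power_mult_distrib[symmetric] by simp
  define r where "r = (1 + t) / (1 + s)"
  have r1: "1 \<le> r" using st by (simp add: r_def)
  have "(1 + (1 + b) * t) / (1 + (1 + b) * s) = 1 + (1 + b) * (t - s) / (1 + (1 + b) * s)"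
    using dpos by (simp add: field_simps)
  also have "\<dots> \<le> 1 + 2 * (t - s) / (1 + s)"
    using st b by (intro add_left_mono frac_le mult_mono) (auto simp: algebra_simps)
  also have "\<dots> = 1 + 2 * (r - 1)" using st by (simp add: r_def field_simps)
  also have "\<dots> \<le> r ^ 2" using zero_le_power2[of "r - 1"] by (simp add: power2_eq_square algebra_simps)
  also have "\<dots> \<le> r ^ K" using K r1 by (rule power_increasing)
  finally have dist: "1 + (1 + b) * t \<le> r ^ K * (1 + (1 + b) * s)" using dpos by (simp add: field_simps)
  have one: "left_transfer b f x = f p / (1 + (1 + b) * s)" "left_transfer b f y = f q / (1 + (1 + b) * t)"
    using xy by (auto simp: left_transfer_def p_def[symmetric] q_def[symmetric] d)
  have qp: "0 \<le> f q * (q / p) ^ K" "0 \<le> f p * (q / p) ^ K" using nn pq by auto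
  have "f p * (1 + (1 + b) * t) \<le> (f q * (q / p) ^ K) * (r ^ K * (1 + (1 + b) * s))"
    using fp dist qp dpos by (intro mult_mono) auto
  then have "f p \<le> (f q * (q / p) ^ K) * (r ^ K * (1 + (1 + b) * s)) / (1 + (1 + b) * t)"
    by (simp only: pos_le_divide_eq[OF dpos(2)])
  also have "\<dots> = f q / (1 + (1 + b) * t) * (y / x) ^ K * (1 + (1 + b) * s)"
    unfolding yx r_def[symmetric] by simp
  finally have A: "f p / (1 + (1 + b) * s) \<le> f q / (1 + (1 + b) * t) * (y / x) ^ K"
    by (simp only: pos_divide_le_eq[OF dpos(1)])
  have "f q / (1 + (1 + b) * t) \<le> (f p * (q / p) ^ K) / (1 + (1 + b) * s)"
    using fq qp st b dpos by (intro frac_le) auto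
  also have "\<dots> = f p / (1 + (1 + b) * s) * ((q / p) ^ K * 1)" by simp
  also have "\<dots> \<le> f p / (1 + (1 + b) * s) * (y / x) ^ K"
    unfolding yx r_def[symmetric] using nn dpos pq r1
    by (intro mult_left_mono) (auto intro!: one_le_power)
  finally show "left_transfer b f x \<le> left_transfer b f y * (y / x) ^ K \<and>
      left_transfer b f y \<le> left_transfer b f x * (y / x) ^ K"
    using A unfolding one by blast
qed auto

text \<open>The inverse \<open>x \<mapsto> (x + 1) / 2\<close> of the right branch at least halves distances in \<open>log x\<close>.\<close>

lemma regular_right_transfer:
  assumes f: "regular (2 * K) {1/2..<1} f"
  shows "regular K {0<..<1} (right_transfer f)"
proof (rule regularI)
  show "0 \<le> right_transfer f x" if "x \<in> {0<..<1}" for x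
    using that regularD(1)[OF f, of "(x+1)/2" "1/2"] by (auto simp: right_transfer_def)
  fix x y assume xy: "x \<in> {0<..<1}" "y \<in> {0<..<1::real}" "x < y"
  define p q where "p = (x + 1) / 2" and "q = (y + 1) / 2"
  have pq: "p \<in> {1/2..<1}" "q \<in> {1/2..<1}" "p < q" using xy by (auto simp: p_def q_def)
  then have rat: "ratio p q = q / p" "ratio q p = q / p" by (auto simp: ratio_eq ratio_commute[of q])
  have "x * y * (y - x) \<le> 1 * (y - x)" using xy by (intro mult_right_mono mult_le_one) auto
  then have "(y + 1) ^ 2 * x \<le> y * (x + 1) ^ 2" by (simp add: power2_eq_square algebra_simps)
  then have "((y + 1) / (x + 1)) ^ 2 \<le> y / x" using xy by (simp add: power_divide field_simps)
  moreover have "q / p = (y + 1) / (x + 1)" 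
    using xy by (simp add: p_def q_def frac_eq_eq algebra_simps)
  ultimately have "(q / p) ^ 2 \<le> y / x" by simp
  then have "((q / p) ^ 2) ^ K \<le> (y / x) ^ K" by (intro power_mono) auto
  then have le: "(q / p) ^ (2 * K) \<le> (y / x) ^ K" by (simp add: power_mult)
  have nn: "0 \<le> f p" "0 \<le> f q" using regularD(1)[OF f pq(1,2)] regularD(1)[OF f pq(2,1)] by auto
  have "f p \<le> f q * (y / x) ^ K" "f q \<le> f p * (y / x) ^ K"
    using regularD(2)[OF f, of p q] regularD(2)[OF f, of q p] pq rat
      mult_left_mono[OF le nn(1)] mult_left_mono[OF le nn(2)] by auto
  then show "right_transfer f x \<le> right_transfer f y * (y / x) ^ K \<and>
      right_transfer f y \<le> right_transfer f x * (y / x) ^ K"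
    using xy by (auto simp: right_transfer_def p_def q_def)
qed auto

lemma regular_lsv_transfer:
  assumes b: "0 < b" "b \<le> 1" and K: "2 \<le> K"
    and f: "regular K {0<..<1/2} f" "regular (2 * K) {1/2..<1} f"
  shows "regular K {0<..<1} (lsv_transfer b f)"
proof -
  have "lsv_transfer b f = (\<lambda>x. left_transfer b f x + right_transfer f x)"
    using lsv_transfer_eq[OF b(1)] by blast
  then show ?thesis
    using regular_add[OF regular_left_transfer[OF b K f(1)] regular_right_transfer[OF f(2)]] by simp
qed

lemma regular_lsv_transfer_interior:
  assumes "0 < b" "b \<le> 1" "2 \<le> K" "regular K {0<..<1} f"
  shows "regular K {0<..<1} (lsv_transfer b f)"
  using assms
  by (intro regular_lsv_transfer regular_exponent_mono[of K _ f "2 * K"]) (auto elim: regular_subset)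

text \<open>The ratio of two points of \<open>[1/2,1)\<close> is at most \<open>2\<close>, so a regular density is comparable there with its mean.\<close>

lemma regular_right_half_bounds:
  assumes f: "is_density f" and r: "regular K {0<..<1} f" and x: "x \<in> {1/2..<1}"
  shows "f x \<le> 2 ^ (K + 1) * (\<integral>x. f x * indicator {1/2..<1} x \<partial>leb)"
    and "2 * (\<integral>x. f x * indicator {1/2..<1} x \<partial>leb) \<le> 2 ^ K * f x"
proof -
  have Y: "{1/2..<1} \<in> sets leb" by (rule sets_unit_lebesgueI) auto
  have mY: "measure leb {1/2..<1} = 1/2"
    unfolding unit_lebesgue_def by (subst measure_restrict_space) auto
  have int: "integrable leb (\<lambda>x. f x * indicator {1/2..<1} x)"
    by (rule integrable_real_mult_indicator[OF Y is_densityD(1)[OF f]])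
  have intc: "integrable leb (\<lambda>x. indicator {1/2..<1} x * c)" for c :: real
    using Y by (auto intro!: integrable_real_indicator leb.emeasure_finite simp: less_top[symmetric])
  have rat: "ratio x y \<le> 2" "1 \<le> ratio x y" if "y \<in> {1/2..<1}" for y
    using x that by (auto simp: ratio_def field_simps le_max_iff_disj)
  have up: "f x \<le> f y * 2 ^ K" and lo: "f y \<le> f x * 2 ^ K" if y: "y \<in> {1/2..<1}" for y
  proof -
    have "f x \<le> f y * ratio x y ^ K" using regularD[OF r, of x y] x y by auto
    also have "\<dots> \<le> f y * 2 ^ K"
      using rat[OF y] regularD(1)[OF r, of y x] x y by (intro mult_left_mono power_mono) auto
    finally show "f x \<le> f y * 2 ^ K" .
    have "f y \<le> f x * ratio x y ^ K" using regularD[OF r, of y x] x y by (auto simp: ratio_commute)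
    also have "\<dots> \<le> f x * 2 ^ K"
      using rat[OF y] regularD(1)[OF r, of x y] x y by (intro mult_left_mono power_mono) auto
    finally show "f y \<le> f x * 2 ^ K" .
  qed
  have ic: "(\<integral>y. indicator {1/2..<1} y * c \<partial>leb) = c / 2" for c :: real
    using Y mY Int_absorb2[of "{1/2..<1}" "{0..1::real}"] by (simp add: subset_eq)
  have "(\<integral>y. indicator {1/2..<1} y * (f x / 2 ^ K) \<partial>leb) \<le> (\<integral>y. f y * indicator {1/2..<1} y \<partial>leb)"
    using up by (intro integral_mono intc int) (auto simp: indicator_def field_simps)
  then show "f x \<le> 2 ^ (K + 1) * (\<integral>x. f x * indicator {1/2..<1} x \<partial>leb)"
    unfolding ic by (simp add: field_simps)
  have "(\<integral>y. f y * indicator {1/2..<1} y \<partial>leb) \<le> (\<integral>y. indicator {1/2..<1} y * (f x * 2 ^ K) \<partial>leb)"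
    using lo by (intro integral_mono intc int) (auto simp: indicator_def field_simps)
  then show "2 * (\<integral>x. f x * indicator {1/2..<1} x \<partial>leb) \<le> 2 ^ K * f x"
    unfolding ic by (simp add: field_simps)
qed

section \<open>Long excursions\<close>

text \<open>
  The sequence \<open>b\<close> lists the parameters of the maps applied at times \<open>0, 1, 2, \<dots>\<close>. The set \<open>stay b l t\<close> consists
  of the points which, placed in \<open>[0,1]\<close> at time \<open>t\<close>, are in \<open>[0,1/2)\<close> at all the times \<open>t, \<dots>, t + l\<close>.
\<close>

primrec stay :: "(nat \<Rightarrow> real) \<Rightarrow> nat \<Rightarrow> nat \<Rightarrow> real set" where
  "stay b 0 t = {0..<1/2}"
| "stay b (Suc l) t = {x\<in>{0..<1/2}. lsv (b t) x \<in> stay b l (Suc t)}"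

definition visits :: "(nat \<Rightarrow> real) \<Rightarrow> real \<Rightarrow> nat \<Rightarrow> nat \<Rightarrow> nat" where
  "visits b \<gamma> s t = card {k\<in>{s..<t}. b k \<le> \<gamma>}"

lemma visits_refl [simp]: "visits b \<gamma> s s = 0"
  by (simp add: visits_def)

lemma visits_split_first:
  "s < t \<Longrightarrow> visits b \<gamma> s t = (if b s \<le> \<gamma> then 1 else 0) + visits b \<gamma> (Suc s) t"
proof -
  assume "s < t"
  then have "{k\<in>{s..<t}. b k \<le> \<gamma>} = (if b s \<le> \<gamma> then {s} else {}) \<union> {k\<in>{Suc s..<t}. b k \<le> \<gamma>}"
    by (auto simp: le_less Suc_le_eq)
  then show ?thesis unfolding visits_def by (auto simp: card_insert_if)
qed

lemma stay_subset: "stay b l t \<subseteq> {0..<1/2}"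
  by (cases l) auto

lemma stay_sets:
  assumes "\<And>k. 0 < b k" shows "stay b l t \<in> sets leb"
proof (induction l arbitrary: t)
  case (Suc l)
  note [measurable] = lsv_measurable[OF assms, of t] Suc.IH[of "Suc t"]
  have half [measurable]: "{0..<1/2} \<in> sets leb" by (rule sets_unit_lebesgueI) auto
  have "stay b (Suc l) t = {x\<in>space leb. x \<in> {0..<1/2} \<and> lsv (b t) x \<in> stay b l (Suc t)}"
    by auto
  also have "\<dots> \<in> sets leb" by measurable
  finally show ?case .
qed (auto intro: sets_unit_lebesgueI)

lemma powr_one_plus_ge:
  assumes "0 < g" "0 \<le> u" "u \<le> (1::real)"
  shows "1 + g * u / 2 \<le> (1 + u) powr g"
proof -
  have "ln (1 / (1 + u)) \<le> 1 / (1 + u) - 1" using assms by (intro ln_le_minus_one) auto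
  then have "u / (1 + u) \<le> ln (1 + u)" using assms by (simp add: ln_div field_simps)
  moreover have "u / 2 \<le> u / (1 + u)" using assms by (intro divide_left_mono) auto
  ultimately have "u / 2 \<le> ln (1 + u)" by linarith
  then have "g * (u / 2) \<le> g * ln (1 + u)" using assms by (intro mult_left_mono) auto
  then have "1 + g * u / 2 \<le> 1 + g * ln (1 + u)" by simp
  also have "\<dots> \<le> exp (g * ln (1 + u))" by (rule exp_ge_add_one_self)
  finally show ?thesis using assms by (simp add: powr_def)
qed

text \<open>
  If \<open>b \<le> g\<close>, then \<open>T x \<ge> x (1 + u)\<close> with \<open>u = (2x)\<^sup>g\<close>, and \<open>(1 + u)\<^sup>g \<ge> 1 + g u / 2\<close>. The decrease
  of \<open>x\<^sup>-\<^sup>g\<close> is then of order \<open>x\<^sup>-\<^sup>g g u\<close>, which is bounded below since \<open>u\<close> is a multiple of \<open>x\<^sup>g\<close>.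
\<close>

lemma lsv_left_powr_drop:
  assumes "0 < b" "b \<le> g" "g \<le> 1" "0 < x" "x < 1/2"
  shows "lsv b x powr (- g) + g / 3 \<le> x powr (- g)"
proof -
  define u where "u = (2 * x) powr g"
  have g: "0 < g" using assms by simp
  have u: "0 < u" "u \<le> 1" unfolding u_def using assms g by (auto intro: powr_le1)
  have "u \<le> (2 * x) powr b" unfolding u_def using assms by (intro powr_mono') auto
  then have "x * (1 + u) \<le> lsv b x" using assms by (simp add: lsv_left_eq)
  then have "(x * (1 + u)) powr g \<le> lsv b x powr g" using assms u g by (intro powr_mono2) auto
  moreover have "x powr g * (1 + g * u / 2) \<le> (x * (1 + u)) powr g"
    using assms u powr_one_plus_ge[OF g, of u] by (simp add: powr_mult mult_left_mono)
  ultimately have le: "x powr g * (1 + g * u / 2) \<le> lsv b x powr g" by linarith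
  have xg: "0 < x powr g" using assms by simp
  have v: "0 < 1 + g * u / 2" using g u by (auto intro: add_pos_nonneg)
  have "lsv b x powr (- g) \<le> 1 / (x powr g * (1 + g * u / 2))"
    unfolding powr_minus_divide using le xg v mult_pos_pos[OF xg v] by (intro divide_left_mono mult_pos_pos) linarith+
  moreover have "1 / x powr g - 1 / (x powr g * (1 + g * u / 2)) = (g * u / 2) / (x powr g * (1 + g * u / 2))"
  proof -
    have "1 / x powr g = (1 + g * u / 2) / (x powr g * (1 + g * u / 2))" using v by simp
    then show ?thesis by (simp only: diff_divide_distrib[symmetric]) simp
  qed
  moreover have "g / 3 \<le> (g * u / 2) / (x powr g * (1 + g * u / 2))"
  proof -
    have "x powr g \<le> u" unfolding u_def using assms g by (intro powr_mono2) auto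
    then have "x powr g * (1 + g * u / 2) \<le> u * (3 / 2)"
    proof (rule mult_mono)
      show "1 + g * u / 2 \<le> 3 / 2" using u g assms mult_mono[of g 1 u 1] by simp
    qed (use u v in linarith)+
    then have "g * (x powr g * (1 + g * u / 2)) \<le> g * (u * (3 / 2))" using g by (intro mult_left_mono) auto
    then show ?thesis using xg v by (simp add: pos_le_divide_eq mult_pos_pos)
  qed
  ultimately show ?thesis by (simp add: powr_minus_divide)
qed

lemma stay_powr_bound:
  assumes b: "\<And>k. 0 < b k" and g: "0 < g" "g \<le> 1"
  shows "x \<in> stay b l t \<Longrightarrow> 0 < x \<Longrightarrow> g / 3 * visits b g t (t + l) \<le> x powr (- g)"
proof (induction l arbitrary: x t)
  case (Suc l)
  let ?y = "lsv (b t) x"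
  have x: "x \<in> {0..<1/2}" and y: "?y \<in> stay b l (Suc t)" using Suc.prems by auto
  have xy: "x \<le> ?y" using lsv_left_bounds[OF b, of x t] x by auto
  have IH: "g / 3 * visits b g (Suc t) (t + Suc l) \<le> ?y powr (- g)"
    using Suc.IH[OF y] xy Suc.prems by simp
  show ?case
  proof (cases "b t \<le> g")
    case True
    then have "?y powr (- g) + g / 3 \<le> x powr (- g)"
      using x Suc.prems g b by (intro lsv_left_powr_drop) auto
    then show ?thesis using IH True by (simp add: visits_split_first[of t] distrib_left)
  next
    case False
    have "?y powr (- g) \<le> x powr (- g)" using xy Suc.prems g by (intro powr_mono2') auto
    then show ?thesis using IH False by (simp add: visits_split_first[of t])
  qed
qed simp

lemma measure_stay_le:
  fixes a :: real
  assumes b: "\<And>k. 0 < b k" and g: "0 < g" "g \<le> 1" and a: "0 < a" "a \<le> visits b g t (t + l)"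
  shows "measure leb (stay b l t) \<le> (g / 3 * a) powr (- 1 / g)"
proof -
  define z where "z = (g / 3 * a) powr (- 1 / g)"
  have z: "0 < z" using a g by (simp add: z_def)
  have "stay b l t \<subseteq> {0..min z 1}"
  proof
    fix x assume x: "x \<in> stay b l t"
    show "x \<in> {0..min z 1}"
    proof (cases "x = 0")
      case False
      then have x0: "0 < x" using x stay_subset[of b l t] by force
      have "g / 3 * a \<le> g / 3 * visits b g t (t + l)" using a g by (intro mult_left_mono) auto
      also have "\<dots> \<le> x powr (- g)" by (rule stay_powr_bound[of b, OF b g x x0])
      finally have "(x powr (- g)) powr (- 1 / g) \<le> z"
        unfolding z_def using a g by (intro powr_mono2') (auto simp: divide_nonpos_pos)
      moreover have "(x powr (- g)) powr (- 1 / g) = x" using x0 g by (simp add: powr_powr)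
      ultimately show ?thesis using x0 x stay_subset[of b l t] by force
    qed (use z in auto)
  qed
  then have "measure leb (stay b l t) \<le> measure leb {0..min z 1}"
    by (intro leb.finite_measure_mono sets_unit_lebesgueI) auto
  also have "\<dots> \<le> z"
    unfolding unit_lebesgue_def using z by (subst measure_restrict_space) auto
  finally show ?thesis unfolding z_def .
qed

text \<open>
  Comparison with a telescoping sum: \<open>s (n + 1)\<^sup>-\<^sup>1\<^sup>-\<^sup>s \<le> n\<^sup>-\<^sup>s - (n + 1)\<^sup>-\<^sup>s\<close>, because
  \<open>(1 - v)\<^sup>-\<^sup>s \<ge> 1 + s v\<close> for \<open>v = 1 / (n + 1)\<close>.
\<close>

lemma sum_powr_tail:
  assumes s: "0 < s" and l: "1 \<le> l"
  shows "(\<Sum>k\<in>{l..l + t}. real k powr (- 1 - s)) \<le> (1 + 1 / s) * real l powr (- s)"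
proof -
  have step: "real (Suc n) powr (- 1 - s) \<le> (real n powr (- s) - real (Suc n) powr (- s)) / s" if n: "1 \<le> n" for n
  proof -
    define v where "v = 1 / real (Suc n)"
    have v: "0 < v" "v < 1" using n by (auto simp: v_def)
    have "1 + s * v \<le> exp (s * v)" by (rule exp_ge_add_one_self)
    also have "\<dots> \<le> exp (- s * ln (1 - v))"
    proof -
      have "v \<le> - ln (1 - v)" using ln_le_minus_one[of "1 - v"] v by simp
      then have "s * v \<le> s * - ln (1 - v)" using s by (intro mult_left_mono) auto
      then show ?thesis by simp
    qed
    also have "\<dots> = (1 - v) powr (- s)" using v by (simp add: powr_def)
    finally have 1: "1 + s * v \<le> (1 - v) powr (- s)" .
    have "real n = real (Suc n) * (1 - v)" by (simp add: v_def field_simps)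
    then have "real n powr (- s) = real (Suc n) powr (- s) * (1 - v) powr (- s)"
      using v powr_mult[of "real (Suc n)" "1 - v" "- s"] by simp
    then have "real (Suc n) powr (- s) * (1 + s * v) \<le> real n powr (- s)"
      using 1 by (simp add: mult_left_mono)
    moreover have "real (Suc n) powr (- 1 - s) = real (Suc n) powr (- s) * v"
      by (simp add: v_def powr_diff powr_minus_divide)
    ultimately show ?thesis using s by (simp add: field_simps)
  qed
  have "(\<Sum>k\<in>{l..l + t}. real k powr (- 1 - s)) \<le> real l powr (- s) + (real l powr (- s) - real (l + t) powr (- s)) / s"
  proof (induction t)
    case 0
    have "real l powr (- 1 - s) \<le> real l powr (- s)" using l s by (intro powr_mono) auto
    then show ?case by simp
  next
    case (Suc t)
    have "(\<Sum>k\<in>{l..l + Suc t}. real k powr (- 1 - s))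
        = (\<Sum>k\<in>{l..l + t}. real k powr (- 1 - s)) + real (Suc (l + t)) powr (- 1 - s)" by simp
    then show ?case using Suc step[of "l + t"] l by (simp add: diff_divide_distrib del: of_nat_Suc)
  qed
  also have "\<dots> \<le> (1 + 1 / s) * real l powr (- s)" using s by (simp add: field_simps)
  finally show ?thesis .
qed

definition evolve :: "(nat \<Rightarrow> real) \<Rightarrow> nat \<Rightarrow> nat \<Rightarrow> (real \<Rightarrow> real) \<Rightarrow> real \<Rightarrow> real" where
  "evolve b n t = cocycle Suc (\<lambda>k. lsv_transfer (b k)) n t"

lemma evolve_0 [simp]: "evolve b 0 t f = f"
  by (simp add: evolve_def)

lemma evolve_Suc: "evolve b (Suc n) t f = lsv_transfer (b (t + n)) (evolve b n t f)"
  by (simp add: evolve_def add.commute)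

lemma evolve_add: "evolve b (m + n) t f = evolve b n (t + m) (evolve b m t f)"
  by (induction n) (simp_all add: evolve_Suc add.assoc)

lemma evolve_Suc_first: "evolve b (Suc n) t f = evolve b n (Suc t) (lsv_transfer (b t) f)"
  using evolve_add[of b 1 n t f] by (simp add: evolve_Suc)

lemma evolve_density:
  assumes "\<And>k. 0 < b k" "is_density f"
  shows "is_density (evolve b n t f)" "(\<integral>x. evolve b n t f x \<partial>leb) = (\<integral>x. f x \<partial>leb)"
  by (induction n) (auto simp: evolve_Suc lsv_transfer_density assms)

lemma evolve_linear:
  "evolve b n t (\<lambda>x. c * f x + d * g x) = (\<lambda>x. c * evolve b n t f x + d * evolve b n t g x)"
proof (induction n)
  case (Suc n)
  show ?case unfolding evolve_Suc Suc using lsv_transfer_linear by blast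
qed simp

lemma evolve_mono_interior:
  assumes "\<And>k. 0 < b k" "\<And>x. x \<in> {0<..<1} \<Longrightarrow> f x \<le> g x"
  shows "y \<in> {0<..<1} \<Longrightarrow> evolve b n t f y \<le> evolve b n t g y"
  by (induction n arbitrary: y)
     (use assms in \<open>auto simp: evolve_Suc intro!: lsv_transfer_mono_interior\<close>)

lemma evolve_cong_interior:
  assumes "\<And>k. 0 < b k" "\<And>x. x \<in> {0<..<1} \<Longrightarrow> f x = g x" "y \<in> {0<..<1}"
  shows "evolve b n t f y = evolve b n t g y"
  using evolve_mono_interior[of b f g y n t] evolve_mono_interior[of b g f y n t] assms by force

lemma evolve_regular:
  assumes "\<And>k. 0 < b k \<and> b k \<le> 1" "2 \<le> K" "regular K {0<..<1} f"
  shows "regular K {0<..<1} (evolve b n t f)"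
  by (induction n) (use assms in \<open>auto simp: evolve_Suc intro!: regular_lsv_transfer_interior\<close>)

text \<open>The part of the density \<open>u\<close>, given at time \<open>t\<close>, that does not visit \<open>[1/2,1]\<close> up to time \<open>t + l\<close>.\<close>

definition staying_mass :: "(nat \<Rightarrow> real) \<Rightarrow> nat \<Rightarrow> nat \<Rightarrow> (real \<Rightarrow> real) \<Rightarrow> real" where
  "staying_mass b l t u = (\<integral>x. u x * indicator (stay b l t) x \<partial>leb)"

lemma staying_mass_left_transfer:
  assumes b: "\<And>k. 0 < b k" and u: "is_density u"
  shows "staying_mass b l (Suc t) (left_transfer (b t) u) = staying_mass b (Suc l) t u"
proof -
  have "indicator {0..<1/2} x * u x * indicator (stay b l (Suc t)) (lsv (b t) x)
      = u x * indicator (stay b (Suc l) t) x" for x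
    by (auto simp: indicator_def)
  then show ?thesis
    unfolding staying_mass_def left_transfer_mass(2)[OF b u stay_sets[of b l "Suc t", OF b]] by presburger
qed

lemma staying_mass_add:
  assumes b: "\<And>k. 0 < b k" and "is_density u" "is_density v"
  shows "staying_mass b l t (\<lambda>x. u x + v x) = staying_mass b l t u + staying_mass b l t v"
  unfolding staying_mass_def distrib_right
  by (intro Bochner_Integration.integral_add integrable_real_mult_indicator stay_sets[of b, OF b]
      is_densityD(1)[OF assms(2)] is_densityD(1)[OF assms(3)])

lemma staying_mass_mono:
  assumes b: "\<And>k. 0 < b k" and "is_density u" "integrable leb v"
    and le: "\<And>x. x \<in> {0<..<1} \<Longrightarrow> u x \<le> v x"
  shows "staying_mass b l t u \<le> staying_mass b l t v"
  unfolding staying_mass_def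
  using le by (intro integral_mono_AE integrable_real_mult_indicator stay_sets[of b, OF b]
      is_densityD(1)[OF assms(2)] assms(3) eventually_mono[OF AE_unit_lebesgue_interior])
    (auto simp: indicator_def)

lemma staying_mass_const:
  assumes b: "\<And>k. 0 < b k"
  shows "staying_mass b l t (\<lambda>_. c) = c * measure leb (stay b l t)"
  unfolding staying_mass_def using sets.sets_into_space[OF stay_sets[of b l t, OF b]]
  by (simp add: Int_absorb2)

lemma right_transfer_le:
  assumes f: "is_density f" and r: "regular K {0<..<1} f" and x: "x \<in> {0<..<1}"
  shows "right_transfer f x \<le> 2 ^ K * (\<integral>x. f x \<partial>leb)"
    and "(\<integral>x. f x * indicator {1/2..<1} x \<partial>leb) \<le> 2 ^ K * right_transfer f x"
proof -
  have x': "(x + 1) / 2 \<in> {1/2..<1}" using x by auto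
  have eq: "right_transfer f x = f ((x + 1) / 2) / 2" using x by (simp add: right_transfer_def)
  have Y: "{1/2..<1} \<in> sets leb" by (rule sets_unit_lebesgueI) auto
  have "(\<integral>x. f x * indicator {1/2..<1} x \<partial>leb) \<le> (\<integral>x. f x \<partial>leb)"
    using is_densityD[OF f] by (intro integral_mono integrable_real_mult_indicator Y) (auto simp: indicator_def)
  then have "2 ^ K * (\<integral>x. f x * indicator {1/2..<1} x \<partial>leb) \<le> 2 ^ K * (\<integral>x. f x \<partial>leb)"
    by (intro mult_left_mono) auto
  moreover have "f ((x + 1) / 2) \<le> 2 * (2 ^ K * (\<integral>x. f x * indicator {1/2..<1} x \<partial>leb))"
    using regular_right_half_bounds(1)[OF f r x'] by simp
  ultimately show "right_transfer f x \<le> 2 ^ K * (\<integral>x. f x \<partial>leb)"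
    unfolding eq by linarith
  show "(\<integral>x. f x * indicator {1/2..<1} x \<partial>leb) \<le> 2 ^ K * right_transfer f x"
    using regular_right_half_bounds(2)[OF f r x'] by (simp add: eq)
qed

text \<open>
  Decomposition according to the first time \<open>r\<close> after the last visit to the right half. At time \<open>r\<close> the
  part that has just left the right half has density at most \<open>4\<close>, because the density on the right half was
  regular with exponent \<open>2\<close> and mass at most \<open>1\<close>. The term \<open>r = 0\<close> accounts for points that
  have never been in the right half.
\<close>

lemma staying_mass_evolve_one:
  assumes b: "\<And>k. 0 < b k \<and> b k \<le> 1"
  shows "staying_mass b l t (evolve b t 0 (\<lambda>_. 1)) \<le> 4 * (\<Sum>r\<le>t. measure leb (stay b (t + l - r) r))"
proof (induction t arbitrary: l)
  case 0
  then show ?case using b by (simp add: staying_mass_const)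
next
  case (Suc t)
  have b0: "\<And>k. 0 < b k" using b by auto
  define u where "u = evolve b t 0 (\<lambda>_. 1)"
  have u: "is_density u" "(\<integral>x. u x \<partial>leb) = 1" "regular 2 {0<..<1} u"
    unfolding u_def using leb.prob_space
    by (auto simp: evolve_density[of b, OF b0] is_density_const intro!: evolve_regular b regular_const)
  have eq: "evolve b (Suc t) 0 (\<lambda>_. 1) = (\<lambda>x. left_transfer (b t) u x + right_transfer u x)"
    using lsv_transfer_eq[OF b0] by (auto simp: evolve_Suc u_def[symmetric])
  have "staying_mass b l (Suc t) (evolve b (Suc t) 0 (\<lambda>_. 1))
      = staying_mass b (Suc l) t u + staying_mass b l (Suc t) (right_transfer u)"
    unfolding eq staying_mass_left_transfer[of b, OF b0 u(1), symmetric]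
    by (intro staying_mass_add b0 left_transfer_mass(1)[OF b0 u(1) sets.empty_sets] right_transfer_mass(1) u(1))
  also have "staying_mass b (Suc l) t u \<le> 4 * (\<Sum>r\<le>t. measure leb (stay b (Suc t + l - r) r))"
    using Suc.IH[of "Suc l"] by (simp add: u_def)
  also have "staying_mass b l (Suc t) (right_transfer u) \<le> staying_mass b l (Suc t) (\<lambda>_. 4)"
    using right_transfer_le(1)[OF u(1,3)] u(2)
    by (intro staying_mass_mono b0 right_transfer_mass(1) u(1)) auto
  also have "\<dots> = 4 * measure leb (stay b (Suc t + l - Suc t) (Suc t))"
    by (simp add: staying_mass_const[of b, OF b0])
  finally show ?case by simp
qed

text \<open>
  The excursion that begins at time \<open>r\<close> and lasts until \<open>t + l\<close> contributes \<open>O((t + l - r)\<^sup>-\<^sup>1\<^sup>/\<^sup>g)\<close>.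
  Summation over \<open>r\<close> costs one power, which leaves the exponent \<open>1/g - 1\<close>.
\<close>

lemma staying_mass_bound:
  assumes g: "0 < g" "g < 1" and \<kappa>: "0 < \<kappa>"
  obtains C where "0 < C"
    "\<And>b l t. (\<And>k. 0 < b k \<and> b k \<le> 1) \<Longrightarrow> 1 \<le> l \<Longrightarrow>
      (\<And>r. r \<le> t \<Longrightarrow> \<kappa> * real (t + l - r) \<le> real (visits b g r (t + l))) \<Longrightarrow>
      staying_mass b l t (evolve b t 0 (\<lambda>_. 1)) \<le> C * real l powr (- (1 / g - 1))"
proof -
  define s where "s = 1 / g - 1"
  have s: "0 < s" using g by (simp add: s_def)
  define A where "A = (g / 3 * \<kappa>) powr (- 1 / g)"
  have A: "0 < A" using g \<kappa> by (simp add: A_def)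
  show thesis
  proof (rule that)
    show "0 < 4 * A * (1 + 1 / s)" using A s by (simp add: add_pos_pos)
    fix b :: "nat \<Rightarrow> real" and l t :: nat
    assume b: "\<And>k. 0 < b k \<and> b k \<le> 1" and l: "1 \<le> l"
      and v: "\<And>r. r \<le> t \<Longrightarrow> \<kappa> * real (t + l - r) \<le> real (visits b g r (t + l))"
    have m: "measure leb (stay b (t + l - r) r) \<le> A * real (t + l - r) powr (- 1 - s)" if r: "r \<le> t" for r
    proof -
      have "measure leb (stay b (t + l - r) r) \<le> (g / 3 * (\<kappa> * real (t + l - r))) powr (- 1 / g)"
        using b g \<kappa> l r v[OF r] by (intro measure_stay_le) (auto simp: mult_pos_pos)
      also have "\<dots> = (g / 3 * \<kappa>) powr (- 1 / g) * real (t + l - r) powr (- 1 / g)"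
        using g \<kappa> by (subst powr_mult[symmetric]) (auto simp: mult.assoc)
      also have "- 1 / g = - 1 - s" by (simp add: s_def)
      finally show ?thesis unfolding A_def s_def by simp
    qed
    have "staying_mass b l t (evolve b t 0 (\<lambda>_. 1)) \<le> 4 * (\<Sum>r\<le>t. measure leb (stay b (t + l - r) r))"
      by (rule staying_mass_evolve_one[of b, OF b])
    also have "\<dots> \<le> 4 * (\<Sum>r\<le>t. A * real (t + l - r) powr (- 1 - s))"
      using m by (intro mult_left_mono sum_mono) auto
    also have "(\<Sum>r\<le>t. A * real (t + l - r) powr (- 1 - s)) = A * (\<Sum>k\<in>{l..l + t}. real k powr (- 1 - s))"
      unfolding sum_distrib_left
      by (rule sum.reindex_bij_witness[of _ "\<lambda>k. t + l - k" "\<lambda>r. t + l - r"]) auto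
    also have "4 * (A * (\<Sum>k\<in>{l..l + t}. real k powr (- 1 - s))) \<le> 4 * (A * ((1 + 1 / s) * real l powr (- s)))"
      using A l s by (intro mult_left_mono sum_powr_tail) auto
    finally show "staying_mass b l t (evolve b t 0 (\<lambda>_. 1)) \<le> 4 * A * (1 + 1 / s) * real l powr (- (1 / g - 1))"
      by (simp add: s_def mult.assoc)
  qed
qed

section \<open>Lower bounds on the right half\<close>

lemma evolve_cmult: "evolve b n t (\<lambda>x. c * f x) = (\<lambda>x. c * evolve b n t f x)"
  using evolve_linear[of b n t c f 0 f] by simp

lemma evolve_diff: "evolve b n t (\<lambda>x. f x - g x) = (\<lambda>x. evolve b n t f x - evolve b n t g x)"
  using evolve_linear[of b n t 1 f "-1" g] by simp

text \<open>
  By induction on the number of steps, splitting \<open>u\<close> at each of them. The part on the right half is comparable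
  with its mean, so its image dominates a constant proportional to its mass, and from then on
  the lower bound \<open>c\<close> for the images of \<open>1\<close> applies. The part on the left is regular and is
  treated by the induction hypothesis at the next time.
\<close>

lemma entered_mass_lower_bound:
  assumes b: "\<And>k. 0 < b k \<and> b k \<le> 1" and K: "2 \<le> K" and c: "0 \<le> c"
  shows "is_density u \<Longrightarrow> regular K {0<..<1} u \<Longrightarrow>
    (\<And>r k y. t \<le> r \<Longrightarrow> r + k \<le> t + l \<Longrightarrow> y \<in> {1/2..<1} \<Longrightarrow> c \<le> evolve b k r (\<lambda>_. 1) y) \<Longrightarrow>
    x \<in> {1/2..<1} \<Longrightarrow>
    c / 2 ^ K * ((\<integral>y. u y \<partial>leb) - staying_mass b l t u) \<le> evolve b l t u x"
proof (induction l arbitrary: t u)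
  case 0
  have "c \<le> 1" using "0.prems"(3)[of t 0 x] "0.prems"(4) by simp
  have pos: "0 \<le> u x" using regularD(1)[OF "0.prems"(2), of x x] "0.prems"(4) by auto
  let ?m = "(\<integral>y. u y * indicator {1/2..<1} y \<partial>leb)"
  have "?m \<le> 2 ^ K * u x"
    using regular_right_half_bounds(2)[OF "0.prems"(1,2,4)] pos zero_le_power[of "2::real" K]
      mult_nonneg_nonneg[of "2^K" "u x"] by linarith
  then have "c / 2 ^ K * ?m \<le> c / 2 ^ K * (2 ^ K * u x)" using c by (intro mult_left_mono) auto
  also have "\<dots> = c * u x" by simp
  also have "\<dots> \<le> u x" using \<open>c \<le> 1\<close> pos by (simp add: mult_left_le_one_le c)
  finally show ?case
    using integral_split_halves[OF is_densityD(1)[OF "0.prems"(1)]] by (simp add: staying_mass_def)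
next
  case (Suc l)
  have b0: "\<And>k. 0 < b k" using b by auto
  define ul ur where "ul = left_transfer (b t) u" and "ur = right_transfer u"
  have ul: "is_density ul" "regular K {0<..<1} ul"
    unfolding ul_def using b Suc.prems(2) K
    by (auto intro!: left_transfer_mass(1)[OF b0 Suc.prems(1) sets.empty_sets] regular_left_transfer
        intro: regular_subset)
  let ?w = "(\<integral>y. u y * indicator {1/2..<1} y \<partial>leb) / 2 ^ K"
  have w: "0 \<le> ?w"
    using is_densityD(3)[OF Suc.prems(1)] by (intro divide_nonneg_pos integral_nonneg) (auto simp: indicator_def)
  have "evolve b (Suc l) t u = evolve b l (Suc t) (\<lambda>x. 1 * ul x + 1 * ur x)"
    unfolding evolve_Suc_first ul_def ur_def using lsv_transfer_eq[OF b0] by (intro arg_cong[where f = "evolve b l (Suc t)"] ext) simp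
  then have split: "evolve b (Suc l) t u x = evolve b l (Suc t) ul x + evolve b l (Suc t) ur x"
    unfolding evolve_linear by simp
  have A: "c / 2 ^ K * ((\<integral>y. ul y \<partial>leb) - staying_mass b l (Suc t) ul) \<le> evolve b l (Suc t) ul x"
    by (rule Suc.IH[OF ul _ Suc.prems(4)]) (rule Suc.prems(3); simp)
  have E1: "staying_mass b l (Suc t) ul = staying_mass b (Suc l) t u"
    unfolding ul_def by (rule staying_mass_left_transfer[of b, OF b0 Suc.prems(1)])
  have E2: "(\<integral>y. ul y \<partial>leb) = (\<integral>y. u y * indicator {0..<1/2} y \<partial>leb)"
    unfolding ul_def by (rule left_transfer_mass_total[OF b0 Suc.prems(1)])
  have B: "c / 2 ^ K * (\<integral>y. u y * indicator {1/2..<1} y \<partial>leb) \<le> evolve b l (Suc t) ur x"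
  proof -
    have "?w * c \<le> ?w * evolve b l (Suc t) (\<lambda>_. 1) x"
      using Suc.prems(3)[of "Suc t" l x] Suc.prems(4) w by (intro mult_left_mono) auto
    also have "\<dots> = evolve b l (Suc t) (\<lambda>_. ?w) x" using evolve_cmult[of b l "Suc t" ?w "\<lambda>_. 1"] by simp
    also have "\<dots> \<le> evolve b l (Suc t) ur x"
    proof (rule evolve_mono_interior[of b, OF b0])
      show "?w \<le> ur y" if "y \<in> {0<..<1}" for y
        using right_transfer_le(2)[OF Suc.prems(1,2) that] by (simp add: ur_def divide_le_eq mult.commute)
    qed (use Suc.prems(4) in auto)
    finally show ?thesis by (simp add: mult.commute)
  qed
  have S: "c / 2 ^ K * ((\<integral>y. u y \<partial>leb) - staying_mass b (Suc l) t u)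
      = c / 2 ^ K * ((\<integral>y. u y * indicator {0..<1/2} y \<partial>leb) - staying_mass b (Suc l) t u)
      + c / 2 ^ K * (\<integral>y. u y * indicator {1/2..<1} y \<partial>leb)"
    unfolding integral_split_halves[OF is_densityD(1)[OF Suc.prems(1)]]
    by (simp only: distrib_left[symmetric]) simp
  show ?case unfolding split S using A B unfolding E1 E2 by (rule add_mono)
qed

lemma evolve_one_ge_power:
  assumes b: "\<And>k. 0 < b k"
  shows "x \<in> {0<..<1} \<Longrightarrow> (1/2) ^ n \<le> evolve b n t (\<lambda>_. 1) x"
proof (induction n arbitrary: x)
  case (Suc n)
  have "(1/2) ^ Suc n \<le> (1/2) ^ n * lsv_transfer (b (t + n)) (\<lambda>_. 1) x"
    using lsv_transfer_eq[OF b, of "t + n" "\<lambda>_. 1" x] left_transfer_nonneg[OF b, of "\<lambda>_. 1" "t + n" x] Suc.prems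
    by (simp add: right_transfer_def)
  also have "\<dots> = lsv_transfer (b (t + n)) (\<lambda>_. (1/2) ^ n) x"
    using lsv_transfer_linear[of "b (t + n)" "(1/2)^n" "\<lambda>_. 1" 0 "\<lambda>_. 1" x] by simp
  also have "\<dots> \<le> evolve b (Suc n) t (\<lambda>_. 1) x"
    unfolding evolve_Suc using Suc by (intro lsv_transfer_mono_interior b) auto
  finally show ?case .
qed simp

lemma evolve_shift: "evolve (\<lambda>k. b (k + t)) n r f = evolve b n (r + t) f"
  by (induction n) (simp_all add: evolve_Suc add_ac)

lemma stay_shift: "stay (\<lambda>k. b (k + t)) l r = stay b l (r + t)"
  by (induction l arbitrary: r) simp_all

text \<open>
  With \<open>\<gamma>\<close> replaced by \<open>\<alpha>\<close> every parameter counts as a visit, so the bound on excursions holds without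
  any assumption on frequencies. Hence there is a fixed length \<open>l\<close> such that, whatever the time, half of the mass
  of the image of \<open>1\<close> enters the right half during the last \<open>l\<close> steps; over \<open>l\<close> steps
  the trivial lower bound \<open>2\<^sup>-\<^sup>l\<close> is available.
\<close>

lemma evolve_one_lower_bound:
  assumes \<alpha>: "0 < \<alpha>" "\<alpha> < 1"
  obtains c where "0 < c" "c < 1"
    "\<And>b n t x. (\<And>k. 0 < b k \<and> b k \<le> \<alpha>) \<Longrightarrow> x \<in> {1/2..<1} \<Longrightarrow> c \<le> evolve b n t (\<lambda>_. 1) x"
proof -
  obtain C where C: "0 < C"
    "\<And>b l t. (\<And>k. 0 < b k \<and> b k \<le> 1) \<Longrightarrow> 1 \<le> l \<Longrightarrow>
      (\<And>r. r \<le> t \<Longrightarrow> 1 * real (t + l - r) \<le> real (visits b \<alpha> r (t + l))) \<Longrightarrow>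
      staying_mass b l t (evolve b t 0 (\<lambda>_. 1)) \<le> C * real l powr (- (1 / \<alpha> - 1))"
    using staying_mass_bound[OF \<alpha>, of 1] by auto
  have "((\<lambda>l. C * real l powr (- (1 / \<alpha> - 1))) \<longlongrightarrow> C * 0) sequentially"
    using \<alpha> by (intro tendsto_intros tendsto_neg_powr filterlim_real_sequentially) auto
  then have "eventually (\<lambda>l. C * real l powr (- (1 / \<alpha> - 1)) < 1/2) sequentially"
    by (intro order_tendstoD) auto
  with eventually_ge_at_top[of 1] have "eventually (\<lambda>l. 1 \<le> l \<and> C * real l powr (- (1 / \<alpha> - 1)) < 1/2) sequentially"
    by (rule eventually_conj)
  then obtain l where l: "1 \<le> l" "C * real l powr (- (1 / \<alpha> - 1)) < 1/2"
    using eventually_happens'[OF sequentially_bot] by blast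
  show thesis
  proof (rule that)
    show "0 < (1/2::real) ^ (l + 3)" "(1/2::real) ^ (l + 3) < 1" by (auto simp: power_less_one_iff)
    fix b :: "nat \<Rightarrow> real" and n t :: nat and x :: real
    assume b: "\<And>k. 0 < b k \<and> b k \<le> \<alpha>" and x: "x \<in> {1/2..<1}"
    have b1: "\<And>k. 0 < b k \<and> b k \<le> 1" using b \<alpha> by (meson less_imp_le order_trans)
    have b0: "\<And>k. 0 < b k" using b by auto
    show "(1/2) ^ (l + 3) \<le> evolve b n t (\<lambda>_. 1) x"
    proof (cases "n \<le> l + 3")
      case True
      then have "(1/2::real) ^ (l + 3) \<le> (1/2) ^ n" by (intro power_decreasing) auto
      also have "\<dots> \<le> evolve b n t (\<lambda>_. 1) x" using x by (intro evolve_one_ge_power b0) auto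
      finally show ?thesis .
    next
      case False
      define m where "m = n - l"
      have n: "n = m + l" using False by (simp add: m_def)
      define u where "u = evolve b m t (\<lambda>_. 1)"
      have u: "is_density u" "(\<integral>x. u x \<partial>leb) = 1" "regular 2 {0<..<1} u"
        unfolding u_def using leb.prob_space
        by (auto simp: evolve_density[of b, OF b0] is_density_const intro!: evolve_regular b1 regular_const)
      let ?b = "\<lambda>k. b (k + t)"
      have "staying_mass ?b l m (evolve ?b m 0 (\<lambda>_. 1)) \<le> C * real l powr (- (1 / \<alpha> - 1))"
      proof (rule C(2)[OF b1 l(1)])
        fix r
        have "{k\<in>{r..<m + l}. b (k + t) \<le> \<alpha>} = {r..<m + l}" using b by auto
        then show "1 * real (m + l - r) \<le> real (visits ?b \<alpha> r (m + l))" by (simp add: visits_def)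
      qed
      then have "staying_mass b l (t + m) u \<le> C * real l powr (- (1 / \<alpha> - 1))"
        by (simp add: staying_mass_def stay_shift evolve_shift u_def add.commute)
      then have st: "staying_mass b l (t + m) u \<le> 1/2" using l by simp
      have "(1/2) ^ l / 2 ^ 2 * ((\<integral>x. u x \<partial>leb) - staying_mass b l (t + m) u) \<le> evolve b l (t + m) u x"
      proof (rule entered_mass_lower_bound[of b, OF b1 _ _ u(1,3) _ x])
        fix r k y assume "t + m \<le> r" "r + k \<le> t + m + l" and y: "y \<in> {1/2..<1::real}"
        then have "(1/2::real) ^ l \<le> (1/2) ^ k" by (intro power_decreasing) auto
        also have "\<dots> \<le> evolve b k r (\<lambda>_. 1) y" using y by (intro evolve_one_ge_power b0) auto
        finally show "(1/2) ^ l \<le> evolve b k r (\<lambda>_. 1) y" .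
      qed auto
      also have "evolve b l (t + m) u x = evolve b n t (\<lambda>_. 1) x" by (simp add: n u_def evolve_add)
      finally have *: "(1/2) ^ l / 2 ^ 2 * (1 - staying_mass b l (t + m) u) \<le> evolve b n t (\<lambda>_. 1) x" unfolding u(2) .
      have "(1/2::real) ^ (l + 3) = (1/2) ^ l / 2 ^ 2 * (1/2)" by (simp add: power_add power3_eq_cube)
      also have "\<dots> \<le> (1/2) ^ l / 2 ^ 2 * (1 - staying_mass b l (t + m) u)" using st by (intro mult_left_mono) auto
      finally show ?thesis using * by linarith
    qed
  qed
qed

section \<open>Coupling\<close>

text \<open>
  The signed function \<open>w\<close> is the difference at time \<open>t\<close> of the two evolutions that are compared, and \<open>u\<close>, \<open>v\<close>
  are their parts that are not yet coupled. Domination by a multiple of the image of \<open>1\<close> transfers the bound on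
  long excursions from that image to \<open>u\<close> and \<open>v\<close>, so that the history of the coupling need not be
  followed.
\<close>

definition coupled :: "(nat \<Rightarrow> real) \<Rightarrow> nat \<Rightarrow> real \<Rightarrow> (real \<Rightarrow> real) \<Rightarrow> real \<Rightarrow> bool" where
  "coupled b t D w U \<longleftrightarrow> (\<exists>u v.
     is_density u \<and> regular 4 {0<..<1} u \<and> (\<integral>x. u x \<partial>leb) = U \<and>
     is_density v \<and> regular 4 {0<..<1} v \<and> (\<integral>x. v x \<partial>leb) = U \<and>
     (\<forall>x\<in>{0<..<1}. u x \<le> D * evolve b t 0 (\<lambda>_. 1) x \<and> v x \<le> D * evolve b t 0 (\<lambda>_. 1) x \<and>
       w x = u x - v x))"

lemma coupled_evolve:
  assumes b: "\<And>k. 0 < b k \<and> b k \<le> 1" and cp: "coupled b t D w U"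
  shows "coupled b (t + n) D (evolve b n t w) U"
proof -
  have b0: "\<And>k. 0 < b k" using b by auto
  from cp obtain u v where uv:
     "is_density u" "regular 4 {0<..<1} u" "(\<integral>x. u x \<partial>leb) = U"
     "is_density v" "regular 4 {0<..<1} v" "(\<integral>x. v x \<partial>leb) = U"
     and le: "\<And>x. x \<in> {0<..<1} \<Longrightarrow> u x \<le> D * evolve b t 0 (\<lambda>_. 1) x"
       "\<And>x. x \<in> {0<..<1} \<Longrightarrow> v x \<le> D * evolve b t 0 (\<lambda>_. 1) x"
       "\<And>x. x \<in> {0<..<1} \<Longrightarrow> w x = u x - v x"
    unfolding coupled_def by blast
  have dom: "D * evolve b (t + n) 0 (\<lambda>_. 1) x = evolve b n t (\<lambda>x. D * evolve b t 0 (\<lambda>_. 1) x) x" for x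
    unfolding evolve_cmult evolve_add[of b t n 0] by simp
  show ?thesis
    unfolding coupled_def
  proof (rule exI[of _ "evolve b n t u"], rule exI[of _ "evolve b n t v"], intro conjI ballI)
    fix x :: real assume x: "x \<in> {0<..<1}"
    show "evolve b n t u x \<le> D * evolve b (t + n) 0 (\<lambda>_. 1) x"
      "evolve b n t v x \<le> D * evolve b (t + n) 0 (\<lambda>_. 1) x"
      unfolding dom using le x by (auto intro!: evolve_mono_interior[of b] b0)
    have "evolve b n t w x = evolve b n t (\<lambda>x. u x - v x) x"
      using le x by (intro evolve_cong_interior b0) auto
    then show "evolve b n t w x = evolve b n t u x - evolve b n t v x" by (simp add: evolve_diff)
  qed (use uv in \<open>auto simp: evolve_density[of b, OF b0] intro!: evolve_regular b\<close>)
qed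

lemma subtract_on_right_half:
  assumes u: "is_density u" "regular 4 {0<..<1} u" and d: "0 \<le> d"
    and le: "\<And>x. x \<in> {1/2..<1} \<Longrightarrow> d \<le> u x / 2" and b: "0 < b" "b \<le> 1"
  defines "u' \<equiv> \<lambda>x. u x - d * indicator {1/2..<1} x"
  shows "is_density u'" "(\<integral>x. u' x \<partial>leb) = (\<integral>x. u x \<partial>leb) - d / 2"
    "regular 4 {0<..<1} (lsv_transfer b u')"
proof -
  have Y: "{1/2..<1} \<in> sets leb" by (rule sets_unit_lebesgueI) auto
  have mY: "measure leb {1/2..<1} = 1/2"
    unfolding unit_lebesgue_def by (subst measure_restrict_space) auto
  have int: "integrable leb (\<lambda>x. d * indicator {1/2..<1} x)"
    using Y by (intro integrable_mult_right integrable_real_indicator)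
      (auto simp: less_top[symmetric] leb.emeasure_finite)
  have nn: "0 \<le> u' x" if "x \<in> {0..1}" for x
    unfolding u'_def using le[of x] is_densityD(3)[OF u(1) that] by (auto simp: indicator_def)
  show "is_density u'"
    using nn int is_densityD(1)[OF u(1)] unfolding is_density_def u'_def by auto
  have ic: "(\<integral>x. d * indicator {1/2..<1} x \<partial>leb) = d / 2"
    using Y mY Int_absorb2[of "{1/2..<1}" "{0..1::real}"] by (simp add: subset_eq)
  show "(\<integral>x. u' x \<partial>leb) = (\<integral>x. u x \<partial>leb) - d / 2"
    unfolding u'_def using int is_densityD(1)[OF u(1)] ic by (subst Bochner_Integration.integral_diff) auto
  have "regular 4 {0<..<1/2} u'"
  proof -
    have "regular 4 {0<..<1/2} u" using u(2) by (rule regular_subset) auto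
    then show ?thesis unfolding regular_def u'_def by (simp add: indicator_def)
  qed
  moreover have "regular (2 * 4) {1/2..<1} (\<lambda>x. u x - d)"
    using le by (intro regular_subtract regular_subset[OF u(2)]) auto
  then have "regular (2 * 4) {1/2..<1} u'"
    unfolding regular_def u'_def by auto
  ultimately show "regular 4 {0<..<1} (lsv_transfer b u')"
    using b by (intro regular_lsv_transfer) auto
qed

text \<open>
  If at least half of the mass of \<open>u\<close> and of \<open>v\<close> enters the right half within \<open>l\<close> steps, then both images are at
  least \<open>c U / 32\<close> there. Half of this constant is subtracted from both, which leaves their difference
  unchanged, and one further step makes the remainders regular again.
\<close>

lemma coupling_step:
  assumes b: "\<And>k. 0 < b k \<and> b k \<le> 1" and cp: "coupled b t D w U" and D: "0 \<le> D"
    and c: "0 < c" "\<And>n t x. x \<in> {1/2..<1} \<Longrightarrow> c \<le> evolve b n t (\<lambda>_. 1) x"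
    and st: "2 * D * staying_mass b l t (evolve b t 0 (\<lambda>_. 1)) \<le> U"
  shows "coupled b (t + l + 1) D (evolve b (l + 1) t w) ((1 - c / 128) * U)"
proof -
  have b0: "\<And>k. 0 < b k" using b by auto
  from cp obtain u v where uv:
     "is_density u" "regular 4 {0<..<1} u" "(\<integral>x. u x \<partial>leb) = U"
     "is_density v" "regular 4 {0<..<1} v" "(\<integral>x. v x \<partial>leb) = U"
     and le: "\<And>x. x \<in> {0<..<1} \<Longrightarrow> u x \<le> D * evolve b t 0 (\<lambda>_. 1) x"
       "\<And>x. x \<in> {0<..<1} \<Longrightarrow> v x \<le> D * evolve b t 0 (\<lambda>_. 1) x"
       "\<And>x. x \<in> {0<..<1} \<Longrightarrow> w x = u x - v x"
    unfolding coupled_def by blast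
  have U: "0 \<le> U" using integral_density_nonneg[OF uv(1)] uv(3) by simp
  define d where "d = c * U / 64"
  have d: "0 \<le> d" using c U by (simp add: d_def)
  have low: "d \<le> evolve b l t f x / 2"
    if f: "is_density f" "regular 4 {0<..<1} f" "(\<integral>x. f x \<partial>leb) = U"
      and fle: "\<And>x. x \<in> {0<..<1} \<Longrightarrow> f x \<le> D * evolve b t 0 (\<lambda>_. 1) x" and x: "x \<in> {1/2..<1}" for f x
  proof -
    have int: "is_density (evolve b t 0 (\<lambda>_. 1))" by (intro evolve_density b0 is_density_const) simp
    have "staying_mass b l t f \<le> staying_mass b l t (\<lambda>x. D * evolve b t 0 (\<lambda>_. 1) x)"
      using fle is_densityD(1)[OF int] by (intro staying_mass_mono b0 f(1)) auto
    also have "\<dots> = D * staying_mass b l t (evolve b t 0 (\<lambda>_. 1))"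
      by (simp add: staying_mass_def mult.assoc)
    finally have "U / 2 \<le> U - staying_mass b l t f" using st by simp
    then have "c / 2 ^ 4 * (U / 2) \<le> c / 2 ^ 4 * (U - staying_mass b l t f)"
      using c by (intro mult_left_mono) auto
    also have "\<dots> \<le> evolve b l t f x"
      unfolding f(3)[symmetric] by (rule entered_mass_lower_bound[of b, OF b]) (use f c x in auto)
    finally show ?thesis by (simp add: d_def mult.commute)
  qed
  define sub where "sub = (\<lambda>f x. evolve b l t f x - d * indicator {1/2..<1} x)"
  have stp: "is_density (lsv_transfer (b (t + l)) (sub f))"
    "regular 4 {0<..<1} (lsv_transfer (b (t + l)) (sub f))"
    "(\<integral>x. lsv_transfer (b (t + l)) (sub f) x \<partial>leb) = (1 - c / 128) * U"
    "\<And>x. x \<in> {0<..<1} \<Longrightarrow> lsv_transfer (b (t + l)) (sub f) x \<le> D * evolve b (t + l + 1) 0 (\<lambda>_. 1) x"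
    if f: "is_density f" "regular 4 {0<..<1} f" "(\<integral>x. f x \<partial>leb) = U"
      and fle: "\<And>x. x \<in> {0<..<1} \<Longrightarrow> f x \<le> D * evolve b t 0 (\<lambda>_. 1) x" for f
  proof -
    have e: "is_density (evolve b l t f)" "regular 4 {0<..<1} (evolve b l t f)"
        "(\<integral>x. evolve b l t f x \<partial>leb) = U"
      using f by (auto simp: evolve_density[of b, OF b0] intro!: evolve_regular b)
    have bt: "0 < b (t + l)" "b (t + l) \<le> 1" using b by auto
    have subf: "sub f = (\<lambda>x. evolve b l t f x - d * indicator {1/2..<1} x)" by (simp add: sub_def)
    note s = subtract_on_right_half[OF e(1,2) d low[OF f fle] bt, folded subf]
    show "is_density (lsv_transfer (b (t + l)) (sub f))"
      by (rule lsv_transfer_density(1)[OF bt(1) s(1)])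
    show "(\<integral>x. lsv_transfer (b (t + l)) (sub f) x \<partial>leb) = (1 - c / 128) * U"
      using lsv_transfer_density(2)[OF bt(1) s(1)] s(2) unfolding e(3) by (simp add: d_def algebra_simps)
    show "regular 4 {0<..<1} (lsv_transfer (b (t + l)) (sub f))" by (rule s(3))
    fix x :: real assume x: "x \<in> {0<..<1}"
    have "lsv_transfer (b (t + l)) (sub f) x \<le> lsv_transfer (b (t + l)) (evolve b l t f) x"
      using d by (intro lsv_transfer_mono bt) (auto simp: sub_def indicator_def)
    also have "\<dots> = evolve b (Suc l) t f x" by (simp add: evolve_Suc)
    also have "\<dots> \<le> evolve b (Suc l) t (\<lambda>x. D * evolve b t 0 (\<lambda>_. 1) x) x"
      using fle x by (intro evolve_mono_interior[of b] b0) auto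
    also have "\<dots> = D * evolve b (t + l + 1) 0 (\<lambda>_. 1) x"
      unfolding evolve_cmult using evolve_add[of b t "Suc l" 0] by simp
    finally show "lsv_transfer (b (t + l)) (sub f) x \<le> D * evolve b (t + l + 1) 0 (\<lambda>_. 1) x" .
  qed
  show ?thesis
    unfolding coupled_def
  proof (rule exI[of _ "lsv_transfer (b (t + l)) (sub u)"],
      rule exI[of _ "lsv_transfer (b (t + l)) (sub v)"], intro conjI ballI)
    fix x :: real assume x: "x \<in> {0<..<1}"
    have "evolve b l t w y = evolve b l t (\<lambda>x. u x - v x) y" if "y \<in> {0<..<1}" for y
      using le that by (intro evolve_cong_interior b0) auto
    then have "evolve b (l + 1) t w x = lsv_transfer (b (t + l)) (\<lambda>x. 1 * sub u x + (-1) * sub v x) x"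
      using x by (simp add: evolve_Suc sub_def evolve_diff) (intro lsv_transfer_cong_interior b0; simp)
    then show "evolve b (l + 1) t w x = lsv_transfer (b (t + l)) (sub u) x - lsv_transfer (b (t + l)) (sub v) x"
      unfolding lsv_transfer_linear by simp
  qed (use stp[OF uv(1-3)] stp[OF uv(4-6)] le in auto)
qed

lemma evolve_one_mass:
  assumes "\<And>k. 0 < b k"
  shows "is_density (evolve b n t (\<lambda>_. 1))" "(\<integral>x. evolve b n t (\<lambda>_. 1) x \<partial>leb) = 1"
  using leb.prob_space by (auto simp: evolve_density[of b, OF assms] is_density_const)

lemma coupled_mass_le:
  assumes b: "\<And>k. 0 < b k" and cp: "coupled b t D w U"
  shows "U \<le> D" "0 \<le> U"
proof -
  from cp obtain u where u: "is_density u" "(\<integral>x. u x \<partial>leb) = U"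
     and le: "\<And>x. x \<in> {0<..<1} \<Longrightarrow> u x \<le> D * evolve b t 0 (\<lambda>_. 1) x"
    unfolding coupled_def by blast
  have "(\<integral>x. u x \<partial>leb) \<le> (\<integral>x. D * evolve b t 0 (\<lambda>_. 1) x \<partial>leb)"
    using le is_densityD(1)[OF u(1)] is_densityD(1)[OF evolve_one_mass(1)[of b, OF b]]
    by (intro integral_mono_AE eventually_mono[OF AE_unit_lebesgue_interior]) auto
  then show "U \<le> D" using evolve_one_mass(2)[of b, OF b] u(2) by simp
  show "0 \<le> U" using integral_density_nonneg[OF u(1)] u(2) by simp
qed

lemma coupled_integral_le:
  assumes b: "\<And>k. 0 < b k" and cp: "coupled b t D w U"
  shows "(\<integral>x. \<bar>w x\<bar> \<partial>leb) \<le> 2 * U"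
proof (cases "integrable leb (\<lambda>x. \<bar>w x\<bar>)")
  case True
  from cp obtain u v where u: "is_density u" "(\<integral>x. u x \<partial>leb) = U"
     and v: "is_density v" "(\<integral>x. v x \<partial>leb) = U"
     and eq: "\<And>x. x \<in> {0<..<1} \<Longrightarrow> w x = u x - v x"
    unfolding coupled_def by blast
  have "(\<integral>x. \<bar>w x\<bar> \<partial>leb) \<le> (\<integral>x. u x + v x \<partial>leb)"
    using eq is_densityD[OF u(1)] is_densityD[OF v(1)] True
    by (intro integral_mono_AE eventually_mono[OF AE_unit_lebesgue_interior]) (auto simp: abs_if)
  also have "\<dots> = 2 * U"
    using is_densityD(1)[OF u(1)] is_densityD(1)[OF v(1)] u(2) v(2) by simp
  finally show ?thesis .
qed (use coupled_mass_le[of b, OF b cp] in \<open>auto simp: not_integrable_integral_eq\<close>)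

lemma powr_scale_le:
  fixes x y r s :: real
  assumes "0 < x" "0 < y" "0 < r" "0 \<le> s" "y \<le> r * x"
  shows "x powr (- s) \<le> r powr s * y powr (- s)"
proof -
  have "y / r \<le> x" using assms by (simp add: divide_le_eq mult.commute)
  then have "x powr (- s) \<le> (y / r) powr (- s)" using assms by (intro powr_mono2') auto
  also have "\<dots> = r powr s * y powr (- s)"
    using assms by (simp add: powr_divide powr_minus_divide)
  finally show ?thesis .
qed

text \<open>
  A time \<open>a\<close> is preceded by \<open>a' = \<lfloor>a / (1 + 2\<delta>)\<rfloor>\<close>. Of the gap \<open>2\<delta>a'\<close> one half absorbs the rounding errors, and
  the last of the \<open>l + 1\<close> steps is the one in which the remainders regain regularity.
\<close>

lemma geometric_time_steps:
  fixes \<delta> :: real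
  assumes \<delta>: "0 < \<delta>" "\<delta> \<le> 1/4" and n0: "2 / \<delta> \<le> real n0" and a: "2 * n0 < a"
  obtains a' l where "n0 \<le> a'" "a = a' + l + 1" "\<delta> * real a' \<le> real l" "1 \<le> l"
    "real a \<le> (1 + 3 * \<delta>) * real a'"
proof -
  define y where "y = real a / (1 + 2 * \<delta>)"
  define a' where "a' = nat \<lfloor>y\<rfloor>"
  have n8: "8 \<le> real n0" "2 \<le> \<delta> * real n0"
  proof -
    have "2 / (1/4) \<le> 2 / \<delta>" using \<delta> by (intro divide_left_mono) auto
    then show "8 \<le> real n0" using n0 by simp
    show "2 \<le> \<delta> * real n0" using n0 \<delta> by (simp add: divide_le_eq mult.commute)
  qed
  have y0: "0 \<le> y" using \<delta> by (simp add: y_def)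
  have a'y: "real a' \<le> y" "y < real a' + 1"
    using y0 unfolding a'_def by (simp_all add: of_nat_floor)
  have ya: "y * (1 + 2 * \<delta>) = real a" using \<delta> by (simp add: y_def)
  have "real a \<le> y * (3 / 2)" unfolding ya[symmetric] using \<delta> y0 by (intro mult_left_mono) auto
  then have "real n0 < real a' + 1" using a a'y n8 by linarith
  then have na: "n0 \<le> a'" by linarith
  then have da: "\<delta> * real n0 \<le> \<delta> * real a'" using \<delta> by (intro mult_left_mono) auto
  have "real a' * (1 + 2 * \<delta>) \<le> real a" unfolding ya[symmetric] using a'y \<delta> by (intro mult_right_mono) auto
  then have low: "real a' + 2 * (\<delta> * real a') \<le> real a" by (simp add: algebra_simps)
  then have "real a' + 1 \<le> real a" using da n8 by linarith
  then have al: "a' + 1 \<le> a" by linarith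
  define l where "l = a - a' - 1"
  have l: "a = a' + l + 1" "real l = real a - real a' - 1" using al by (auto simp: l_def)
  have dl: "\<delta> * real a' \<le> real l" using l low da n8 by linarith
  have "real a \<le> (real a' + 1) * (1 + 2 * \<delta>)"
    unfolding ya[symmetric] using a'y \<delta> by (intro mult_right_mono) auto
  also have "\<dots> \<le> (1 + 3 * \<delta>) * real a'"
  proof -
    have "1 + 2 * \<delta> \<le> \<delta> * real a'" using da n8 \<delta> by linarith
    then show ?thesis by (simp add: algebra_simps)
  qed
  finally have up: "real a \<le> (1 + 3 * \<delta>) * real a'" .
  have "1 \<le> l" using dl da n8 by linarith
  from that[OF na l(1) dl this up] show thesis .
qed

section \<open>Polynomial loss of memory\<close>

text \<open>
  The order of the choices matters. The proportion \<open>\<theta>\<close> that is coupled at each step depends only on \<open>\<alpha>\<close>; the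
  window size \<open>\<delta>\<close> is then taken so small that a decrease by the factor \<open>1 - \<theta>\<close> compensates the growth of
  \<open>a\<^sup>s\<close> over one window, and the frequency of visits is needed only in windows of relative length \<open>\<delta>\<close>.
\<close>

lemma memory_loss:
  assumes g: "0 < g" "g < 1" and \<alpha>: "0 < \<alpha>" "\<alpha> < 1" and \<kappa>: "0 < \<kappa>"
  obtains \<delta> C where "0 < \<delta>" "\<delta> \<le> 1/4" "0 < C"
    "\<And>b I n0 a w U D. (\<And>k. 0 < b k \<and> b k \<le> \<alpha>) \<Longrightarrow> 2 / \<delta> \<le> real n0 \<Longrightarrow>
      (\<And>a l r. n0 \<le> a \<Longrightarrow> \<delta> * real a \<le> real l \<Longrightarrow> r \<le> I + a \<Longrightarrow>
        \<kappa> * real (I + a + l - r) \<le> real (visits b g r (I + a + l))) \<Longrightarrow>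
      coupled b I D w U \<Longrightarrow> 1 \<le> a \<Longrightarrow>
      (\<integral>x. \<bar>evolve b a I w x\<bar> \<partial>leb)
        \<le> C * D * real n0 powr (1 / g - 1) * real a powr (- (1 / g - 1))"
proof -
  define s where "s = 1 / g - 1"
  have s: "0 < s" using g by (simp add: s_def)
  obtain c where c: "0 < c" "c < 1"
    "\<And>b n t x. (\<And>k. 0 < b k \<and> b k \<le> \<alpha>) \<Longrightarrow> x \<in> {1/2..<1} \<Longrightarrow> c \<le> evolve b n t (\<lambda>_. 1) x"
    using evolve_one_lower_bound[OF \<alpha>] by metis
  obtain R where R: "0 < R"
    "\<And>b l t. (\<And>k. 0 < b k \<and> b k \<le> 1) \<Longrightarrow> 1 \<le> l \<Longrightarrow>
      (\<And>r. r \<le> t \<Longrightarrow> \<kappa> * real (t + l - r) \<le> real (visits b g r (t + l))) \<Longrightarrow>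
      staying_mass b l t (evolve b t 0 (\<lambda>_. 1)) \<le> R * real l powr (- s)"
    using staying_mass_bound[OF g \<kappa>] unfolding s_def by metis
  define \<theta> where "\<theta> = c / 128"
  define \<delta> where "\<delta> = min (1/4) (\<theta> / (3 * s))"
  have \<theta>: "0 < \<theta>" "\<theta> < 1" using c by (auto simp: \<theta>_def)
  have \<delta>: "0 < \<delta>" "\<delta> \<le> 1/4" "3 * \<delta> * s \<le> \<theta>"
    using \<theta> s by (auto simp: \<delta>_def min_def field_simps)
  \<comment> \<open>\<open>(1 + 3\<delta>)\<^sup>s \<le> exp (3 \<delta> s) \<le> exp \<theta>\<close> and \<open>1 - \<theta> \<le> exp (- \<theta>)\<close>\<close>
  have growth: "(1 - \<theta>) * (1 + 3 * \<delta>) powr s \<le> 1"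
  proof -
    have "ln (1 + 3 * \<delta>) \<le> 3 * \<delta>" using \<delta> by (intro ln_add_one_self_le_self) auto
    then have "s * ln (1 + 3 * \<delta>) \<le> s * (3 * \<delta>)" using s by (intro mult_left_mono) auto
    then have "s * ln (1 + 3 * \<delta>) \<le> \<theta>" using \<delta>(3) by (simp add: mult_ac)
    then have "(1 + 3 * \<delta>) powr s \<le> exp \<theta>" using \<delta> by (simp add: powr_def)
    moreover have "1 - \<theta> \<le> exp (- \<theta>)" using exp_ge_add_one_self[of "- \<theta>"] by simp
    ultimately have "(1 - \<theta>) * (1 + 3 * \<delta>) powr s \<le> exp (- \<theta>) * exp \<theta>"
      using \<theta> by (intro mult_mono) auto
    then show ?thesis by (simp flip: exp_add)
  qed
  \<comment> \<open>The first summand covers the times up to \<open>2 n0\<close>, where the mass is only known to be at most \<open>D\<close>,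
    the second one the steps at which long excursions dominate.\<close>
  define C0 where "C0 = 2 powr s + 2 * R * \<delta> powr (- s) * (1 + 3 * \<delta>) powr s"
  have C0: "0 < C0" "2 powr s \<le> C0" "2 * R * \<delta> powr (- s) * (1 + 3 * \<delta>) powr s \<le> C0"
    using R \<delta> by (auto simp: C0_def add_pos_nonneg)
  have main: "\<exists>U. coupled b (I + a) D (evolve b a I w) U \<and> U \<le> C0 * D * real n0 powr s * real a powr (- s)"
    if b: "\<And>k. 0 < b k \<and> b k \<le> \<alpha>" and n0: "2 / \<delta> \<le> real n0"
      and vis: "\<And>a l r. n0 \<le> a \<Longrightarrow> \<delta> * real a \<le> real l \<Longrightarrow> r \<le> I + a \<Longrightarrow>
        \<kappa> * real (I + a + l - r) \<le> real (visits b g r (I + a + l))"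
      and cp: "coupled b I D w U0" and a: "n0 \<le> a"
    for b I n0 a w U0 D
    using a
  proof (induction a rule: less_induct)
    case (less a)
    have b1: "\<And>k. 0 < b k \<and> b k \<le> 1" using b \<alpha> by (meson less_imp_le order_trans)
    have b0: "\<And>k. 0 < b k" using b by auto
    have D: "0 \<le> D" using coupled_mass_le[of b, OF b0 cp] by linarith
    have n01: "1 \<le> real n0"
    proof -
      have "2 / (1/4) \<le> 2 / \<delta>" using \<delta> by (intro divide_left_mono) auto
      then show ?thesis using n0 by simp
    qed
    have n0s: "1 \<le> real n0 powr s" using n01 s by (intro ge_one_powr_ge_zero) auto
    show ?case
    proof (cases "a \<le> 2 * n0")
      case True
      have "real n0 powr (- s) \<le> 2 powr s * real a powr (- s)"
        using True less.prems n01 s by (intro powr_scale_le) auto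
      moreover have "real n0 powr s * real n0 powr (- s) = 1"
        using n01 by (simp flip: powr_add)
      ultimately have "1 \<le> real n0 powr s * (2 powr s * real a powr (- s))"
        using mult_left_mono[of "real n0 powr (- s)" "2 powr s * real a powr (- s)" "real n0 powr s"] by simp
      also have "\<dots> \<le> real n0 powr s * (C0 * real a powr (- s))"
        using C0 by (intro mult_left_mono mult_right_mono) auto
      finally have "D * 1 \<le> D * (real n0 powr s * (C0 * real a powr (- s)))"
        using D by (intro mult_left_mono)
      then have "U0 \<le> C0 * D * real n0 powr s * real a powr (- s)"
        using coupled_mass_le[of b, OF b0 cp] by (simp add: mult_ac)
      then show ?thesis using coupled_evolve[of b, OF b1 cp] by blast
    next
      case False
      then obtain a' l where al: "n0 \<le> a'" "a = a' + l + 1" "\<delta> * real a' \<le> real l" "1 \<le> l"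
          "real a \<le> (1 + 3 * \<delta>) * real a'"
        using geometric_time_steps[OF \<delta>(1,2) n0, of a] by (metis not_le)
      from less.IH[of a'] al obtain U where U: "coupled b (I + a') D (evolve b a' I w) U"
          "U \<le> C0 * D * real n0 powr s * real a' powr (- s)" by auto
      have eva: "evolve b a I w = evolve b (l + 1) (I + a') (evolve b a' I w)"
        using evolve_add[of b a' "l + 1" I w] al(2) by (simp add: add.assoc)
      have ta: "I + a = I + a' + l + 1" "I + a = I + a' + (l + 1)" using al(2) by auto
      have a'0: "0 < real a'" using al n01 by linarith
      have a0: "0 < real a" using al(2) by simp
      have aa: "real a' powr (- s) \<le> (1 + 3 * \<delta>) powr s * real a powr (- s)"
        using a'0 a0 \<delta> s al(5) by (intro powr_scale_le) auto
      define B where "B = C0 * D * real n0 powr s"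
      have B: "0 \<le> B" using C0 D by (simp add: B_def)
      define \<rho> where "\<rho> = staying_mass b l (I + a') (evolve b (I + a') 0 (\<lambda>_. 1))"
      show ?thesis
      proof (cases "2 * D * \<rho> \<le> U")
        case True
        have "coupled b (I + a' + l + 1) D (evolve b (l + 1) (I + a') (evolve b a' I w)) ((1 - c / 128) * U)"
          using True unfolding \<rho>_def by (intro coupling_step b1 U(1) D c(1) c(3) b)
        moreover have "(1 - c / 128) * U \<le> B * real a powr (- s)"
        proof -
          have "(1 - \<theta>) * U \<le> (1 - \<theta>) * (B * real a' powr (- s))"
            using \<theta> U(2) unfolding B_def by (intro mult_left_mono) auto
          also have "\<dots> \<le> (1 - \<theta>) * (B * ((1 + 3 * \<delta>) powr s * real a powr (- s)))"
            using \<theta> B aa by (intro mult_left_mono) auto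
          also have "\<dots> = ((1 - \<theta>) * (1 + 3 * \<delta>) powr s) * (B * real a powr (- s))" by simp
          also have "\<dots> \<le> 1 * (B * real a powr (- s))" using growth B by (intro mult_right_mono) auto
          finally show ?thesis by (simp add: \<theta>_def)
        qed
        ultimately show ?thesis unfolding eva ta(1) B_def by blast
      next
        case False
        have "\<rho> \<le> R * real l powr (- s)"
          unfolding \<rho>_def using al by (intro R(2) b1 vis) auto
        moreover have "real l powr (- s) \<le> (\<delta> * real a') powr (- s)"
          using al(3) a'0 \<delta> s by (intro powr_mono2') auto
        moreover have "\<dots> = \<delta> powr (- s) * real a' powr (- s)" using \<delta> by (simp add: powr_mult)
        ultimately have "\<rho> \<le> R * (\<delta> powr (- s) * real a' powr (- s))"
          using R(1) by (smt (verit) mult_left_mono)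
        also have "\<dots> \<le> R * (\<delta> powr (- s) * ((1 + 3 * \<delta>) powr s * real a powr (- s)))"
          using R(1) aa by (intro mult_left_mono) auto
        finally have "2 * D * \<rho> \<le> 2 * D * (R * (\<delta> powr (- s) * ((1 + 3 * \<delta>) powr s * real a powr (- s))))"
          using D by (intro mult_left_mono) auto
        also have "\<dots> = (2 * R * \<delta> powr (- s) * (1 + 3 * \<delta>) powr s) * (D * real a powr (- s))" by simp
        also have "\<dots> \<le> (C0 * real n0 powr s) * (D * real a powr (- s))"
          using C0 n0s D mult_mono[OF C0(3) n0s] by (intro mult_right_mono) auto
        finally have "U \<le> C0 * D * real n0 powr s * real a powr (- s)" using False by (simp add: mult_ac)
        moreover have "coupled b (I + a) D (evolve b a I w) U"
          unfolding eva ta(2) by (rule coupled_evolve[of b, OF b1 U(1)])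
        ultimately show ?thesis by blast
      qed
    qed
  qed
  show thesis
  proof (rule that)
    show "0 < \<delta>" "\<delta> \<le> 1/4" by (rule \<delta>)+
    show "0 < 2 * C0" using C0 by simp
    fix b :: "nat \<Rightarrow> real" and I n0 a :: nat and w U0 and D :: real
    assume b: "\<And>k. 0 < b k \<and> b k \<le> \<alpha>" and n0: "2 / \<delta> \<le> real n0"
      and vis: "\<And>a l r. n0 \<le> a \<Longrightarrow> \<delta> * real a \<le> real l \<Longrightarrow> r \<le> I + a \<Longrightarrow>
        \<kappa> * real (I + a + l - r) \<le> real (visits b g r (I + a + l))"
      and cp: "coupled b I D w U0" and a: "1 \<le> a"
    have b1: "\<And>k. 0 < b k \<and> b k \<le> 1" using b \<alpha> by (meson less_imp_le order_trans)
    have b0: "\<And>k. 0 < b k" using b by auto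
    have D: "0 \<le> D" using coupled_mass_le[of b, OF b0 cp] by linarith
    obtain U where U: "coupled b (I + a) D (evolve b a I w) U" "U \<le> C0 * D * real n0 powr s * real a powr (- s)"
    proof (cases "n0 \<le> a")
      case True
      from main[of b n0 I D w U0 a, OF b n0 vis cp True] that show thesis by blast
    next
      case False
      have "1 \<le> 2 powr s" using s by (intro ge_one_powr_ge_zero) auto
      then have "1 \<le> C0" using C0 by linarith
      moreover have "1 \<le> real n0 powr s * real a powr (- s)"
        using False a s powr_mono2[of s "real a" "real n0"]
        by (simp add: powr_minus_divide le_divide_eq)
      ultimately have "1 * 1 \<le> C0 * (real n0 powr s * real a powr (- s))" by (intro mult_mono) auto
      then have "D * 1 \<le> D * (C0 * (real n0 powr s * real a powr (- s)))" using D by (intro mult_left_mono) auto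
      then have "U0 \<le> C0 * D * real n0 powr s * real a powr (- s)"
        using coupled_mass_le[of b, OF b0 cp] by (simp add: mult_ac)
      then show thesis using coupled_evolve[of b, OF b1 cp] that by blast
    qed
    then show "(\<integral>x. \<bar>evolve b a I w x\<bar> \<partial>leb)
        \<le> 2 * C0 * D * real n0 powr (1 / g - 1) * real a powr (- (1 / g - 1))"
      using coupled_integral_le[of b, OF b0 U(1)] unfolding s_def by simp
  qed
qed

section \<open>Frequencies of small parameters in windows\<close>

lemma visits_split:
  assumes "s \<le> t" "t \<le> u"
  shows "visits b g s u = visits b g s t + visits b g t u"
proof -
  have "{k\<in>{s..<u}. b k \<le> g} = {k\<in>{s..<t}. b k \<le> g} \<union> {k\<in>{t..<u}. b k \<le> g}" using assms by auto
  then show ?thesis unfolding visits_def by (simp add: card_Un_disjoint disjoint_iff)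
qed

lemma visits_antimono: "s \<le> t \<Longrightarrow> t \<le> u \<Longrightarrow> visits b g t u \<le> visits b g s u"
  by (simp add: visits_split[of s t u])

text \<open>
  The window is \<open>[r, I + a + l)\<close>. If it begins before the base time \<open>I\<close>, the counts on both sides of \<open>I\<close> add up;
  the backward count includes the time \<open>I\<close> itself, whence a correction by \<open>1\<close>. If it begins
  after \<open>I\<close>, its count is a difference of two forward counts, each with an error of at most \<open>\<epsilon>\<close> times the elapsed
  time. This error is small compared with the length of the window, which is at least \<open>\<delta>a\<close>.
\<close>

lemma visits_linear_lower_bound:
  fixes \<delta> \<epsilon> p :: real
  assumes p: "0 < p" and \<delta>: "0 < \<delta>" "\<delta> \<le> 1/4" and \<epsilon>: "0 < \<epsilon>" "\<epsilon> \<le> \<delta> / 16"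
    and fwd: "\<And>n. N < n \<Longrightarrow> p * (1 - \<epsilon>) * real n \<le> real (visits b g I (I + n))"
      "\<And>n. N < n \<Longrightarrow> real (visits b g I (I + n)) \<le> p * (1 + \<epsilon>) * real n"
    and bwd: "\<And>n. N < n \<Longrightarrow> n \<le> Suc I \<Longrightarrow> p * (1 - \<epsilon>) * real n \<le> real (visits b g (Suc I - n) (Suc I))"
    and n0: "2 * (N + 1) \<le> n0" "4 / p \<le> real n0"
    and a: "n0 \<le> a" and l: "\<delta> * real a \<le> real l" and r: "r \<le> I + a"
  shows "p / 8 * real (I + a + l - r) \<le> real (visits b g r (I + a + l))"
proof -
  have \<epsilon>2: "\<epsilon> \<le> 1/2" using \<epsilon> \<delta> by linarith
  have aN: "2 * (N + 1) \<le> a" using n0 a by linarith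
  have "real n0 \<le> real a" using a by simp
  then have "4 / p \<le> real a" using n0(2) by linarith
  then have ap: "4 \<le> p * real a" using p by (simp add: divide_le_eq mult.commute)
  show ?thesis
  proof (cases "I \<le> r")
    case True
    define a' where "a' = r - I"
    \<comment> \<open>The upper bound on forward counts is available only after time \<open>N\<close>.\<close>
    define a'' where "a'' = max a' (N + 1)"
    have r': "r = I + a'" "a' \<le> a" using True r by (auto simp: a'_def)
    have a'': "a' \<le> a''" "N < a''" "a'' \<le> a" using r' aN by (auto simp: a''_def)
    have "visits b g I (I + (a + l)) = visits b g I (I + a'') + visits b g (I + a'') (I + (a + l))"
      using a'' by (intro visits_split) auto
    moreover have "visits b g (I + a'') (I + (a + l)) \<le> visits b g r (I + (a + l))"
      using a'' r' by (intro visits_antimono) auto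
    moreover have "p * (1 - \<epsilon>) * real (a + l) \<le> real (visits b g I (I + (a + l)))"
      using aN by (intro fwd) auto
    moreover have "real (visits b g I (I + a'')) \<le> p * (1 + \<epsilon>) * real a''" using a'' by (intro fwd) auto
    ultimately have "p * (1 - \<epsilon>) * real (a + l) - p * (1 + \<epsilon>) * real a'' \<le> real (visits b g r (I + (a + l)))"
      by linarith
    also have "p * (1 - \<epsilon>) * real (a + l) - p * (1 + \<epsilon>) * real a''
        = p * ((real (a + l) - real a'') - \<epsilon> * (real (a + l) + real a''))" by (simp add: algebra_simps)
    finally have V: "p * ((real (a + l) - real a'') - \<epsilon> * (real (a + l) + real a'')) \<le> real (visits b g r (I + (a + l)))" .
    have E: "\<epsilon> * (real (a + l) + real a'') \<le> (real (a + l) - real a'') / 4"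
    proof -
      have "\<epsilon> * (real (a + l) + real a'') \<le> \<delta> / 16 * (2 * real a + real l)"
        using a'' \<epsilon> by (intro mult_mono) auto
      also have "\<dots> = (2 * (\<delta> * real a) + \<delta> * real l) / 16" by (simp add: algebra_simps)
      also have "\<dots> \<le> real l / 4" using l \<delta> mult_right_mono[of \<delta> 1 "real l"] by simp
      also have "\<dots> \<le> (real (a + l) - real a'') / 4" using a'' by simp
      finally show ?thesis .
    qed
    have quarter: "w / 8 \<le> z - z / 4" if "w \<le> 2 * z" "0 \<le> z" for w z :: real using that by simp
    have "real (a + l) - real a' \<le> 2 * (real (a + l) - real a'')"
      using aN r' unfolding a''_def max_def by (auto split: if_splits)
    moreover have "0 \<le> real (a + l) - real a''" using a'' by simp
    ultimately have "(real (a + l) - real a') / 8 \<le> (real (a + l) - real a'') - (real (a + l) - real a'') / 4"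
      using quarter by blast
    with E have "(real (a + l) - real a') / 8 \<le> (real (a + l) - real a'') - \<epsilon> * (real (a + l) + real a'')"
      by linarith
    then have "p * ((real (a + l) - real a') / 8) \<le> p * ((real (a + l) - real a'') - \<epsilon> * (real (a + l) + real a''))"
      using p by (intro mult_left_mono) auto
    with V have "p * ((real (a + l) - real a') / 8) \<le> real (visits b g r (I + (a + l)))" by linarith
    moreover have "real (I + a + l - r) = real (a + l) - real a'" using r' by simp
    ultimately show ?thesis by (simp add: add.assoc)
  next
    case False
    define k where "k = I - r"
    have k: "r = I - k" "k \<le> I" "1 \<le> k" using False by (auto simp: k_def)
    have sp: "visits b g r (I + a + l) = visits b g r I + visits b g I (I + (a + l))"
      using False visits_split[of r I "I + (a + l)"] by (simp add: add.assoc)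
    have "p * (1/2) * real (a + l) \<le> p * (1 - \<epsilon>) * real (a + l)"
      using p \<epsilon>2 by (intro mult_right_mono mult_left_mono) auto
    also have "\<dots> \<le> real (visits b g I (I + (a + l)))" using aN by (intro fwd) auto
    finally have f: "p * (1/2) * real (a + l) \<le> real (visits b g I (I + (a + l)))" .
    have len: "real (I + a + l - r) = real (a + l) + real k" using k by simp
    have pa: "4 \<le> p * real (a + l)" using ap p by (simp add: distrib_left add_increasing2)
    show ?thesis
    proof (cases "k \<le> N")
      case True
      then have "real k \<le> real (a + l)" using aN by simp
      then have "p * real k \<le> p * real (a + l)" using p by (intro mult_left_mono) auto
      then show ?thesis using f pa unfolding len sp by (simp add: distrib_left)
    next
      case False
      then have "p * (1 - \<epsilon>) * real (k + 1) \<le> real (visits b g (Suc I - (k + 1)) (Suc I))"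
        using k by (intro bwd) auto
      also have "visits b g (Suc I - (k + 1)) (Suc I) = visits b g r I + visits b g I (Suc I)"
        using k visits_split[of "I - k" I "Suc I"] by simp
      also have "visits b g I (Suc I) \<le> 1" by (simp add: visits_split_first)
      finally have "p * (1 - \<epsilon>) * real (k + 1) \<le> real (visits b g r I) + 1" by simp
      moreover have "p * (1/2) * real k \<le> p * (1 - \<epsilon>) * real (k + 1)"
        using p \<epsilon>2 by (intro mult_mono) auto
      ultimately have "p * (1/2) * real k \<le> real (visits b g r I) + 1" by linarith
      moreover have "0 \<le> p * real k" using p by simp
      ultimately show ?thesis using f pa unfolding len sp by (simp add: distrib_left)
    qed
  qed
qed

text \<open>
  All conditions on the starting time \<open>n0\<close> of the coupling are met by a multiple of \<open>1 + N\<close>, with a factor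
  that depends only on \<open>\<delta>\<close> and \<open>p\<close>.
\<close>

lemma memory_loss_deviation:
  assumes g: "0 < g" "g < 1" and \<alpha>: "0 < \<alpha>" "\<alpha> < 1" and p: "0 < p"
  obtains \<epsilon>0 C where "0 < \<epsilon>0" "\<epsilon>0 < 1/2" "0 < C"
    "\<And>b I N \<epsilon> a w U D. (\<And>k. 0 < b k \<and> b k \<le> \<alpha>) \<Longrightarrow> 0 < \<epsilon> \<Longrightarrow> \<epsilon> \<le> \<epsilon>0 \<Longrightarrow>
      (\<And>n. N < n \<Longrightarrow> p * (1 - \<epsilon>) * real n \<le> real (visits b g I (I + n))) \<Longrightarrow>
      (\<And>n. N < n \<Longrightarrow> real (visits b g I (I + n)) \<le> p * (1 + \<epsilon>) * real n) \<Longrightarrow>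
      (\<And>n. N < n \<Longrightarrow> n \<le> Suc I \<Longrightarrow> p * (1 - \<epsilon>) * real n \<le> real (visits b g (Suc I - n) (Suc I))) \<Longrightarrow>
      coupled b I D w U \<Longrightarrow> 1 \<le> a \<Longrightarrow>
      (\<integral>x. \<bar>evolve b a I w x\<bar> \<partial>leb)
        \<le> C * (1 + real N) powr (1 / g - 1) * real a powr (- (1 / g - 1)) * D"
proof -
  have p8: "0 < p / 8" using p by simp
  obtain \<delta> C where \<delta>: "0 < \<delta>" "\<delta> \<le> 1/4" and C: "0 < C"
    and ml: "\<And>b I n0 a w U D. (\<And>k. 0 < b k \<and> b k \<le> \<alpha>) \<Longrightarrow> 2 / \<delta> \<le> real n0 \<Longrightarrow>
      (\<And>a l r. n0 \<le> a \<Longrightarrow> \<delta> * real a \<le> real l \<Longrightarrow> r \<le> I + a \<Longrightarrow>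
        p / 8 * real (I + a + l - r) \<le> real (visits b g r (I + a + l))) \<Longrightarrow>
      coupled b I D w U \<Longrightarrow> 1 \<le> a \<Longrightarrow>
      (\<integral>x. \<bar>evolve b a I w x\<bar> \<partial>leb)
        \<le> C * D * real n0 powr (1 / g - 1) * real a powr (- (1 / g - 1))"
    by (rule memory_loss[OF g \<alpha> p8]) blast
  define s where "s = 1 / g - 1"
  have s: "0 < s" using g by (simp add: s_def)
  define A where "A = 2 / \<delta> + 4 / p + 3"
  have A: "0 < A" using \<delta> p by (simp add: A_def add_pos_pos)
  show thesis
  proof (rule that)
    show "0 < \<delta> / 16" "\<delta> / 16 < 1/2" using \<delta> by auto
    show "0 < C * A powr s" using C A by simp
    fix b :: "nat \<Rightarrow> real" and I N a :: nat and \<epsilon> D :: real and w U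
    assume b: "\<And>k. 0 < b k \<and> b k \<le> \<alpha>" and \<epsilon>: "0 < \<epsilon>" "\<epsilon> \<le> \<delta> / 16"
      and f1: "\<And>n. N < n \<Longrightarrow> p * (1 - \<epsilon>) * real n \<le> real (visits b g I (I + n))"
      and f2: "\<And>n. N < n \<Longrightarrow> real (visits b g I (I + n)) \<le> p * (1 + \<epsilon>) * real n"
      and bw: "\<And>n. N < n \<Longrightarrow> n \<le> Suc I \<Longrightarrow> p * (1 - \<epsilon>) * real n \<le> real (visits b g (Suc I - n) (Suc I))"
      and cp: "coupled b I D w U" and a: "1 \<le> a"
    have D: "0 \<le> D" using coupled_mass_le[of b I D w U] b cp by fastforce
    define n0 where "n0 = nat \<lceil>(2 / \<delta> + 4 / p + 2) * real (N + 1)\<rceil>"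
    have "0 \<le> (2 / \<delta> + 4 / p + 2) * real (N + 1)" using \<delta> p by simp
    then have n0: "(2 / \<delta> + 4 / p + 2) * real (N + 1) \<le> real n0" "real n0 \<le> (2 / \<delta> + 4 / p + 2) * real (N + 1) + 1"
      unfolding n0_def by (simp_all add: of_nat_nat)
    have e: "(2 / \<delta> + 4 / p + 2) * real (N + 1)
        = 2 / \<delta> + 4 / p + 2 * real (N + 1) + (2 / \<delta> * real N + 4 / p * real N)"
      by (simp add: algebra_simps add_divide_distrib)
    have "0 \<le> 2 / \<delta> * real N" "0 \<le> 4 / p * real N" "0 \<le> 2 / \<delta>" "0 \<le> 4 / p" using \<delta> p by auto
    with n0(1) e have n0': "2 / \<delta> \<le> real n0" "4 / p \<le> real n0" "2 * real (N + 1) \<le> real n0" by linarith+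
    have "real n0 \<le> A * (1 + real N)" using n0(2) by (simp add: A_def algebra_simps)
    then have "real n0 powr s \<le> (A * (1 + real N)) powr s" using s by (intro powr_mono2) auto
    also have "\<dots> = A powr s * (1 + real N) powr s" using A by (simp add: powr_mult)
    finally have n0s: "real n0 powr s \<le> A powr s * (1 + real N) powr s" .
    have "(\<integral>x. \<bar>evolve b a I w x\<bar> \<partial>leb) \<le> C * D * real n0 powr s * real a powr (- s)"
      unfolding s_def
      by (rule ml[OF b n0'(1) visits_linear_lower_bound[OF p \<delta> \<epsilon> f1 f2 bw _ n0'(2)] cp a])
         (use n0'(3) in auto)
    also have "\<dots> \<le> C * D * (A powr s * (1 + real N) powr s) * real a powr (- s)"
      using C D n0s by (intro mult_right_mono mult_left_mono) auto
    finally show "(\<integral>x. \<bar>evolve b a I w x\<bar> \<partial>leb)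
        \<le> C * A powr s * (1 + real N) powr (1 / g - 1) * real a powr (- (1 / g - 1)) * D"
      by (simp add: s_def mult_ac)
  qed
qed

section \<open>Observables\<close>

lemma lipschitz_measurable:
  fixes f :: "real \<Rightarrow> real"
  assumes "L-lipschitz_on {0..1} f"
  shows "f \<in> borel_measurable leb"
proof -
  have "f \<in> borel_measurable (restrict_space borel {0..1})"
    using lipschitz_on_continuous_on[OF assms] by (rule borel_measurable_continuous_on_restrict)
  then show ?thesis using measurable_cong_sets[OF sets_unit_lebesgue refl] by blast
qed

lemma integrable_bounded_mult:
  fixes f g :: "real \<Rightarrow> real"
  assumes f: "integrable leb f" and g: "g \<in> borel_measurable leb"
    and B: "\<And>x. x \<in> {0..1} \<Longrightarrow> \<bar>g x\<bar> \<le> B"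
  shows "integrable leb (\<lambda>x. g x * f x)"
proof (rule Bochner_Integration.integrable_bound)
  show "integrable leb (\<lambda>x. B * f x)" using f by simp
  show "(\<lambda>x. g x * f x) \<in> borel_measurable leb"
    by (rule borel_measurable_times[OF g borel_measurable_integrable[OF f]])
  show "AE x in leb. norm (g x * f x) \<le> norm (B * f x)"
    using B by (intro AE_I2) (auto simp: abs_mult intro!: mult_right_mono order_trans[OF B abs_ge_self])
qed

lemma is_density_bounded_mult:
  assumes f: "is_density f" and g: "g \<in> borel_measurable leb"
    and B: "\<And>x. x \<in> {0..1} \<Longrightarrow> 0 \<le> g x \<and> g x \<le> B"
  shows "is_density (\<lambda>x. g x * f x)"
  using integrable_bounded_mult[OF is_densityD(1)[OF f] g, of B] B is_densityD(3)[OF f]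
  by (auto simp: is_density_def)

text \<open>
  With \<open>A1 = B1 + L1\<close> and \<open>A2 = B2 + L2\<close> the functions \<open>g1 + A1\<close> and \<open>g2 + A2\<close> are nonnegative and regular with exponent
  \<open>1\<close>. Expanding the product, \<open>\<Phi>\<close> becomes a combination of four densities. Starting from exponent \<open>2\<close>
  for the images of \<open>1\<close>, each of the two multiplications raises the exponent by \<open>1\<close>; this
  is why the coupling works with exponent \<open>4\<close>. The number \<open>9\<close> is the sum of the bounds
  \<open>4 + 2 + 2 + 1\<close> of the four terms.
\<close>

lemma observable_memory_loss:
  fixes b :: "nat \<Rightarrow> real"
  assumes b: "\<And>k. 0 < b k \<and> b k \<le> 1"
    and g1: "L1-lipschitz_on {0..1} g1" "\<And>x. x \<in> {0..1} \<Longrightarrow> \<bar>g1 x\<bar> \<le> B1"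
    and g2: "L2-lipschitz_on {0..1} g2" "\<And>x. x \<in> {0..1} \<Longrightarrow> \<bar>g2 x\<bar> \<le> B2"
    and X: "\<And>w U D. coupled b (m + d) D w U \<Longrightarrow> (\<integral>x. \<bar>evolve b a (m + d) w x\<bar> \<partial>leb) \<le> X * D"
  defines "\<Phi> \<equiv> \<lambda>x. g2 x * evolve b d m (\<lambda>x. g1 x * evolve b m 0 (\<lambda>_. 1) x) x"
  shows "integrable leb \<Phi>"
    "integrable leb (evolve b a (m + d) \<Phi>)"
    "(\<integral>x. evolve b a (m + d) \<Phi> x \<partial>leb) = (\<integral>x. \<Phi> x \<partial>leb)"
    "(\<integral>x. \<bar>evolve b a (m + d) \<Phi> x - (\<integral>x. \<Phi> x \<partial>leb) * evolve b (m + d + a) 0 (\<lambda>_. 1) x\<bar> \<partial>leb)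
      \<le> 9 * (B1 + L1) * (B2 + L2) * X"
proof -
  have b0: "\<And>k. 0 < b k" using b by auto
  define I where "I = m + d"
  define H where "H = (\<lambda>n. evolve b n 0 (\<lambda>_. 1))"
  define E where "E = evolve b a I"
  define A1 A2 where "A1 = B1 + L1" and "A2 = B2 + L2"
  have L: "0 \<le> L1" "0 \<le> L2" using lipschitz_on_nonneg[OF g1(1)] lipschitz_on_nonneg[OF g2(1)] by auto
  have B: "0 \<le> B1" "0 \<le> B2" using g1(2)[of 0] g2(2)[of 0] by auto
  have A: "0 \<le> A1" "0 \<le> A2" using L B by (auto simp: A1_def A2_def)
  have b1: "L1 \<le> g1 x + A1" "g1 x + A1 \<le> 2 * A1" "0 \<le> g1 x + A1" if "x \<in> {0..1}" for x
    using g1(2)[OF that] L by (auto simp: A1_def)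
  have b2: "L2 \<le> g2 x + A2" "g2 x + A2 \<le> 2 * A2" "0 \<le> g2 x + A2" if "x \<in> {0..1}" for x
    using g2(2)[OF that] L by (auto simp: A2_def)
  have r1: "regular 1 {0<..<1} (\<lambda>x. g1 x + A1)" using g1(1) b1(1) by (rule regular_lipschitz_shift)
  have r2: "regular 1 {0<..<1} (\<lambda>x. g2 x + A2)" using g2(1) b2(1) by (rule regular_lipschitz_shift)
  have m1: "(\<lambda>x. g1 x + A1) \<in> borel_measurable leb" "(\<lambda>x. g2 x + A2) \<in> borel_measurable leb"
    using lipschitz_measurable[OF g1(1)] lipschitz_measurable[OF g2(1)] by auto
  have Hd: "is_density (H n)" "(\<integral>x. H n x \<partial>leb) = 1" and Hr: "regular 2 {0<..<1} (H n)" for n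
    unfolding H_def using evolve_one_mass[of b, OF b0] by (auto intro!: evolve_regular b regular_const)
  define f where "f = (\<lambda>x. (g1 x + A1) * H m x)"
  have three: "(1::nat) + 2 = 3" and four: "(1::nat) + 3 = 4" by auto
  have f: "is_density f" "regular 3 {0<..<1} f"
    unfolding f_def using b1 regular_mult[OF r1 Hr, unfolded three]
    by (auto intro!: is_density_bounded_mult[OF Hd(1) m1(1), of "2 * A1"])
  define t2 where "t2 = evolve b d m f"
  define t1 where "t1 = (\<lambda>x. (g2 x + A2) * t2 x)"
  define t3 where "t3 = (\<lambda>x. (g2 x + A2) * H I x)"
  have HI: "H I = evolve b d m (H m)" unfolding H_def I_def using evolve_add[of b m d 0] by simp
  have t2: "is_density t2" "regular 3 {0<..<1} t2"
    unfolding t2_def using f by (auto simp: evolve_density[of b, OF b0] intro!: evolve_regular b)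
  have t1: "is_density t1" "regular 4 {0<..<1} t1"
    unfolding t1_def using b2 regular_mult[OF r2 t2(2), unfolded four]
    by (auto intro!: is_density_bounded_mult[OF t2(1) m1(2), of "2 * A2"])
  have t3: "is_density t3" "regular 3 {0<..<1} t3"
    unfolding t3_def using b2 regular_mult[OF r2 Hr, unfolded three]
    by (auto intro!: is_density_bounded_mult[OF Hd(1) m1(2), of "2 * A2"])
  have up: "regular 4 {0<..<1} u" if "regular K {0<..<1} u" "K \<le> 4" for K u
    using that by (rule regular_exponent_mono) auto
  have Hnn: "0 \<le> H n x" if "x \<in> {0<..<1}" for n x using regularD(1)[OF Hr that that] .
  have t2le: "t2 x \<le> 2 * A1 * H I x" if x: "x \<in> {0<..<1}" for x
  proof -
    have "t2 x \<le> evolve b d m (\<lambda>x. 2 * A1 * H m x) x"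
      unfolding t2_def f_def using b1 Hnn x by (intro evolve_mono_interior[of b] b0 mult_right_mono) auto
    then show ?thesis by (simp add: evolve_cmult HI)
  qed
  have t3le: "t3 x \<le> 2 * A2 * H I x" if x: "x \<in> {0<..<1}" for x
    unfolding t3_def using b2 Hnn x by (intro mult_right_mono) auto
  have t1le: "t1 x \<le> 4 * A1 * A2 * H I x" if x: "x \<in> {0<..<1}" for x
  proof -
    have "t1 x \<le> (2 * A2) * (2 * A1 * H I x)"
      unfolding t1_def using b2[of x] t2le[OF x] x A Hnn[OF x] regularD(1)[OF t2(2) x x] by (intro mult_mono) auto
    then show ?thesis by (simp add: mult_ac)
  qed
  have loss: "integrable leb (E t)" "(\<integral>x. E t x \<partial>leb) = (\<integral>x. t x \<partial>leb)"
    "(\<integral>x. \<bar>E t x - (\<integral>x. t x \<partial>leb) * H (I + a) x\<bar> \<partial>leb) \<le> X * D"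
    if t: "is_density t" "regular 4 {0<..<1} t" "\<And>x. x \<in> {0<..<1} \<Longrightarrow> t x \<le> D * H I x" for t D
  proof -
    show "integrable leb (E t)" "(\<integral>x. E t x \<partial>leb) = (\<integral>x. t x \<partial>leb)"
      unfolding E_def using evolve_density[of b t a I, OF b0 t(1)] by (auto simp: is_density_def)
    let ?M = "\<integral>x. t x \<partial>leb"
    have M0: "0 \<le> ?M" by (rule integral_density_nonneg[OF t(1)])
    have "?M \<le> (\<integral>x. D * H I x \<partial>leb)"
      using t(3) is_densityD(1)[OF t(1)] is_densityD(1)[OF Hd(1)]
      by (intro integral_mono_AE eventually_mono[OF AE_unit_lebesgue_interior]) auto
    then have M: "?M \<le> D" using Hd(2) by simp
    have HI': "evolve b (m + d) 0 (\<lambda>_. 1) = H I" by (simp add: H_def I_def)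
    have "coupled b (m + d) D (\<lambda>x. t x - ?M * H I x) ?M"
      unfolding coupled_def
    proof (rule exI[of _ t], rule exI[of _ "\<lambda>x. ?M * H I x"], intro conjI ballI)
      show "?M * H I x \<le> D * evolve b (m + d) 0 (\<lambda>_. 1) x" if "x \<in> {0<..<1}" for x
        unfolding HI' using M Hnn[OF that] by (intro mult_right_mono) auto
    qed (use t M0 Hd up[OF Hr] in \<open>auto simp: HI' intro!: is_density_cmult regular_cmult\<close>)
    from X[OF this] have "(\<integral>x. \<bar>E (\<lambda>x. t x - ?M * H I x) x\<bar> \<partial>leb) \<le> X * D"
      by (simp add: E_def I_def)
    moreover have "E (\<lambda>x. t x - ?M * H I x) = (\<lambda>x. E t x - ?M * H (I + a) x)"
      unfolding E_def evolve_diff evolve_cmult H_def using evolve_add[of b I a 0] by simp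
    ultimately show "(\<integral>x. \<bar>E t x - ?M * H (I + a) x\<bar> \<partial>leb) \<le> X * D" by simp
  qed
  have \<Phi>: "\<Phi> = (\<lambda>x. 1 * t1 x + (- A2) * (1 * t2 x + (- A1) * H I x) + (- A1) * t3 x)"
  proof
    fix x
    have "evolve b d m (\<lambda>x. 1 * f x + (- A1) * H m x) x = t2 x - A1 * H I x"
      unfolding evolve_linear by (simp add: HI t2_def)
    moreover have "(\<lambda>x. 1 * f x + (- A1) * H m x) = (\<lambda>x. g1 x * H m x)"
      by (simp add: f_def algebra_simps)
    ultimately have "\<Phi> x = g2 x * (t2 x - A1 * H I x)" by (simp add: \<Phi>_def H_def)
    then show "\<Phi> x = 1 * t1 x + (- A2) * (1 * t2 x + (- A1) * H I x) + (- A1) * t3 x"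
      by (simp add: t1_def t3_def algebra_simps)
  qed
  have E\<Phi>: "E \<Phi> = (\<lambda>x. E t1 x - A2 * E t2 x + A1 * A2 * E (H I) x - A1 * E t3 x)"
  proof -
    have "\<Phi> = (\<lambda>x. 1 * (1 * t1 x + (- A2) * t2 x) + 1 * ((A1 * A2) * H I x + (- A1) * t3 x))"
      unfolding \<Phi> by (simp add: algebra_simps)
    then show ?thesis unfolding E_def by (simp only: evolve_linear) (simp add: algebra_simps)
  qed
  note l1 = loss[OF t1(1,2) t1le] and l2 = loss[OF t2(1) up[OF t2(2)] t2le]
    and l3 = loss[OF t3(1) up[OF t3(2)] t3le] and l4 = loss[OF Hd(1) up[OF Hr], of I 1]
  note ints = is_densityD(1)[OF t1(1)] is_densityD(1)[OF t2(1)] is_densityD(1)[OF t3(1)]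
    is_densityD(1)[OF Hd(1)]
  show "integrable leb \<Phi>" unfolding \<Phi> using ints by simp
  have i\<Phi>: "(\<integral>x. \<Phi> x \<partial>leb) = (\<integral>x. t1 x \<partial>leb) - A2 * (\<integral>x. t2 x \<partial>leb)
      + A1 * A2 * (\<integral>x. H I x \<partial>leb) - A1 * (\<integral>x. t3 x \<partial>leb)"
    unfolding \<Phi> using ints by (simp add: algebra_simps)
  have "integrable leb (E \<Phi>)"
    unfolding E\<Phi> using l1(1) l2(1) l3(1) l4(1) by simp
  then show "integrable leb (evolve b a (m + d) \<Phi>)" by (simp add: E_def I_def)
  have "(\<integral>x. E \<Phi> x \<partial>leb) = (\<integral>x. \<Phi> x \<partial>leb)"
    unfolding E\<Phi> i\<Phi> using l1 l2 l3 l4 by simp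
  then show "(\<integral>x. evolve b a (m + d) \<Phi> x \<partial>leb) = (\<integral>x. \<Phi> x \<partial>leb)"
    by (simp add: E_def I_def)
  define e where "e = (\<lambda>t x. \<bar>E t x - (\<integral>x. t x \<partial>leb) * H (I + a) x\<bar>)"
  have ie: "integrable leb (e t)" if "integrable leb (E t)" for t
    unfolding e_def using that is_densityD(1)[OF Hd(1)] by simp
  note ies = ie[OF l1(1)] ie[OF l2(1)] ie[OF l3(1)] ie[OF l4(1)]
  have "(\<integral>x. e \<Phi> x \<partial>leb) \<le> (\<integral>x. e t1 x + A2 * e t2 x + A1 * A2 * e (H I) x + A1 * e t3 x \<partial>leb)"
  proof (rule integral_mono)
    show "integrable leb (e \<Phi>)" by (rule ie) fact
    show "integrable leb (\<lambda>x. e t1 x + A2 * e t2 x + A1 * A2 * e (H I) x + A1 * e t3 x)"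
      using ies by simp
    fix x
    let ?e = "\<lambda>t. E t x - (\<integral>x. t x \<partial>leb) * H (I + a) x"
    have "?e \<Phi> = ?e t1 - A2 * ?e t2 + A1 * A2 * ?e (H I) - A1 * ?e t3"
      unfolding i\<Phi> unfolding E\<Phi> by (simp add: algebra_simps)
    then have "\<bar>?e \<Phi>\<bar> \<le> \<bar>?e t1\<bar> + \<bar>A2 * ?e t2\<bar> + \<bar>A1 * A2 * ?e (H I)\<bar> + \<bar>A1 * ?e t3\<bar>" by linarith
    then show "e \<Phi> x \<le> e t1 x + A2 * e t2 x + A1 * A2 * e (H I) x + A1 * e t3 x"
      using A by (simp add: e_def abs_mult)
  qed
  also have "\<dots> = (\<integral>x. e t1 x \<partial>leb) + A2 * (\<integral>x. e t2 x \<partial>leb)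
      + A1 * A2 * (\<integral>x. e (H I) x \<partial>leb) + A1 * (\<integral>x. e t3 x \<partial>leb)"
    using ies by simp
  also have "\<dots> \<le> X * (4 * A1 * A2) + A2 * (X * (2 * A1)) + A1 * A2 * (X * 1) + A1 * (X * (2 * A2))"
    using l1(3) l2(3) l3(3) l4(3) A unfolding e_def by (intro add_mono mult_left_mono) auto
  also have "\<dots> = 9 * A1 * A2 * X" by (simp add: algebra_simps)
  finally show "(\<integral>x. \<bar>evolve b a (m + d) \<Phi> x - (\<integral>x. \<Phi> x \<partial>leb) * evolve b (m + d + a) 0 (\<lambda>_. 1) x\<bar> \<partial>leb)
      \<le> 9 * (B1 + L1) * (B2 + L2) * X"
    by (simp add: e_def E_def I_def H_def A1_def A2_def)
qed

section \<open>Birkhoff sums\<close>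

locale ergodic_system = prob_space M for M :: "'a measure" +
  fixes T :: "'a \<Rightarrow> 'a"
  assumes T_measurable [measurable]: "T \<in> measurable M M"
    and T_preserves: "distr M M T = M"
    and T_ergodic: "\<And>A. A \<in> sets M \<Longrightarrow> T -` A \<inter> space M = A \<Longrightarrow> measure M A = 0 \<or> measure M A = 1"
begin

lemma AE_compose:
  assumes "AE x in M. Q x" shows "AE x in M. Q (T x)"
proof -
  from assms obtain N where N: "{x \<in> space M. \<not> Q x} \<subseteq> N" "emeasure M N = 0" "N \<in> sets M"
    by (rule AE_E)
  have "emeasure M (T -` N \<inter> space M) = emeasure (distr M M T) N"
    using N(3) by (simp add: emeasure_distr)
  then have "emeasure M (T -` N \<inter> space M) = 0" using N(2) T_preserves by simp
  then show ?thesis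
    using N measurable_space[OF T_measurable]
    by (intro AE_I[of _ _ "T -` N \<inter> space M"]) auto
qed

lemma AE_compose_funpow:
  assumes "AE x in M. Q x" shows "AE x in M. Q ((T ^^ n) x)"
proof (induction n)
  case (Suc n)
  from AE_compose[OF this] show ?case by (simp add: funpow_swap1)
qed (use assms in simp)

text \<open>The maximum of the Birkhoff sums of length at most \<open>n\<close>, the empty one included.\<close>

primrec max_birkhoff :: "('a \<Rightarrow> real) \<Rightarrow> nat \<Rightarrow> 'a \<Rightarrow> real" where
  "max_birkhoff f 0 x = 0"
| "max_birkhoff f (Suc n) x = max 0 (f x + max_birkhoff f n (T x))"

lemma max_birkhoff_nonneg: "0 \<le> max_birkhoff f n x"
  by (cases n) auto

lemma max_birkhoff_mono: "max_birkhoff f n x \<le> max_birkhoff f (Suc n) x"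
proof (induction n arbitrary: x)
  case (Suc n)
  show ?case using Suc[of "T x"] by auto
qed simp

lemma max_birkhoff_le: "m \<le> n \<Longrightarrow> max_birkhoff f m x \<le> max_birkhoff f n x"
  by (rule lift_Suc_mono_le[of "\<lambda>n. max_birkhoff f n x"]) (rule max_birkhoff_mono)

lemma birkhoff_sum_le_max: "(\<Sum>i<n. f ((T ^^ i) x)) \<le> max_birkhoff f n x"
proof (induction n arbitrary: x)
  case (Suc n)
  have "(\<Sum>i<Suc n. f ((T ^^ i) x)) = f x + (\<Sum>i<n. f ((T ^^ i) (T x)))"
    by (simp add: sum.lessThan_Suc_shift funpow_swap1 del: sum.lessThan_Suc)
  then show ?case using Suc[of "T x"] by simp
qed simp

lemma integrable_compose:
  fixes f :: "'a \<Rightarrow> real"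
  assumes "integrable M f"
  shows "integrable M (\<lambda>x. f (T x))" "(\<integral>x. f (T x) \<partial>M) = (\<integral>x. f x \<partial>M)"
proof -
  show "integrable M (\<lambda>x. f (T x))"
    using assms integrable_distr[OF T_measurable, of f] by (simp add: T_preserves)
  show "(\<integral>x. f (T x) \<partial>M) = (\<integral>x. f x \<partial>M)"
    using integral_distr[OF T_measurable, of f] assms by (simp add: T_preserves borel_measurable_integrable)
qed

lemma integrable_max_birkhoff: "integrable M f \<Longrightarrow> integrable M (max_birkhoff f n)"
proof (induction n)
  case (Suc n)
  then show ?case using integrable_compose(1)[of "max_birkhoff f n"] by simp
next
  case 0
  have "max_birkhoff f 0 = (\<lambda>_. 0)" by (rule ext) simp
  then show ?case by simp
qed

text \<open>
  Garsia's argument: where the maximum \<open>m\<close> is positive, \<open>f \<ge> m - m \<circ> T\<close>, and elsewhere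
  \<open>m - m \<circ> T \<le> 0\<close>. The integral of \<open>m - m \<circ> T\<close> vanishes.
\<close>

lemma maximal_ergodic:
  assumes f: "integrable M f"
  shows "0 \<le> (\<integral>x. f x * indicator {x. 0 < max_birkhoff f n x} x \<partial>M)"
proof -
  let ?m = "max_birkhoff f n"
  note m = integrable_max_birkhoff[OF f, of n]
  note [measurable] = borel_measurable_integrable[OF f] borel_measurable_integrable[OF m]
  have "0 = (\<integral>x. ?m x - ?m (T x) \<partial>M)"
    using m integrable_compose[OF m] by simp
  also have "\<dots> \<le> (\<integral>x. f x * indicator {x. 0 < ?m x} x \<partial>M)"
  proof (rule integral_mono)
    show "integrable M (\<lambda>x. ?m x - ?m (T x))" using m integrable_compose[OF m] by simp
    show "integrable M (\<lambda>x. f x * indicator {x. 0 < ?m x} x)"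
    proof (rule Bochner_Integration.integrable_bound[OF f])
      show "(\<lambda>x. f x * indicator {x. 0 < ?m x} x) \<in> borel_measurable M" by measurable
    qed (auto simp: indicator_def)
    fix x
    show "?m x - ?m (T x) \<le> f x * indicator {x. 0 < ?m x} x"
    proof (cases "0 < ?m x")
      case True
      then obtain k where n: "n = Suc k" by (cases n) auto
      have "?m x = f x + max_birkhoff f k (T x)" using True unfolding n by (auto split: if_splits simp: max_def)
      also have "\<dots> \<le> f x + ?m (T x)" unfolding n by (intro add_left_mono max_birkhoff_mono)
      finally show ?thesis using True by simp
    next
      case False
      then show ?thesis using max_birkhoff_nonneg[of f n "T x"] max_birkhoff_nonneg[of f n x] by simp
    qed
  qed
  finally show ?thesis .
qed

text \<open>
  The set on which the maxima of the Birkhoff sums are unbounded is invariant. If it had measure \<open>1\<close>,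
  letting \<open>n\<close> tend to infinity in the maximal inequality would give \<open>0 \<le> \<integral>f\<close>.
\<close>

lemma AE_birkhoff_sums_bounded:
  fixes f :: "'a \<Rightarrow> real"
  assumes f: "integrable M f" and neg: "(\<integral>x. f x \<partial>M) < 0"
  shows "AE x in M. \<exists>K. \<forall>n. (\<Sum>i<n. f ((T ^^ i) x)) \<le> K"
proof -
  note [measurable] = borel_measurable_integrable[OF f] borel_measurable_integrable[OF integrable_max_birkhoff[OF f]]
  define A where "A = {x\<in>space M. \<forall>c::nat. \<exists>n. real c < max_birkhoff f n x}"
  have A [measurable]: "A \<in> sets M" unfolding A_def by measurable
  have step: "(\<forall>c::nat. \<exists>n. real c < max_birkhoff f n (T x)) \<longleftrightarrow> (\<forall>c::nat. \<exists>n. real c < max_birkhoff f n x)" for x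
  proof (intro iffI allI)
    fix c :: nat
    assume *: "\<forall>c::nat. \<exists>n. real c < max_birkhoff f n (T x)"
    obtain c' :: nat where c': "real c - f x \<le> real c'" using real_arch_simple by blast
    from * obtain n where "real c' < max_birkhoff f n (T x)" by blast
    with c' have "real c < f x + max_birkhoff f n (T x)" by linarith
    then have "real c < max_birkhoff f (Suc n) x" by simp
    then show "\<exists>n. real c < max_birkhoff f n x" by blast
  next
    fix c :: nat
    assume *: "\<forall>c::nat. \<exists>n. real c < max_birkhoff f n x"
    obtain c' :: nat where c': "real c + \<bar>f x\<bar> \<le> real c'" using real_arch_simple by blast
    from * obtain n where n: "real c' < max_birkhoff f n x" by blast
    then obtain k where "n = Suc k" by (cases n) auto
    with n c' have "real c < max_birkhoff f k (T x)" by (auto simp: max_def split: if_splits)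
    then show "\<exists>n. real c < max_birkhoff f n (T x)" by blast
  qed
  have "T -` A \<inter> space M = A"
    using step measurable_space[OF T_measurable] by (auto simp: A_def)
  then consider "prob A = 0" | "prob A = 1" using T_ergodic[OF A] by blast
  then show ?thesis
  proof cases
    case 1
    then have "AE x in M. x \<notin> A" using AE_iff_measurable[OF A, of "\<lambda>x. x \<notin> A"] sets.sets_into_space[OF A]
      by (auto simp: emeasure_eq_measure intro!: AE_not_in null_setsI)
    then show ?thesis
    proof (rule AE_mp, intro AE_I2 impI)
      fix x assume "x \<in> space M" "x \<notin> A"
      then obtain c :: nat where c: "\<And>n. max_birkhoff f n x \<le> real c" by (auto simp: A_def not_less)
      then show "\<exists>K. \<forall>n. (\<Sum>i<n. f ((T ^^ i) x)) \<le> K"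
        by (intro exI[of _ "real c"] allI order_trans[OF birkhoff_sum_le_max])
    qed
  next
    case 2
    then have AA: "AE x in M. x \<in> A" by (simp add: prob_eq_1 A)
    have "(\<lambda>n. \<integral>x. f x * indicator {x. 0 < max_birkhoff f n x} x \<partial>M) \<longlonglongrightarrow> (\<integral>x. f x \<partial>M)"
    proof (rule integral_dominated_convergence)
      show "integrable M (\<lambda>x. \<bar>f x\<bar>)" using f by simp
      show "AE x in M. (\<lambda>n. f x * indicator {x. 0 < max_birkhoff f n x} x) \<longlonglongrightarrow> f x"
        using AA
      proof eventually_elim
        fix x assume "x \<in> A"
        then have "\<exists>m. real 0 < max_birkhoff f m x" unfolding A_def by blast
        then obtain m where m: "0 < max_birkhoff f m x" by auto
        have "eventually (\<lambda>n. f x = f x * indicator {x. 0 < max_birkhoff f n x} x) sequentially"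
          using eventually_ge_at_top[of m]
        proof eventually_elim
          case (elim n)
          then show ?case using m max_birkhoff_le[OF elim, of f x] by simp
        qed
        then show "(\<lambda>n. f x * indicator {x. 0 < max_birkhoff f n x} x) \<longlonglongrightarrow> f x"
          by (rule Lim_transform_eventually[OF tendsto_const])
      qed
    qed (auto simp: indicator_def)
    then have "0 \<le> (\<integral>x. f x \<partial>M)"
      by (rule LIMSEQ_le_const) (use maximal_ergodic[OF f] in auto)
    then show ?thesis using neg by simp
  qed
qed

lemma AE_eventually_birkhoff_le:
  fixes f :: "'a \<Rightarrow> real"
  assumes f: "integrable M f" and c: "(\<integral>x. f x \<partial>M) < c"
  shows "AE x in M. eventually (\<lambda>n. (\<Sum>i<n. f ((T ^^ i) x)) \<le> c * real n) sequentially"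
proof -
  define c' where "c' = ((\<integral>x. f x \<partial>M) + c) / 2"
  have c': "(\<integral>x. f x \<partial>M) < c'" "c' < c" using c by (auto simp: c'_def)
  have "integrable M (\<lambda>x. f x - c')" "(\<integral>x. f x - c' \<partial>M) < 0"
    using f c' prob_space by auto
  from AE_birkhoff_sums_bounded[OF this] show ?thesis
  proof (rule AE_mp, intro AE_I2 impI)
    fix x assume "\<exists>K. \<forall>n. (\<Sum>i<n. f ((T ^^ i) x) - c') \<le> K"
    then obtain K where K: "\<And>n. (\<Sum>i<n. f ((T ^^ i) x)) \<le> K + c' * real n"
      by (auto simp: sum_subtractf mult.commute algebra_simps)
    have "eventually (\<lambda>n. K / (c - c') \<le> real n) sequentially"
      using filterlim_real_sequentially by (simp add: filterlim_at_top)
    then show "eventually (\<lambda>n. (\<Sum>i<n. f ((T ^^ i) x)) \<le> c * real n) sequentially"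
    proof eventually_elim
      case (elim n)
      then have "K \<le> (c - c') * real n" using c' by (simp add: divide_le_eq mult.commute)
      then show ?case using K[of n] by (simp add: algebra_simps)
    qed
  qed
qed

lemma AE_finite_deviations:
  assumes \<beta> [measurable]: "\<beta> \<in> borel_measurable M" and pos: "\<And>\<omega>. \<omega> \<in> space M \<Longrightarrow> 0 < \<beta> \<omega>"
    and p: "0 < visit_prob M \<beta> \<gamma>" and \<epsilon>: "0 < \<epsilon>"
  shows "AE \<omega> in M. finite {n. 1 \<le> n \<and> visit_sum \<beta> \<gamma> T n \<omega> / real n
    \<notin> {visit_prob M \<beta> \<gamma> * (1 - \<epsilon>)..visit_prob M \<beta> \<gamma> * (1 + \<epsilon>)}}"
proof -
  let ?f = "\<lambda>\<omega>. indicator {0<..\<gamma>} (\<beta> \<omega>) :: real" and ?p = "visit_prob M \<beta> \<gamma>"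
  have S: "{\<omega>\<in>space M. \<beta> \<omega> \<le> \<gamma>} \<in> sets M" by measurable
  have int: "(\<integral>\<omega>. ?f \<omega> \<partial>M) = ?p"
  proof -
    have "(\<integral>\<omega>. ?f \<omega> \<partial>M) = (\<integral>\<omega>. indicator {\<omega>\<in>space M. \<beta> \<omega> \<le> \<gamma>} \<omega> \<partial>M)"
      using pos by (intro Bochner_Integration.integral_cong) (auto simp: indicator_def)
    then show ?thesis using S by (simp add: visit_prob_def)
  qed
  have f: "integrable M ?f"
    by (rule integrable_const_bound[of _ 1]) (auto simp: indicator_def)
  have "AE \<omega> in M. eventually (\<lambda>n. (\<Sum>i<n. ?f ((T ^^ i) \<omega>)) \<le> (?p * (1 + \<epsilon>)) * real n) sequentially"
    using p \<epsilon> by (intro AE_eventually_birkhoff_le f) (simp add: int)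
  moreover have "AE \<omega> in M. eventually (\<lambda>n. (\<Sum>i<n. - ?f ((T ^^ i) \<omega>)) \<le> (- (?p * (1 - \<epsilon>))) * real n) sequentially"
    using p \<epsilon> f by (intro AE_eventually_birkhoff_le) (simp_all add: int)
  ultimately show ?thesis
  proof eventually_elim
    case (elim \<omega>)
    from eventually_conj[OF elim] obtain N where N: "\<And>n. N \<le> n \<Longrightarrow>
        visit_sum \<beta> \<gamma> T n \<omega> \<le> (?p * (1 + \<epsilon>)) * real n \<and> (?p * (1 - \<epsilon>)) * real n \<le> visit_sum \<beta> \<gamma> T n \<omega>"
      unfolding eventually_sequentially visit_sum_def sum_negf by (metis minus_le_iff minus_minus minus_mult_left neg_le_iff_le)
    have "{n. 1 \<le> n \<and> visit_sum \<beta> \<gamma> T n \<omega> / real n \<notin> {?p * (1 - \<epsilon>)..?p * (1 + \<epsilon>)}} \<subseteq> {..<N}"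
    proof
      fix n assume n: "n \<in> {n. 1 \<le> n \<and> visit_sum \<beta> \<gamma> T n \<omega> / real n \<notin> {?p * (1 - \<epsilon>)..?p * (1 + \<epsilon>)}}"
      show "n \<in> {..<N}"
      proof (rule ccontr)
        assume "n \<notin> {..<N}"
        then have "N \<le> n" by simp
        from N[OF this] n show False by (auto simp: divide_le_eq le_divide_eq)
      qed
    qed
    then show ?case using finite_subset by blast
  qed
qed

end

lemma ergodic_automorphism_systems:
  assumes "prob_space P" "ergodic_automorphism P \<sigma>"
  shows "ergodic_system P \<sigma>" "ergodic_system P (inv_into (space P) \<sigma>)"
proof -
  let ?i = "inv_into (space P) \<sigma>"
  interpret prob_space P by fact
  have bij: "bij_betw \<sigma> (space P) (space P)" and s: "\<sigma> \<in> measurable P P" and i: "?i \<in> measurable P P"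
    and d: "distr P P \<sigma> = P"
    and e: "\<And>A. A \<in> sets P \<Longrightarrow> \<sigma> -` A \<inter> space P = A \<Longrightarrow> measure P A = 0 \<or> measure P A = 1"
    using assms(2) unfolding ergodic_automorphism_def by auto
  show "ergodic_system P \<sigma>" by standard (use s d e in auto)
  have inv_s: "?i (\<sigma> x) = x" if "x \<in> space P" for x using bij that by (simp add: bij_betw_inv_into_left)
  have "distr P P ?i = distr (distr P P \<sigma>) P ?i" by (simp add: d)
  also have "\<dots> = distr P P (?i \<circ> \<sigma>)" by (rule distr_distr[OF i s])
  also have "\<dots> = distr P P (\<lambda>x. x)" by (rule distr_cong) (auto simp: inv_s)
  also have "\<dots> = P" by (rule distr_id)
  finally have di: "distr P P ?i = P" .
  show "ergodic_system P ?i"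
  proof
    fix A assume A: "A \<in> sets P" "?i -` A \<inter> space P = A"
    have "\<sigma> x \<in> A \<longleftrightarrow> x \<in> A" if x: "x \<in> space P" for x
      using A(2) inv_s[OF x] measurable_space[OF s x] by (metis IntE IntI vimageE vimageI)
    then have "\<sigma> -` A \<inter> space P = A" using sets.sets_into_space[OF A(1)] by auto
    then show "measure P A = 0 \<or> measure P A = 1" by (rule e[OF A(1)])
  qed (use i di in auto)
qed

section \<open>The normalised transfer operators\<close>

lemma lsv_transfer_abs_le:
  assumes "0 < b" shows "\<bar>lsv_transfer b f x\<bar> \<le> lsv_transfer b (\<lambda>y. \<bar>f y\<bar>) x"
proof -
  have "lsv_transfer b (\<lambda>y. \<bar>f y\<bar>) x = (\<Sum>y\<in>{y\<in>{0..1}. lsv b y = x}. \<bar>f y / lsv_deriv b y\<bar>)"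
    unfolding lsv_transfer_def using lsv_deriv_pos[OF assms] by (intro sum.cong) (auto simp: abs_divide abs_of_pos)
  then show ?thesis unfolding lsv_transfer_def by (simp only: sum_abs)
qed

lemma lsv_transfer_L1:
  assumes b: "0 < b" and f: "integrable leb f"
  shows "integrable leb (lsv_transfer b f)"
    and "(\<integral>x. \<bar>lsv_transfer b f x\<bar> \<partial>leb) \<le> (\<integral>x. \<bar>f x\<bar> \<partial>leb)"
proof -
  have d: "is_density (\<lambda>x. \<bar>f x\<bar>)" using f by (simp add: is_density_def)
  note Pd = lsv_transfer_density[OF b d]
  show i: "integrable leb (lsv_transfer b f)"
    by (rule Bochner_Integration.integrable_bound[OF is_densityD(1)[OF Pd(1)]
        lsv_transfer_measurable[OF b borel_measurable_integrable[OF f]]])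
      (intro AE_I2, simp, rule order_trans[OF lsv_transfer_abs_le[OF b] abs_ge_self])
  have "(\<integral>x. \<bar>lsv_transfer b f x\<bar> \<partial>leb) \<le> (\<integral>x. lsv_transfer b (\<lambda>y. \<bar>f y\<bar>) x \<partial>leb)"
    using i is_densityD(1)[OF Pd(1)] lsv_transfer_abs_le[OF b] by (intro integral_mono) auto
  then show "(\<integral>x. \<bar>lsv_transfer b f x\<bar> \<partial>leb) \<le> (\<integral>x. \<bar>f x\<bar> \<partial>leb)" using Pd(2) by simp
qed

lemma lsv_transfer_diff: "lsv_transfer b (\<lambda>x. f x - g x) y = lsv_transfer b f y - lsv_transfer b g y"
  using lsv_transfer_linear[of b 1 f "-1" g y] by simp

lemma AE_eqI_L1:
  fixes f g :: "real \<Rightarrow> real"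
  assumes "integrable leb f" "integrable leb g"
    and "(\<integral>x. \<bar>f x - g x\<bar> \<partial>leb) \<le> 0"
  shows "AE x in leb. f x = g x"
proof -
  have "(\<integral>x. \<bar>f x - g x\<bar> \<partial>leb) = 0"
    using assms(3) by (intro antisym integral_nonneg) auto
  then have "AE x in leb. \<bar>f x - g x\<bar> = 0"
    by (subst (asm) integral_nonneg_eq_0_iff_AE) (use assms in auto)
  then show ?thesis by eventually_elim simp
qed

lemma lsv_transfer_cong_AE:
  assumes b: "0 < b" and f: "integrable leb f" and g: "integrable leb g"
    and eq: "AE x in leb. f x = g x"
  shows "AE x in leb. lsv_transfer b f x = lsv_transfer b g x"
proof (rule AE_eqI_L1)
  have i: "integrable leb (\<lambda>x. f x - g x)" using f g by simp
  have "(\<integral>x. \<bar>f x - g x\<bar> \<partial>leb) = (\<integral>x. 0 \<partial>leb)"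
    using i eq by (intro integral_cong_AE) (auto intro: borel_measurable_integrable)
  then show "(\<integral>x. \<bar>lsv_transfer b f x - lsv_transfer b g x\<bar> \<partial>leb) \<le> 0"
    using lsv_transfer_L1(2)[OF b i] by (simp add: lsv_transfer_diff)
qed (use lsv_transfer_L1(1)[OF b] f g in auto)

lemma lsv_transfer_mono_AE:
  assumes b: "0 < b" and f: "integrable leb f" and g: "integrable leb g"
    and le: "AE x in leb. f x \<le> g x"
  shows "AE x in leb. lsv_transfer b f x \<le> lsv_transfer b g x"
proof -
  have "AE x in leb. lsv_transfer b f x = lsv_transfer b (\<lambda>x. min (f x) (g x)) x"
  proof (intro lsv_transfer_cong_AE b f integrable_min g)
    show "AE x in leb. f x = min (f x) (g x)" using le by eventually_elim simp
  qed
  then show ?thesis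
  proof eventually_elim
    case (elim x)
    show ?case unfolding elim by (rule lsv_transfer_mono[OF b]) simp
  qed
qed

lemma evolve_L1:
  assumes b: "\<And>k. 0 < b k" and f: "integrable leb f"
  shows "integrable leb (evolve b n t f)"
    and "(\<integral>x. \<bar>evolve b n t f x\<bar> \<partial>leb) \<le> (\<integral>x. \<bar>f x\<bar> \<partial>leb)"
proof -
  have "integrable leb (evolve b n t f) \<and>
    (\<integral>x. \<bar>evolve b n t f x\<bar> \<partial>leb) \<le> (\<integral>x. \<bar>f x\<bar> \<partial>leb)"
  proof (induction n)
    case (Suc n)
    then show ?case
      using lsv_transfer_L1[OF b, of "evolve b n t f" "t + n"] by (simp add: evolve_Suc)
  qed (use f in simp)
  then show "integrable leb (evolve b n t f)"
    "(\<integral>x. \<bar>evolve b n t f x\<bar> \<partial>leb) \<le> (\<integral>x. \<bar>f x\<bar> \<partial>leb)" by auto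
qed

lemma evolve_cong_AE:
  assumes b: "\<And>k. 0 < b k" and f: "integrable leb f" and g: "integrable leb g"
    and eq: "AE x in leb. f x = g x"
  shows "AE x in leb. evolve b n t f x = evolve b n t g x"
proof (induction n)
  case (Suc n)
  show ?case
    unfolding evolve_Suc by (rule lsv_transfer_cong_AE[OF b evolve_L1(1)[of b, OF b f] evolve_L1(1)[of b, OF b g] Suc])
qed (use eq in simp)

lemma cocycle_shift:
  "cocycle \<sigma> A n ((\<sigma> ^^ k) \<omega>) = cocycle Suc (\<lambda>k. A ((\<sigma> ^^ k) \<omega>)) n k"
  by (induction n) (simp_all add: funpow_add add.commute)

lemma cocycle_lsv_transfer:
  "cocycle \<sigma> (\<lambda>\<omega>. lsv_transfer (\<beta> \<omega>)) n ((\<sigma> ^^ k) \<omega>) = evolve (\<lambda>k. \<beta> ((\<sigma> ^^ k) \<omega>)) n k"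
  by (simp add: cocycle_shift evolve_def)

lemma evolve_cong_shift:
  assumes "\<And>k. b (t + k) = c (u + k)"
  shows "evolve b n t = evolve c n u"
proof
  fix f
  have "(\<lambda>k. b (k + t)) = (\<lambda>k. c (k + u))" using assms by (simp add: add.commute)
  then show "evolve b n t f = evolve c n u f"
    using evolve_shift[of b t n 0 f] evolve_shift[of c u n 0 f] by simp
qed

text \<open>
  Both sides depend continuously on \<open>h\<close> in \<open>L\<^sup>1\<close>, because the transfer operators are contractions; thus
  a bound that is uniform over the approximating densities \<open>H m\<close> passes to \<open>h\<close>. The pointwise estimates of
  the coupling concern the functions \<open>H m\<close>, whereas \<open>h\<close> is determined only up to null sets.
\<close>

lemma memory_loss_limit:
  fixes h :: "real \<Rightarrow> real" and c :: "nat \<Rightarrow> real" and s d a :: nat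
  assumes c: "\<And>k. 0 < c k" and h: "integrable leb h"
    and H: "\<And>m. is_density (H m)" "\<And>m. (\<integral>x. H m x \<partial>leb) = 1"
    and lim: "(\<lambda>m::nat. \<integral>x. \<bar>H m x - h x\<bar> \<partial>leb) \<longlonglongrightarrow> 0"
    and g1: "g1 \<in> borel_measurable leb" "\<And>x. x \<in> {0..1} \<Longrightarrow> \<bar>g1 x\<bar> \<le> B1"
    and g2: "g2 \<in> borel_measurable leb" "\<And>x. x \<in> {0..1} \<Longrightarrow> \<bar>g2 x\<bar> \<le> B2"
  defines "\<Phi> \<equiv> \<lambda>f x. g2 x * evolve c d s (\<lambda>x. g1 x * f x) x"
  defines "E \<equiv> evolve c a (s + d)"
  assumes bound: "\<And>m. (\<integral>x. \<bar>E (\<Phi> (H m)) x - (\<integral>x. E (\<Phi> (H m)) x \<partial>leb) * evolve c (d + a) s (H m) x\<bar> \<partial>leb) \<le> Z"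
  shows "integrable leb (\<Phi> h)"
    "(\<integral>x. \<bar>E (\<Phi> h) x - (\<integral>x. E (\<Phi> h) x \<partial>leb) * evolve c (d + a) s h x\<bar> \<partial>leb) \<le> Z"
proof -
  have B: "0 \<le> B1" "0 \<le> B2" using g1(2)[of 0] g2(2)[of 0] by auto
  have i\<Phi>: "integrable leb (\<Phi> f)"
    and n\<Phi>: "(\<integral>x. \<bar>\<Phi> f x\<bar> \<partial>leb) \<le> B1 * B2 * (\<integral>x. \<bar>f x\<bar> \<partial>leb)"
    if f: "integrable leb f" for f
  proof -
    have i1: "integrable leb (\<lambda>x. g1 x * f x)" using f g1 by (rule integrable_bounded_mult)
    note e = evolve_L1[of c, OF c i1, of d s]
    show i2: "integrable leb (\<Phi> f)" unfolding \<Phi>_def using e(1) g2 by (rule integrable_bounded_mult)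
    have "(\<integral>x. \<bar>\<Phi> f x\<bar> \<partial>leb) \<le> (\<integral>x. B2 * \<bar>evolve c d s (\<lambda>x. g1 x * f x) x\<bar> \<partial>leb)"
      using integrable_abs[OF i2] e(1) g2(2) unfolding \<Phi>_def by (intro integral_mono) (auto simp: abs_mult intro!: mult_right_mono)
    also have "\<dots> \<le> B2 * (\<integral>x. \<bar>g1 x * f x\<bar> \<partial>leb)" using e(2) B by (auto intro: mult_left_mono)
    also have "\<dots> \<le> B2 * (\<integral>x. B1 * \<bar>f x\<bar> \<partial>leb)"
      using integrable_abs[OF i1] f g1(2) by (intro mult_left_mono B integral_mono) (auto simp: abs_mult intro!: mult_right_mono)
    finally show "(\<integral>x. \<bar>\<Phi> f x\<bar> \<partial>leb) \<le> B1 * B2 * (\<integral>x. \<bar>f x\<bar> \<partial>leb)"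
      by (simp add: mult_ac)
  qed
  show "integrable leb (\<Phi> h)" using h by (rule i\<Phi>)
  have \<Phi>diff: "\<Phi> (\<lambda>x. f x - f' x) = (\<lambda>x. \<Phi> f x - \<Phi> f' x)" for f f'
    unfolding \<Phi>_def by (simp add: right_diff_distrib evolve_diff)
  let ?I = "\<lambda>f. \<integral>x. f x \<partial>leb" and ?N = "\<lambda>f. \<integral>x. \<bar>f x\<bar> \<partial>leb"
  let ?h = "evolve c (d + a) s"
  define W where "W = B1 * B2 + B1 * B2 + \<bar>?I (E (\<Phi> h))\<bar>"
  have est: "?N (\<lambda>x. E (\<Phi> h) x - ?I (E (\<Phi> h)) * ?h h x) \<le> Z + W * ?N (\<lambda>x. H m x - h x)" for m
  proof -
    note Hi = is_densityD(1)[OF H(1)[of m]]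
    have iE: "integrable leb (E (\<Phi> f))" if "integrable leb f" for f
      unfolding E_def using i\<Phi>[OF that] by (intro evolve_L1 c)
    have ih: "integrable leb (?h f)" if "integrable leb f" for f
      using that by (intro evolve_L1 c)
    have dE: "E (\<Phi> (H m)) x - E (\<Phi> h) x = E (\<Phi> (\<lambda>x. H m x - h x)) x" for x
      unfolding E_def \<Phi>diff evolve_diff ..
    have d1: "?N (\<lambda>x. E (\<Phi> (H m)) x - E (\<Phi> h) x) \<le> B1 * B2 * ?N (\<lambda>x. H m x - h x)"
      unfolding dE unfolding E_def
      using evolve_L1(2)[of c, OF c i\<Phi>[of "\<lambda>x. H m x - h x"], of a "s + d"] n\<Phi>[of "\<lambda>x. H m x - h x"] Hi h by simp
    have d2: "\<bar>?I (E (\<Phi> (H m))) - ?I (E (\<Phi> h))\<bar> \<le> B1 * B2 * ?N (\<lambda>x. H m x - h x)"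
      using integral_abs_bound[of leb "\<lambda>x. E (\<Phi> (H m)) x - E (\<Phi> h) x"] d1 iE[OF Hi] iE[OF h] by simp
    have d3: "?N (\<lambda>x. ?h (H m) x - ?h h x) \<le> ?N (\<lambda>x. H m x - h x)"
      using evolve_L1(2)[of c "\<lambda>x. H m x - h x" "d + a" s, OF c] Hi h by (simp add: evolve_diff)
    have d4: "?N (?h (H m)) = 1"
    proof -
      have "is_density (?h (H m))" "?I (?h (H m)) = 1" using evolve_density[of c "H m", OF c H(1)] H(2) by auto
      moreover have "?N (?h (H m)) = ?I (?h (H m))"
        using is_densityD(3)[OF \<open>is_density (?h (H m))\<close>] by (intro Bochner_Integration.integral_cong) auto
      ultimately show ?thesis by simp
    qed
    let ?A = "\<lambda>x. \<bar>E (\<Phi> (H m)) x - E (\<Phi> h) x\<bar>"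
    let ?B = "\<lambda>x. \<bar>E (\<Phi> (H m)) x - ?I (E (\<Phi> (H m))) * ?h (H m) x\<bar>"
    let ?C = "\<lambda>x. \<bar>?I (E (\<Phi> (H m))) - ?I (E (\<Phi> h))\<bar> * \<bar>?h (H m) x\<bar>"
    let ?D = "\<lambda>x. \<bar>?I (E (\<Phi> h))\<bar> * \<bar>?h (H m) x - ?h h x\<bar>"
    note ints = iE[OF Hi] iE[OF h] ih[OF Hi] ih[OF h]
    have "?N (\<lambda>x. E (\<Phi> h) x - ?I (E (\<Phi> h)) * ?h h x) \<le> ?I (\<lambda>x. ?A x + ?B x + ?C x + ?D x)"
    proof (rule integral_mono)
      fix x
      have "E (\<Phi> h) x - ?I (E (\<Phi> h)) * ?h h x = - (E (\<Phi> (H m)) x - E (\<Phi> h) x)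
        + (E (\<Phi> (H m)) x - ?I (E (\<Phi> (H m))) * ?h (H m) x)
        + (?I (E (\<Phi> (H m))) - ?I (E (\<Phi> h))) * ?h (H m) x
        + ?I (E (\<Phi> h)) * (?h (H m) x - ?h h x)" by (simp add: algebra_simps)
      then show "\<bar>E (\<Phi> h) x - ?I (E (\<Phi> h)) * ?h h x\<bar> \<le> ?A x + ?B x + ?C x + ?D x"
        unfolding abs_mult[symmetric] by linarith
    qed (use ints in auto)
    also have "\<dots> = ?I ?A + ?I ?B + ?I ?C + ?I ?D" using ints by simp
    also have "?I ?C = \<bar>?I (E (\<Phi> (H m))) - ?I (E (\<Phi> h))\<bar>" using d4 by simp
    also have "?I ?D = \<bar>?I (E (\<Phi> h))\<bar> * ?N (\<lambda>x. ?h (H m) x - ?h h x)" by simp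
    also have "\<dots> \<le> \<bar>?I (E (\<Phi> h))\<bar> * ?N (\<lambda>x. H m x - h x)" using d3 by (intro mult_left_mono) auto
    finally show ?thesis using d1 d2 bound[of m] by (simp add: W_def algebra_simps)
  qed
  have "(\<lambda>m. Z + W * ?N (\<lambda>x. H m x - h x)) \<longlonglongrightarrow> Z + W * 0" by (intro tendsto_intros lim)
  then have "?N (\<lambda>x. E (\<Phi> h) x - ?I (E (\<Phi> h)) * ?h h x) \<le> Z + W * 0"
    by (rule LIMSEQ_le_const) (use est in auto)
  then show "?N (\<lambda>x. E (\<Phi> h) x - ?I (E (\<Phi> h)) * ?h h x) \<le> Z" by simp
qed

text \<open>
  The division by \<open>h\<close> is harmless: where \<open>h\<close> vanishes, the numerator vanishes too, since the
  inequality \<open>\<bar>\<phi> h\<bar> \<le> G h\<close> is preserved by the transfer operators.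
\<close>

lemma normalised_transfer_cocycle:
  fixes h :: "'a \<Rightarrow> real \<Rightarrow> real" and k n :: nat
  assumes pos: "\<And>k. 0 < \<beta> ((\<sigma> ^^ k) \<omega>)"
    and int: "\<And>k. integrable leb (h ((\<sigma> ^^ k) \<omega>))"
    and nn: "\<And>k. AE x in leb. 0 \<le> h ((\<sigma> ^^ k) \<omega>) x"
    and inv: "\<And>k. AE x in leb. lsv_transfer (\<beta> ((\<sigma> ^^ k) \<omega>)) (h ((\<sigma> ^^ k) \<omega>)) x = h ((\<sigma> ^^ Suc k) \<omega>) x"
    and \<phi>: "\<phi> \<in> borel_measurable leb" "AE x in leb. \<bar>\<phi> x\<bar> \<le> G" and G: "0 \<le> G"
  defines "L \<equiv> \<lambda>n. cocycle \<sigma> (normalised_transfer \<sigma> \<beta> h) n ((\<sigma> ^^ k) \<omega>) \<phi>"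
    and "E \<equiv> \<lambda>n. evolve (\<lambda>k. \<beta> ((\<sigma> ^^ k) \<omega>)) n k (\<lambda>x. \<phi> x * h ((\<sigma> ^^ k) \<omega>) x)"
  shows "L n \<in> borel_measurable leb"
    and "AE x in leb. L n x * h ((\<sigma> ^^ (k + n)) \<omega>) x = E n x"
    and "AE x in leb. \<bar>L n x\<bar> \<le> G"
proof -
  let ?h = "\<lambda>n. h ((\<sigma> ^^ n) \<omega>)" and ?P = "\<lambda>n. lsv_transfer (\<beta> ((\<sigma> ^^ n) \<omega>))"
  have iE0: "integrable leb (\<lambda>x. \<phi> x * ?h k x)"
  proof (rule Bochner_Integration.integrable_bound)
    show "integrable leb (\<lambda>x. G * ?h k x)" using int by simp
    show "(\<lambda>x. \<phi> x * ?h k x) \<in> borel_measurable leb"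
      by (rule borel_measurable_times[OF \<phi>(1) borel_measurable_integrable[OF int]])
    show "AE x in leb. norm (\<phi> x * ?h k x) \<le> norm (G * ?h k x)"
      using \<phi>(2) by eventually_elim (auto simp: abs_mult G intro: mult_right_mono)
  qed
  have iE: "integrable leb (E n)" for n
    unfolding E_def by (rule evolve_L1(1)[OF pos iE0])
  have ESuc: "E (Suc n) = ?P (k + n) (E n)" for n by (simp add: E_def evolve_Suc)
  have LSuc: "L (Suc n) = (\<lambda>x. ?P (k + n) (\<lambda>y. L n y * ?h (k + n) y) x / ?h (k + Suc n) x)" for n
  proof
    fix x
    have "(\<sigma> ^^ n) ((\<sigma> ^^ k) \<omega>) = (\<sigma> ^^ (k + n)) \<omega>" by (simp add: funpow_add add.commute[of k])
    then show "L (Suc n) x = ?P (k + n) (\<lambda>y. L n y * ?h (k + n) y) x / ?h (k + Suc n) x"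
      by (simp add: L_def normalised_transfer_def)
  qed
  have bound: "AE x in leb. \<bar>E n x\<bar> \<le> G * ?h (k + n) x" for n
  proof (induction n)
    case 0
    show ?case using \<phi>(2) nn[of k] by eventually_elim (auto simp: E_def abs_mult intro: mult_right_mono)
  next
    case (Suc n)
    have 1: "AE x in leb. ?P (k + n) (E n) x \<le> ?P (k + n) (\<lambda>x. G * ?h (k + n) x) x"
      using Suc int iE by (intro lsv_transfer_mono_AE pos) (auto elim: eventually_mono)
    have 2: "AE x in leb. ?P (k + n) (\<lambda>x. - G * ?h (k + n) x) x \<le> ?P (k + n) (E n) x"
      using Suc int iE by (intro lsv_transfer_mono_AE pos) (auto elim!: eventually_mono)
    have cm: "?P (k + n) (\<lambda>x. C * ?h (k + n) x) x = C * ?P (k + n) (?h (k + n)) x" for C x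
      using lsv_transfer_linear[of _ C "?h (k + n)" 0 "?h (k + n)"] by simp
    show ?case
      using 1 2 inv[of "k + n"] unfolding cm ESuc by eventually_elim (simp add: abs_le_iff)
  qed
  have main: "L n \<in> borel_measurable leb \<and>
      (AE x in leb. L n x * ?h (k + n) x = E n x) \<and> (AE x in leb. \<bar>L n x\<bar> \<le> G)"
  proof (induction n)
    case 0
    then show ?case using \<phi> by (simp add: L_def E_def)
  next
    case (Suc n)
    then have m: "L n \<in> borel_measurable leb"
      and eq: "AE x in leb. L n x * ?h (k + n) x = E n x" by auto
    have mL: "(\<lambda>x. L n x * ?h (k + n) x) \<in> borel_measurable leb"
      by (rule borel_measurable_times[OF m borel_measurable_integrable[OF int]])
    have iL: "integrable leb (\<lambda>x. L n x * ?h (k + n) x)"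
      using eq by (subst integrable_cong_AE[OF mL borel_measurable_integrable[OF iE]]) (auto intro: iE)
    have PE: "AE x in leb. ?P (k + n) (\<lambda>y. L n y * ?h (k + n) y) x = E (Suc n) x"
      unfolding ESuc by (rule lsv_transfer_cong_AE[OF pos iL iE eq])
    have "L (Suc n) \<in> borel_measurable leb"
      unfolding LSuc by (rule borel_measurable_divide[OF lsv_transfer_measurable[OF pos mL]
            borel_measurable_integrable[OF int]])
    moreover have "AE x in leb. L (Suc n) x * ?h (k + Suc n) x = E (Suc n) x"
      using PE bound[of "Suc n"] unfolding LSuc by eventually_elim auto
    moreover have "AE x in leb. \<bar>L (Suc n) x\<bar> \<le> G"
      using PE bound[of "Suc n"] nn[of "k + Suc n"] unfolding LSuc
    proof eventually_elim
      case (elim x)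
      then show ?case using G
        by (cases "?h (k + Suc n) x = 0") (auto simp: abs_divide pos_divide_le_eq)
    qed
    ultimately show ?case by blast
  qed
  then show "L n \<in> borel_measurable leb"
    "AE x in leb. L n x * h ((\<sigma> ^^ (k + n)) \<omega>) x = E n x"
    "AE x in leb. \<bar>L n x\<bar> \<le> G" by auto
qed

text \<open>Interpolation: \<open>\<bar>F\<bar>\<^sup>p \<le> R\<^sup>p\<^sup>-\<^sup>1 \<bar>F\<bar>\<close> when \<open>\<bar>F\<bar> \<le> R\<close>.\<close>

lemma Lp_norm_density_le:
  fixes h :: "real \<Rightarrow> real"
  assumes h: "integrable leb h" "AE x in leb. 0 \<le> h x"
    and F: "F \<in> borel_measurable leb" "AE x in leb. \<bar>F x\<bar> \<le> R"
    and p: "1 \<le> p" and Z: "(\<integral>x. \<bar>F x\<bar> * h x \<partial>leb) \<le> Z"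
  shows "in_Lp (density leb (\<lambda>x. ennreal (h x))) p F"
    and "Lp_norm (density leb (\<lambda>x. ennreal (h x))) p F \<le> (R powr (p - 1) * Z) powr (1 / p)"
proof -
  let ?M = "density leb (\<lambda>x. ennreal (h x))"
  note [measurable] = F(1) borel_measurable_integrable[OF h(1)]
  have R: "AE x in leb. 0 \<le> R \<and> \<bar>F x\<bar> powr p \<le> R powr (p - 1) * \<bar>F x\<bar>"
    using F(2)
  proof eventually_elim
    case (elim x)
    have "\<bar>F x\<bar> powr p = \<bar>F x\<bar> powr (p - 1) * \<bar>F x\<bar>"
    proof (cases "F x = 0")
      case False
      then show ?thesis using powr_add[of "\<bar>F x\<bar>" "p - 1" 1] by simp
    qed simp
    also have "\<dots> \<le> R powr (p - 1) * \<bar>F x\<bar>" using elim p by (intro mult_right_mono powr_mono2) auto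
    finally show ?case using elim by auto
  qed
  have i1: "integrable leb (\<lambda>x. \<bar>F x\<bar> * h x)"
  proof (rule Bochner_Integration.integrable_bound)
    show "integrable leb (\<lambda>x. R * h x)" using h by simp
    show "AE x in leb. norm (\<bar>F x\<bar> * h x) \<le> norm (R * h x)"
      using F(2) by eventually_elim (auto simp: abs_mult intro!: mult_right_mono)
  qed measurable
  have ip: "integrable leb (\<lambda>x. h x * \<bar>F x\<bar> powr p)"
  proof (rule Bochner_Integration.integrable_bound)
    show "integrable leb (\<lambda>x. R powr (p - 1) * (\<bar>F x\<bar> * h x))" using i1 by simp
    show "AE x in leb. norm (h x * \<bar>F x\<bar> powr p) \<le> norm (R powr (p - 1) * (\<bar>F x\<bar> * h x))"
      using R h(2)
    proof eventually_elim
      case (elim x)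
      then have "h x * \<bar>F x\<bar> powr p \<le> h x * (R powr (p - 1) * \<bar>F x\<bar>)" by (intro mult_left_mono) auto
      then show ?case using elim by (simp add: abs_mult mult_ac)
    qed
  qed measurable
  have "integrable ?M (\<lambda>x. \<bar>F x\<bar> powr p)"
    using ip h(2) by (subst integrable_density) auto
  then show "in_Lp ?M p F" unfolding in_Lp_def by simp
  have "(\<integral>x. \<bar>F x\<bar> powr p \<partial>?M) = (\<integral>x. h x * \<bar>F x\<bar> powr p \<partial>leb)"
    using h(2) by (subst integral_density) auto
  also have "\<dots> \<le> (\<integral>x. R powr (p - 1) * (\<bar>F x\<bar> * h x) \<partial>leb)"
  proof (rule integral_mono_AE)
    show "AE x in leb. h x * \<bar>F x\<bar> powr p \<le> R powr (p - 1) * (\<bar>F x\<bar> * h x)"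
      using R h(2)
    proof eventually_elim
      case (elim x)
      then have "h x * \<bar>F x\<bar> powr p \<le> h x * (R powr (p - 1) * \<bar>F x\<bar>)" by (intro mult_left_mono) auto
      then show ?case by (simp add: mult_ac)
    qed
  qed (use ip i1 in auto)
  also have "\<dots> \<le> R powr (p - 1) * Z" using Z by (simp add: mult_left_mono)
  finally have "(\<integral>x. \<bar>F x\<bar> powr p \<partial>?M) \<le> R powr (p - 1) * Z" .
  then show "Lp_norm ?M p F \<le> (R powr (p - 1) * Z) powr (1 / p)"
    unfolding Lp_norm_def using p by (intro powr_mono2) (auto intro!: integral_nonneg)
qed

section \<open>Densities as limits from the past\<close>

text \<open>
  The infimum in the Lipschitz norm need not be attained a priori; a constant within \<open>1\<close> of it is good enough,
  since the final bound contains \<open>1 + lip_norm g\<close>.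
\<close>

lemma lip_norm_witness:
  assumes "lipschitz_fun g"
  obtains B L where "L-lipschitz_on {0..1} g" "\<And>x. x \<in> {0..1} \<Longrightarrow> \<bar>g x\<bar> \<le> B" "B + L \<le> 1 + lip_norm g"
proof -
  let ?K = "{K. K-lipschitz_on {0..1} g}"
  from assms obtain K where K: "K-lipschitz_on {0..1} g" unfolding lipschitz_fun_def by blast
  have bdd: "bdd_below ?K" using lipschitz_on_nonneg by (intro bdd_belowI[of _ 0]) auto
  have "Inf ?K < Inf ?K + 1" by simp
  then obtain L where L: "L-lipschitz_on {0..1} g" "L < Inf ?K + 1"
    using cInf_lessD[of ?K "Inf ?K + 1"] K by blast
  have "compact ((\<lambda>x. \<bar>g x\<bar>) ` {0..1})"
    using lipschitz_on_continuous_on[OF K] by (intro compact_continuous_image continuous_intros) auto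
  then have "bdd_above ((\<lambda>x. \<bar>g x\<bar>) ` {0..1})" by (intro bounded_imp_bdd_above compact_imp_bounded)
  then have "\<bar>g x\<bar> \<le> (SUP x\<in>{0..1}. \<bar>g x\<bar>)" if "x \<in> {0..1}" for x
    using that by (intro cSUP_upper)
  with L show thesis by (intro that[of L "SUP x\<in>{0..1}. \<bar>g x\<bar>"]) (auto simp: lip_norm_def)
qed

lemma visits_sum_forward:
  "real (visits b g s (s + n)) = (\<Sum>k<n. of_bool (b (s + k) \<le> g))"
proof (induction n)
  case (Suc n)
  have "visits b g (s + n) (s + Suc n) = of_bool (b (s + n) \<le> g)"
    by (simp add: visits_split_first[of "s + n"])
  then show ?case using Suc visits_split[of s "s + n" "s + Suc n" b g] by simp
qed simp

lemma visits_sum_backward: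
  "n \<le> Suc I \<Longrightarrow> real (visits b g (Suc I - n) (Suc I)) = (\<Sum>k<n. of_bool (b (I - k) \<le> g))"
proof (induction n)
  case (Suc n)
  then have "Suc I - n = Suc (I - n)" by simp
  then show ?case using Suc by (simp add: visits_split_first[of "I - n"])
qed simp

lemma funpow_inv_into:
  assumes bij: "bij_betw f S S" and x: "x \<in> S"
  shows "(f ^^ k) x \<in> S" "(inv_into S f ^^ k) x \<in> S"
    and "k \<le> m \<Longrightarrow> (f ^^ k) ((inv_into S f ^^ m) x) = (inv_into S f ^^ (m - k)) x"
    and "k \<le> m \<Longrightarrow> (inv_into S f ^^ k) ((f ^^ m) x) = (f ^^ (m - k)) x"
proof -
  let ?i = "inv_into S f"
  have mem: "(f ^^ k) x \<in> S" "(?i ^^ k) x \<in> S" for k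
    using bij x bij_betw_inv_into[OF bij] by (induction k) (auto simp: bij_betw_apply)
  then show "(f ^^ k) x \<in> S" "(?i ^^ k) x \<in> S" by auto
  have fi: "f (?i y) = y" "?i (f y) = y" if "y \<in> S" for y
    using bij that by (auto simp: bij_betw_inv_into_right bij_betw_inv_into_left)
  show "k \<le> m \<Longrightarrow> (f ^^ k) ((?i ^^ m) x) = (?i ^^ (m - k)) x"
  proof (induction k)
    case (Suc k)
    then have "m - k = Suc (m - Suc k)" by simp
    then show ?case using Suc fi(1)[OF mem(2)] by simp
  qed simp
  show "k \<le> m \<Longrightarrow> (?i ^^ k) ((f ^^ m) x) = (f ^^ (m - k)) x"
  proof (induction k)
    case (Suc k)
    then have "m - k = Suc (m - Suc k)" by simp
    then show ?case using Suc fi(2)[OF mem(1)] by simp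
  qed simp
qed

lemma L1_limit_density:
  fixes h :: "real \<Rightarrow> real"
  assumes h: "integrable leb h"
    and H: "\<And>m. is_density (H m)" "\<And>m. (\<integral>x. H m x \<partial>leb) = 1"
    and lim: "(\<lambda>m::nat. \<integral>x. \<bar>H m x - h x\<bar> \<partial>leb) \<longlonglongrightarrow> 0"
  shows "AE x in leb. 0 \<le> h x" "(\<integral>x. h x \<partial>leb) = 1"
proof -
  note Hi = is_densityD(1)[OF H(1)]
  have "(\<integral>x. \<bar>max 0 (- h x) - 0\<bar> \<partial>leb) \<le> (\<integral>x. \<bar>H m x - h x\<bar> \<partial>leb)" for m
  proof (rule integral_mono)
    show "\<bar>max 0 (- h x) - 0\<bar> \<le> \<bar>H m x - h x\<bar>" if "x \<in> space leb" for x
      using is_densityD(3)[OF H(1)[of m], of x] that by auto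
  qed (use h Hi in auto)
  then have "(\<integral>x. \<bar>max 0 (- h x) - 0\<bar> \<partial>leb) \<le> 0"
    by (intro LIMSEQ_le_const[OF lim]) auto
  then have "AE x in leb. max 0 (- h x) = 0"
    using h by (intro AE_eqI_L1) auto
  then show "AE x in leb. 0 \<le> h x" by eventually_elim auto
  have "\<bar>1 - (\<integral>x. h x \<partial>leb)\<bar> \<le> (\<integral>x. \<bar>H m x - h x\<bar> \<partial>leb)" for m
    using integral_abs_bound[of leb "\<lambda>x. H m x - h x"] h Hi H(2) by simp
  then have "\<bar>1 - (\<integral>x. h x \<partial>leb)\<bar> \<le> 0"
    by (intro LIMSEQ_le_const[OF lim]) auto
  then show "(\<integral>x. h x \<partial>leb) = 1" by simp
qed

text \<open>The image at \<open>\<omega>\<close> of the constant \<open>1\<close> started \<open>m\<close> steps in the past.\<close>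

definition pullback :: "'a set \<Rightarrow> ('a \<Rightarrow> 'a) \<Rightarrow> ('a \<Rightarrow> real) \<Rightarrow> 'a \<Rightarrow> nat \<Rightarrow> real \<Rightarrow> real" where
  "pullback S \<sigma> \<beta> \<omega> m = evolve (\<lambda>k. \<beta> ((\<sigma> ^^ k) ((inv_into S \<sigma> ^^ m) \<omega>))) m 0 (\<lambda>_. 1)"

lemma pullback_tendsto:
  assumes bij: "bij_betw \<sigma> S S" and \<omega>: "\<omega> \<in> S" and pos: "\<And>\<omega>. \<omega> \<in> S \<Longrightarrow> 0 < \<beta> \<omega>"
    and h: "integrable leb h"
    and lim: "(\<lambda>n. \<integral>\<^sup>+ x. ennreal \<bar>cocycle \<sigma> (\<lambda>\<omega>. lsv_transfer (\<beta> \<omega>)) n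
                 ((inv_into S \<sigma> ^^ n) \<omega>) (\<lambda>_. 1) x - h x\<bar> \<partial>leb) \<longlonglongrightarrow> 0"
  shows "is_density (pullback S \<sigma> \<beta> \<omega> m)" "(\<integral>x. pullback S \<sigma> \<beta> \<omega> m x \<partial>leb) = 1"
    "(\<lambda>m. \<integral>x. \<bar>pullback S \<sigma> \<beta> \<omega> m x - h x\<bar> \<partial>leb) \<longlonglongrightarrow> 0"
proof -
  have b: "0 < \<beta> ((\<sigma> ^^ k) ((inv_into S \<sigma> ^^ m) \<omega>))" for k m
    using funpow_inv_into(1,2)[OF bij] \<omega> by (intro pos) auto
  have d: "is_density (pullback S \<sigma> \<beta> \<omega> m)" "(\<integral>x. pullback S \<sigma> \<beta> \<omega> m x \<partial>leb) = 1" for m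
    unfolding pullback_def by (rule evolve_one_mass; rule b)+
  then show "is_density (pullback S \<sigma> \<beta> \<omega> m)" "(\<integral>x. pullback S \<sigma> \<beta> \<omega> m x \<partial>leb) = 1" by auto
  have "(\<integral>\<^sup>+ x. ennreal \<bar>cocycle \<sigma> (\<lambda>\<omega>. lsv_transfer (\<beta> \<omega>)) n ((inv_into S \<sigma> ^^ n) \<omega>) (\<lambda>_. 1) x - h x\<bar> \<partial>leb)
      = ennreal (\<integral>x. \<bar>pullback S \<sigma> \<beta> \<omega> n x - h x\<bar> \<partial>leb)" for n
    using cocycle_lsv_transfer[of \<sigma> \<beta> n 0 "(inv_into S \<sigma> ^^ n) \<omega>"] h is_densityD(1)[OF d(1)]
    by (subst nn_integral_eq_integral) (auto simp: pullback_def)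
  with lim have "(\<lambda>n. ennreal (\<integral>x. \<bar>pullback S \<sigma> \<beta> \<omega> n x - h x\<bar> \<partial>leb)) \<longlonglongrightarrow> ennreal 0" by simp
  then show "(\<lambda>m. \<integral>x. \<bar>pullback S \<sigma> \<beta> \<omega> m x - h x\<bar> \<partial>leb) \<longlonglongrightarrow> 0"
    by (subst (asm) tendsto_ennreal_iff) (auto intro!: integral_nonneg)
qed

lemma pullback_Suc:
  assumes bij: "bij_betw \<sigma> S S" and \<omega>: "\<omega> \<in> S"
  shows "pullback S \<sigma> \<beta> (\<sigma> \<omega>) (Suc m) = lsv_transfer (\<beta> \<omega>) (pullback S \<sigma> \<beta> \<omega> m)"
proof -
  have "(inv_into S \<sigma> ^^ Suc m) (\<sigma> \<omega>) = (inv_into S \<sigma> ^^ m) \<omega>"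
    using bij \<omega> by (simp add: funpow_swap1 bij_betw_inv_into_left)
  moreover have "(\<sigma> ^^ m) ((inv_into S \<sigma> ^^ m) \<omega>) = \<omega>"
    using funpow_inv_into(3)[OF bij \<omega>, of m m] by simp
  ultimately show ?thesis unfolding pullback_def by (simp add: evolve_Suc del: funpow.simps)
qed

text \<open>
  Applying the transfer operator to the density pulled back from \<open>m\<close> steps before \<open>\<omega>\<close> gives the one pulled back from
  \<open>m + 1\<close> steps before \<open>\<sigma> \<omega>\<close>, and the operator is continuous in \<open>L\<^sup>1\<close>.
\<close>

lemma limit_density_invariant:
  fixes h h' :: "real \<Rightarrow> real"
  assumes bij: "bij_betw \<sigma> S S" and \<omega>: "\<omega> \<in> S" and pos: "0 < \<beta> \<omega>"
    and H: "\<And>m. is_density (pullback S \<sigma> \<beta> \<omega> m)"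
    and h: "integrable leb h" "integrable leb h'"
    and lim: "(\<lambda>m. \<integral>x. \<bar>pullback S \<sigma> \<beta> \<omega> m x - h x\<bar> \<partial>leb) \<longlonglongrightarrow> 0"
      "(\<lambda>m. \<integral>x. \<bar>pullback S \<sigma> \<beta> (\<sigma> \<omega>) m x - h' x\<bar> \<partial>leb) \<longlonglongrightarrow> 0"
  shows "AE x in leb. lsv_transfer (\<beta> \<omega>) h x = h' x"
proof (rule AE_eqI_L1)
  let ?P = "lsv_transfer (\<beta> \<omega>)" and ?H = "pullback S \<sigma> \<beta> \<omega>" and ?H' = "pullback S \<sigma> \<beta> (\<sigma> \<omega>)"
  show iP: "integrable leb (?P h)" by (rule lsv_transfer_L1(1)[OF pos h(1)])
  have "(\<integral>x. \<bar>?P h x - h' x\<bar> \<partial>leb)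
      \<le> (\<integral>x. \<bar>?H m x - h x\<bar> \<partial>leb) + (\<integral>x. \<bar>?H' (Suc m) x - h' x\<bar> \<partial>leb)" for m
  proof -
    have iH: "integrable leb (?H m)" using is_densityD(1)[OF H] .
    have iH': "integrable leb (?H' (Suc m))"
      unfolding pullback_Suc[OF bij \<omega>] by (rule lsv_transfer_L1(1)[OF pos iH])
    have "(\<integral>x. \<bar>?P h x - h' x\<bar> \<partial>leb)
        \<le> (\<integral>x. \<bar>?P (\<lambda>x. ?H m x - h x) x\<bar> + \<bar>?H' (Suc m) x - h' x\<bar> \<partial>leb)"
    proof (rule integral_mono)
      show "integrable leb (\<lambda>x. \<bar>?P (\<lambda>x. ?H m x - h x) x\<bar> + \<bar>?H' (Suc m) x - h' x\<bar>)"
        using lsv_transfer_L1(1)[OF pos, of "\<lambda>x. ?H m x - h x"] iH h iH' by auto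
      show "\<bar>?P h x - h' x\<bar> \<le> \<bar>?P (\<lambda>x. ?H m x - h x) x\<bar> + \<bar>?H' (Suc m) x - h' x\<bar>" for x
        unfolding lsv_transfer_diff pullback_Suc[OF bij \<omega>] by simp
    qed (use iP h in auto)
    also have "\<dots> = (\<integral>x. \<bar>?P (\<lambda>x. ?H m x - h x) x\<bar> \<partial>leb) + (\<integral>x. \<bar>?H' (Suc m) x - h' x\<bar> \<partial>leb)"
      using lsv_transfer_L1(1)[OF pos, of "\<lambda>x. ?H m x - h x"] iH h iH' by simp
    also have "\<dots> \<le> (\<integral>x. \<bar>?H m x - h x\<bar> \<partial>leb) + (\<integral>x. \<bar>?H' (Suc m) x - h' x\<bar> \<partial>leb)"
      using lsv_transfer_L1(2)[OF pos, of "\<lambda>x. ?H m x - h x"] iH h by simp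
    finally show ?thesis .
  qed
  moreover have "(\<lambda>m. (\<integral>x. \<bar>?H m x - h x\<bar> \<partial>leb) + (\<integral>x. \<bar>?H' (Suc m) x - h' x\<bar> \<partial>leb)) \<longlonglongrightarrow> 0 + 0"
    by (intro tendsto_add lim(1) LIMSEQ_Suc[OF lim(2)])
  ultimately show "(\<integral>x. \<bar>?P h x - h' x\<bar> \<partial>leb) \<le> 0"
    using LIMSEQ_le_const by fastforce
qed (rule h)

lemma evolve_invariant_densities:
  assumes c: "\<And>k. 0 < c k" and int: "\<And>k. integrable leb (h k)"
    and inv: "\<And>k. AE x in leb. lsv_transfer (c k) (h k) x = h (Suc k) x"
  shows "AE x in leb. evolve c n s (h s) x = h (s + n) x"
proof (induction n)
  case (Suc n)
  have "AE x in leb. lsv_transfer (c (s + n)) (evolve c n s (h s)) x = lsv_transfer (c (s + n)) (h (s + n)) x"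
    by (rule lsv_transfer_cong_AE[OF c evolve_L1(1)[of c, OF c int] int Suc])
  then show ?case using inv[of "s + n"] by eventually_elim (simp add: evolve_Suc)
qed simp

lemma last_deviation_bounds:
  assumes fin: "finite {n. 1 \<le> n \<and> visit_sum \<beta> \<gamma> \<delta> n \<omega> / real n
      \<notin> {visit_prob P \<beta> \<gamma> * (1 - \<epsilon>)..visit_prob P \<beta> \<gamma> * (1 + \<epsilon>)}}"
    and n: "last_deviation P \<beta> \<gamma> \<epsilon> \<delta> \<omega> < n"
  shows "visit_prob P \<beta> \<gamma> * (1 - \<epsilon>) * real n \<le> visit_sum \<beta> \<gamma> \<delta> n \<omega>"
    "visit_sum \<beta> \<gamma> \<delta> n \<omega> \<le> visit_prob P \<beta> \<gamma> * (1 + \<epsilon>) * real n"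
proof -
  let ?D = "{n. 1 \<le> n \<and> visit_sum \<beta> \<gamma> \<delta> n \<omega> / real n
      \<notin> {visit_prob P \<beta> \<gamma> * (1 - \<epsilon>)..visit_prob P \<beta> \<gamma> * (1 + \<epsilon>)}}"
  have "n \<notin> ?D"
  proof
    assume "n \<in> ?D"
    then have "n \<le> Max (?D \<union> {0})" using fin by (intro Max_ge) auto
    then show False using n unfolding last_deviation_def by simp
  qed
  then show "visit_prob P \<beta> \<gamma> * (1 - \<epsilon>) * real n \<le> visit_sum \<beta> \<gamma> \<delta> n \<omega>"
    "visit_sum \<beta> \<gamma> \<delta> n \<omega> \<le> visit_prob P \<beta> \<gamma> * (1 + \<epsilon>) * real n"
    using n by (auto simp: le_divide_eq divide_le_eq)
qed

section \<open>Decay along almost every orbit\<close>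

text \<open>
  For a single orbit: the constant \<open>X\<close> is the rate of memory loss of the sequences of parameters that start
  \<open>m\<close> steps before \<open>\<sigma>\<^sup>s \<omega>\<close>, uniformly in \<open>m\<close>. Both \<open>F\<close> and its mean are controlled through the
  identity \<open>L\<^sup>n \<phi> h = P\<^sup>n (\<phi> h)\<close>, which turns the \<open>L\<^sup>1\<close> norm of \<open>F\<close> with respect to the
  invariant measure into the quantity bounded by memory loss.
\<close>

lemma fibre_estimate:
  fixes \<sigma> :: "'a \<Rightarrow> 'a" and \<beta> :: "'a \<Rightarrow> real" and h :: "'a \<Rightarrow> real \<Rightarrow> real" and s d a :: nat
  assumes bij: "bij_betw \<sigma> S S" and \<omega>: "\<omega> \<in> S" and pos: "\<And>\<omega>. \<omega> \<in> S \<Longrightarrow> 0 < \<beta> \<omega>"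
    and int: "\<And>k. integrable leb (h ((\<sigma> ^^ k) \<omega>))"
    and lim: "\<And>k. (\<lambda>n. \<integral>\<^sup>+ x. ennreal \<bar>cocycle \<sigma> (\<lambda>\<omega>. lsv_transfer (\<beta> \<omega>)) n
                 ((inv_into S \<sigma> ^^ n) ((\<sigma> ^^ k) \<omega>)) (\<lambda>_. 1) x - h ((\<sigma> ^^ k) \<omega>) x\<bar> \<partial>leb) \<longlonglongrightarrow> 0"
    and g1: "L1-lipschitz_on {0..1} g1" "\<And>x. x \<in> {0..1} \<Longrightarrow> \<bar>g1 x\<bar> \<le> B1"
    and g2: "L2-lipschitz_on {0..1} g2" "\<And>x. x \<in> {0..1} \<Longrightarrow> \<bar>g2 x\<bar> \<le> B2"
    and le1: "\<And>m k. \<beta> ((\<sigma> ^^ k) ((inv_into S \<sigma> ^^ m) ((\<sigma> ^^ s) \<omega>))) \<le> 1"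
    and X: "\<And>m w U D. coupled (\<lambda>k. \<beta> ((\<sigma> ^^ k) ((inv_into S \<sigma> ^^ m) ((\<sigma> ^^ s) \<omega>)))) (m + d) D w U \<Longrightarrow>
      (\<integral>x. \<bar>evolve (\<lambda>k. \<beta> ((\<sigma> ^^ k) ((inv_into S \<sigma> ^^ m) ((\<sigma> ^^ s) \<omega>)))) a (m + d) w x\<bar> \<partial>leb) \<le> X * D"
    and p: "1 \<le> p"
  defines "L \<equiv> cocycle \<sigma> (normalised_transfer \<sigma> \<beta> h)"
  defines "F \<equiv> centred (fiber_measure h ((\<sigma> ^^ (s + d + a)) \<omega>))
    (L a ((\<sigma> ^^ (s + d)) \<omega>) (\<lambda>x. g2 x * L d ((\<sigma> ^^ s) \<omega>) g1 x))"
  shows "in_Lp (fiber_measure h ((\<sigma> ^^ (s + d + a)) \<omega>)) p F"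
    and "Lp_norm (fiber_measure h ((\<sigma> ^^ (s + d + a)) \<omega>)) p F
      \<le> ((2 * (B1 * B2)) powr (p - 1) * (9 * (B1 + L1) * (B2 + L2) * X)) powr (1 / p)"
proof -
  define c where "c = (\<lambda>k. \<beta> ((\<sigma> ^^ k) \<omega>))"
  define hh where "hh = (\<lambda>k. h ((\<sigma> ^^ k) \<omega>))"
  have orbit: "(\<sigma> ^^ k) \<omega> \<in> S" for k by (rule funpow_inv_into(1)[OF bij \<omega>])
  have c0: "0 < c k" for k unfolding c_def by (rule pos[OF orbit])
  have B: "0 \<le> B1" "0 \<le> B2" using g1(2)[of 0] g2(2)[of 0] by auto
  have m1: "g1 \<in> borel_measurable leb" "g2 \<in> borel_measurable leb"
    by (rule lipschitz_measurable[OF g1(1)], rule lipschitz_measurable[OF g2(1)])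
  have pb: "is_density (pullback S \<sigma> \<beta> ((\<sigma> ^^ k) \<omega>) m)"
      "(\<integral>x. pullback S \<sigma> \<beta> ((\<sigma> ^^ k) \<omega>) m x \<partial>leb) = 1"
      "(\<lambda>m. \<integral>x. \<bar>pullback S \<sigma> \<beta> ((\<sigma> ^^ k) \<omega>) m x - h ((\<sigma> ^^ k) \<omega>) x\<bar> \<partial>leb) \<longlonglongrightarrow> 0" for k m
    by (rule pullback_tendsto; (rule bij orbit pos int lim | assumption)+)+
  have nn: "AE x in leb. 0 \<le> hh k x" and one: "(\<integral>x. hh k x \<partial>leb) = 1" for k
    unfolding hh_def using L1_limit_density[OF int pb] by auto
  have inv: "AE x in leb. lsv_transfer (c k) (hh k) x = hh (Suc k) x" for k
    using limit_density_invariant[OF bij orbit pos[OF orbit] pb(1) int int[of "Suc k"] pb(3), of k] pb(3)[of "Suc k"]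
    unfolding c_def hh_def by simp
  have ih: "integrable leb (hh k)" for k unfolding hh_def by (rule int)
  define \<Phi> where "\<Phi> = (\<lambda>f x. g2 x * evolve c d s (\<lambda>x. g1 x * f x) x)"
  define E where "E = evolve c a (s + d)"
  define H where "H = pullback S \<sigma> \<beta> ((\<sigma> ^^ s) \<omega>)"
  define Z where "Z = 9 * (B1 + L1) * (B2 + L2) * X"
  have bound: "(\<integral>x. \<bar>E (\<Phi> (H m)) x - (\<integral>x. E (\<Phi> (H m)) x \<partial>leb) * evolve c (d + a) s (H m) x\<bar> \<partial>leb) \<le> Z" for m
  proof -
    define \<omega>' where "\<omega>' = (inv_into S \<sigma> ^^ m) ((\<sigma> ^^ s) \<omega>)"
    define b where "b = (\<lambda>k. \<beta> ((\<sigma> ^^ k) \<omega>'))"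
    have "\<omega>' \<in> S" unfolding \<omega>'_def by (rule funpow_inv_into(2)[OF bij orbit])
    then have b0: "0 < b k" for k unfolding b_def by (intro pos funpow_inv_into(1)[OF bij])
    have b1: "0 < b k \<and> b k \<le> 1" for k using b0 le1 unfolding b_def \<omega>'_def by auto
    have start: "(\<sigma> ^^ m) \<omega>' = (\<sigma> ^^ s) \<omega>"
      unfolding \<omega>'_def using funpow_inv_into(3)[OF bij orbit, of m m] by simp
    have bc: "b (m + k) = c (s + k)" for k
    proof -
      have "(\<sigma> ^^ (m + k)) \<omega>' = (\<sigma> ^^ k) ((\<sigma> ^^ m) \<omega>')" by (simp add: funpow_add add.commute[of m])
      also have "\<dots> = (\<sigma> ^^ (s + k)) \<omega>" unfolding start by (simp add: funpow_add add.commute[of s])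
      finally show ?thesis by (simp add: b_def c_def)
    qed
    have e1: "evolve b d m = evolve c d s" by (rule evolve_cong_shift) (rule bc)
    have e2: "evolve b a (m + d) = E"
      unfolding E_def by (rule evolve_cong_shift) (use bc in \<open>simp add: add.assoc\<close>)
    have H: "evolve b m 0 (\<lambda>_. 1) = H m" by (simp add: H_def pullback_def b_def \<omega>'_def)
    have e3: "evolve b (m + d + a) 0 (\<lambda>_. 1) = evolve c (d + a) s (H m)"
    proof -
      have "evolve b (m + (d + a)) 0 (\<lambda>_. 1) = evolve b (d + a) m (H m)" unfolding evolve_add H by simp
      also have "evolve b (d + a) m = evolve c (d + a) s" by (rule evolve_cong_shift) (rule bc)
      finally show ?thesis by (simp add: add.assoc)
    qed
    have \<Phi>': "(\<lambda>x. g2 x * evolve b d m (\<lambda>x. g1 x * evolve b m 0 (\<lambda>_. 1) x) x) = \<Phi> (H m)"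
      unfolding H e1 \<Phi>_def ..
    have Xb: "(\<integral>x. \<bar>evolve b a (m + d) w x\<bar> \<partial>leb) \<le> X * D" if "coupled b (m + d) D w U" for w U D
      using X[of m D w U] that unfolding b_def \<omega>'_def by blast
    have "(\<integral>x. E (\<Phi> (H m)) x \<partial>leb) = (\<integral>x. \<Phi> (H m) x \<partial>leb)"
      unfolding \<Phi>'[symmetric] e2[symmetric]
      by (rule observable_memory_loss(3)[of b L1 g1 B1 L2 g2 B2 m d a X]) (use b1 g1 g2 Xb in auto)
    moreover have "(\<integral>x. \<bar>E (\<Phi> (H m)) x - (\<integral>x. \<Phi> (H m) x \<partial>leb) * evolve c (d + a) s (H m) x\<bar> \<partial>leb)
        \<le> 9 * (B1 + L1) * (B2 + L2) * X"
      unfolding \<Phi>'[symmetric] e2[symmetric] e3[symmetric]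
      by (rule observable_memory_loss(4)[of b L1 g1 B1 L2 g2 B2 m d a X]) (use b1 g1 g2 Xb in auto)
    ultimately show ?thesis unfolding Z_def by simp
  qed
  have Hs: "is_density (H m)" "(\<integral>x. H m x \<partial>leb) = 1"
      "(\<lambda>m. \<integral>x. \<bar>H m x - hh s x\<bar> \<partial>leb) \<longlonglongrightarrow> 0" for m
    unfolding H_def hh_def by (rule pb)+
  note limit = memory_loss_limit[where c = c and h = "hh s" and H = H and s = s and d = d and a = a
      and ?g1.0 = g1 and ?g2.0 = g2 and ?B1.0 = B1 and ?B2.0 = B2 and Z = Z]
  have ml: "integrable leb (\<Phi> (hh s))"
    "(\<integral>x. \<bar>E (\<Phi> (hh s)) x - (\<integral>x. E (\<Phi> (hh s)) x \<partial>leb) * evolve c (d + a) s (hh s) x\<bar> \<partial>leb) \<le> Z"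
    unfolding E_def \<Phi>_def
    by (rule limit; (rule c0 ih Hs m1 g1(2) g2(2) bound[unfolded E_def \<Phi>_def] | assumption)+)+
  define M where "M = (\<integral>x. E (\<Phi> (hh s)) x \<partial>leb)"
  define J where "J = s + d + a"
  have evJ: "AE x in leb. evolve c (d + a) s (hh s) x = hh J x"
    using evolve_invariant_densities[of c hh, OF c0 ih inv, of "d + a" s] by (simp add: J_def add.assoc)

  note nt = normalised_transfer_cocycle[of \<beta> \<sigma> \<omega> h, OF c0[unfolded c_def] int nn[unfolded hh_def] inv[unfolded hh_def c_def]]
  have g1AE: "AE x in leb. \<bar>g1 x\<bar> \<le> B1" using g1(2) by (intro AE_I2) simp
  define \<psi> where "\<psi> = L d ((\<sigma> ^^ s) \<omega>) g1"
  have \<psi>: "\<psi> \<in> borel_measurable leb"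
      "AE x in leb. \<psi> x * hh (s + d) x = evolve c d s (\<lambda>x. g1 x * hh s x) x"
      "AE x in leb. \<bar>\<psi> x\<bar> \<le> B1"
    unfolding \<psi>_def hh_def c_def L_def by (rule nt[OF m1(1) g1AE B(1)])+
  define \<phi> where "\<phi> = (\<lambda>x. g2 x * \<psi> x)"
  have \<phi>: "\<phi> \<in> borel_measurable leb" "AE x in leb. \<bar>\<phi> x\<bar> \<le> B1 * B2"
  proof -
    show "\<phi> \<in> borel_measurable leb" unfolding \<phi>_def by (rule borel_measurable_times[OF m1(2) \<psi>(1)])
    show "AE x in leb. \<bar>\<phi> x\<bar> \<le> B1 * B2"
      using \<psi>(3) AE_unit_lebesgue_interior
    proof eventually_elim
      case (elim x)
      then have "\<bar>\<psi> x\<bar> * \<bar>g2 x\<bar> \<le> B1 * B2" using g2(2)[of x] B by (intro mult_mono) auto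
      then show ?case by (simp add: \<phi>_def abs_mult mult.commute)
    qed
  qed
  define u where "u = L a ((\<sigma> ^^ (s + d)) \<omega>) \<phi>"
  have BB: "0 \<le> B1 * B2" using B by simp
  have u: "u \<in> borel_measurable leb"
      "AE x in leb. u x * hh J x = E (\<lambda>x. \<phi> x * hh (s + d) x) x"
      "AE x in leb. \<bar>u x\<bar> \<le> B1 * B2"
    unfolding u_def E_def J_def hh_def c_def L_def by (rule nt[OF \<phi> BB])+
  have \<phi>\<Phi>: "AE x in leb. \<phi> x * hh (s + d) x = \<Phi> (hh s) x"
    using \<psi>(2) by eventually_elim (simp add: \<phi>_def \<Phi>_def)
  have i\<phi>: "integrable leb (\<lambda>x. \<phi> x * hh (s + d) x)"
    using \<phi>\<Phi> by (subst integrable_cong_AE[OF borel_measurable_times[OF \<phi>(1) borel_measurable_integrable[OF ih]]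
        borel_measurable_integrable[OF ml(1)]]) (auto intro: ml(1))
  have "AE x in leb. E (\<lambda>x. \<phi> x * hh (s + d) x) x = E (\<Phi> (hh s)) x"
    unfolding E_def by (rule evolve_cong_AE[of c, OF c0 i\<phi> ml(1) \<phi>\<Phi>])
  with u(2) have uE: "AE x in leb. u x * hh J x = E (\<Phi> (hh s)) x" by eventually_elim simp
  have iE: "integrable leb (E (\<Phi> (hh s)))" unfolding E_def by (rule evolve_L1(1)[of c, OF c0 ml(1)])
  have mu: "(\<lambda>x. u x * hh J x) \<in> borel_measurable leb"
    by (rule borel_measurable_times[OF u(1) borel_measurable_integrable[OF ih]])
  have iu: "integrable leb (\<lambda>x. u x * hh J x)"
    using uE by (subst integrable_cong_AE[OF mu borel_measurable_integrable[OF iE]]) (auto intro: iE)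
  have mean: "(\<integral>x. u x \<partial>fiber_measure h ((\<sigma> ^^ J) \<omega>)) = M"
  proof -
    have "(\<integral>x. u x \<partial>fiber_measure h ((\<sigma> ^^ J) \<omega>)) = (\<integral>x. hh J x * u x \<partial>leb)"
      unfolding fiber_measure_def hh_def
      by (subst integral_density) (auto intro: u(1) borel_measurable_integrable int nn[unfolded hh_def])
    also have "\<dots> = M"
      unfolding M_def using uE mu iE by (intro integral_cong_AE) (auto simp: mult.commute intro: borel_measurable_integrable)
    finally show ?thesis .
  qed
  have F: "F = (\<lambda>x. u x - M)"
    unfolding F_def centred_def using mean unfolding u_def \<phi>_def \<psi>_def J_def by simp
  have M: "\<bar>M\<bar> \<le> B1 * B2"
  proof -
    have "\<bar>M\<bar> \<le> (\<integral>x. \<bar>E (\<Phi> (hh s)) x\<bar> \<partial>leb)"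
      unfolding M_def by (rule integral_abs_bound)
    also have "\<dots> \<le> (\<integral>x. (B1 * B2) * hh J x \<partial>leb)"
    proof (rule integral_mono_AE)
      show "AE x in leb. \<bar>E (\<Phi> (hh s)) x\<bar> \<le> B1 * B2 * hh J x"
        using uE u(3) nn[of J]
      proof eventually_elim
        case (elim x)
        have "\<bar>u x\<bar> * hh J x \<le> B1 * B2 * hh J x" using elim by (intro mult_right_mono)
        then show ?case using elim by (simp add: abs_mult flip: elim(1))
      qed
    qed (use iE ih in auto)
    finally show ?thesis using one by simp
  qed
  have FR: "AE x in leb. \<bar>F x\<bar> \<le> 2 * (B1 * B2)"
    using u(3) by eventually_elim (use M in \<open>simp add: F\<close>)
  have FZ: "(\<integral>x. \<bar>F x\<bar> * hh J x \<partial>leb) \<le> Z"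
  proof -
    have "(\<integral>x. \<bar>F x\<bar> * hh J x \<partial>leb)
        = (\<integral>x. \<bar>E (\<Phi> (hh s)) x - M * evolve c (d + a) s (hh s) x\<bar> \<partial>leb)"
    proof (rule integral_cong_AE)
      show "AE x in leb. \<bar>F x\<bar> * hh J x = \<bar>E (\<Phi> (hh s)) x - M * evolve c (d + a) s (hh s) x\<bar>"
        using uE evJ nn[of J]
      proof eventually_elim
        case (elim x)
        have "\<bar>F x\<bar> * hh J x = \<bar>(u x - M) * hh J x\<bar>" using elim by (simp add: F abs_mult)
        then show ?case using elim by (simp add: left_diff_distrib)
      qed
      have "F \<in> borel_measurable leb" unfolding F using u(1) by simp
      then show "(\<lambda>x. \<bar>F x\<bar> * hh J x) \<in> borel_measurable leb"
        by (intro borel_measurable_times borel_measurable_abs borel_measurable_integrable[OF ih])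
      have "integrable leb (evolve c (d + a) s (hh s))" by (rule evolve_L1(1)[of c, OF c0 ih])
      then show "(\<lambda>x. \<bar>E (\<Phi> (hh s)) x - M * evolve c (d + a) s (hh s) x\<bar>) \<in> borel_measurable leb"
        using iE by (intro borel_measurable_integrable) auto
    qed
    also have "\<dots> \<le> Z" using ml(2) unfolding M_def .
    finally show ?thesis .
  qed
  have Fm: "F \<in> borel_measurable leb" unfolding F using u(1) by simp
  show "in_Lp (fiber_measure h ((\<sigma> ^^ (s + d + a)) \<omega>)) p F"
    "Lp_norm (fiber_measure h ((\<sigma> ^^ (s + d + a)) \<omega>)) p F
      \<le> ((2 * (B1 * B2)) powr (p - 1) * (9 * (B1 + L1) * (B2 + L2) * X)) powr (1 / p)"
    using Lp_norm_density_le[OF ih[of J] nn[of J] Fm FR p FZ]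
    unfolding fiber_measure_def hh_def J_def Z_def by auto
qed

text \<open>
  Here \<open>A\<close> is the product of the two Lipschitz norms, up to constants, and \<open>Y\<close> the rate. The power \<open>p - 1\<close>
  of the supremum bound and the first power from the \<open>L\<^sup>1\<close> estimate combine to \<open>A\<^sup>p\<close>, so the result is
  linear in \<open>A\<close>.
\<close>

lemma Lp_constant:
  fixes p C Y A B :: real
  assumes p: "1 \<le> p" and C: "0 < C" and Y: "0 \<le> Y" and B: "0 \<le> B" "B \<le> A"
  shows "((2 * B) powr (p - 1) * (9 * A * (C * Y))) powr (1 / p) \<le> 2 * (9 * C) powr (1 / p) * A * Y powr (1 / p)"
proof -
  have A: "0 \<le> A" using B by simp
  have "(2 * B) powr (p - 1) * (9 * A * (C * Y)) \<le> (2 * A) powr (p - 1) * (9 * (2 * A) * (C * Y))"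
    using assms A by (intro mult_mono powr_mono2 mult_nonneg_nonneg) auto
  also have "\<dots> = ((2 * A) powr (p - 1) * (2 * A)) * (9 * C * Y)" by simp
  also have "(2 * A) powr (p - 1) * (2 * A) = (2 * A) powr p"
    using A powr_add[of "2 * A" "p - 1" 1] by (cases "A = 0") auto
  finally have "((2 * B) powr (p - 1) * (9 * A * (C * Y))) powr (1 / p) \<le> ((2 * A) powr p * (9 * C * Y)) powr (1 / p)"
    using assms A by (intro powr_mono2) auto
  also have "\<dots> = ((2 * A) powr p) powr (1 / p) * ((9 * C) powr (1 / p) * Y powr (1 / p))"
    using C Y A by (simp add: powr_mult)
  also have "((2 * A) powr p) powr (1 / p) = 2 * A" using A p by (simp add: powr_powr)
  finally show ?thesis by (simp add: mult_ac)
qed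

theorem corollary25:
  fixes P :: "'a measure" and \<sigma> :: "'a \<Rightarrow> 'a" and \<beta> :: "'a \<Rightarrow> real" and \<gamma> :: real
    and h :: "'a \<Rightarrow> real \<Rightarrow> real"
  assumes "prob_space P"
    and "ergodic_automorphism P \<sigma>"
    and "\<beta> \<in> borel_measurable P"
    and "\<And>\<omega>. \<omega> \<in> space P \<Longrightarrow> 0 < \<beta> \<omega> \<and> \<beta> \<omega> < 1"
    and "esssup P (\<lambda>\<omega>. ereal (\<beta> \<omega>)) < 1"
    and "0 < \<gamma>" and "\<gamma> < 1"
    and "visit_prob P \<beta> \<gamma> > 0"
    and "random_acim_density P \<sigma> \<beta> h"
  shows "\<exists>\<epsilon>\<^sub>0::real. 0 < \<epsilon>\<^sub>0 \<and> \<epsilon>\<^sub>0 < 1/2 \<and>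
    (let \<mu> = fiber_measure h; L = cocycle \<sigma> (normalised_transfer \<sigma> \<beta> h) in
    \<forall>p::real. 1 \<le> p \<longrightarrow> (\<exists>C::real. 0 < C \<and>
      (\<forall>(g\<^sub>1::real \<Rightarrow> real) (g\<^sub>2::real \<Rightarrow> real) (\<epsilon>::real) (s::nat) (i::nat) (j::nat).
        lipschitz_fun g\<^sub>1 \<and> lipschitz_fun g\<^sub>2 \<and> 0 < \<epsilon> \<and> \<epsilon> \<le> \<epsilon>\<^sub>0 \<and> s \<le> i \<and> i < j \<longrightarrow>
        (AE \<omega> in P.
          let F = centred (\<mu> ((\<sigma> ^^ j) \<omega>))
                (L (j - i) ((\<sigma> ^^ i) \<omega>) (\<lambda>x. g\<^sub>2 x * L (i - s) ((\<sigma> ^^ s) \<omega>) g\<^sub>1 x))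
          in in_Lp (\<mu> ((\<sigma> ^^ j) \<omega>)) p F \<and>
             Lp_norm (\<mu> ((\<sigma> ^^ j) \<omega>)) p F
             \<le> C * (1 + lip_norm g\<^sub>1) * (1 + lip_norm g\<^sub>2)
                 * (1 + real (deviation_time P \<sigma> \<beta> \<gamma> \<epsilon> ((\<sigma> ^^ i) \<omega>))) powr (1 / p * max 1 (1 / \<gamma> - 1))
                 * real (j - i) powr (- (1 / p) * (1 / \<gamma> - 1))))))"
proof -
  let ?inv = "inv_into (space P) \<sigma>" and ?S = "1 / \<gamma> - 1"
  let ?F = "\<lambda>g1 g2 s i j \<omega>. centred (fiber_measure h ((\<sigma> ^^ j) \<omega>))
    (cocycle \<sigma> (normalised_transfer \<sigma> \<beta> h) (j - i) ((\<sigma> ^^ i) \<omega>)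
      (\<lambda>x. g2 x * cocycle \<sigma> (normalised_transfer \<sigma> \<beta> h) (i - s) ((\<sigma> ^^ s) \<omega>) g1 x))"
  interpret prob_space P by fact
  interpret fw: ergodic_system P \<sigma> by (rule ergodic_automorphism_systems[OF assms(1,2)])
  interpret bw: ergodic_system P ?inv by (rule ergodic_automorphism_systems[OF assms(1,2)])
  have bij: "bij_betw \<sigma> (space P) (space P)" using assms(2) by (simp add: ergodic_automorphism_def)
  have pos: "\<And>\<omega>. \<omega> \<in> space P \<Longrightarrow> 0 < \<beta> \<omega>" using assms(4) by blast
  \<comment> \<open>The maximum with \<open>1/2\<close> only makes the bound positive.\<close>
  obtain \<alpha> :: real where \<alpha>: "0 < \<alpha>" "\<alpha> < 1" and \<alpha>\<beta>: "AE \<omega> in P. \<beta> \<omega> \<le> \<alpha>"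
  proof -
    obtain r where r: "esssup P (\<lambda>\<omega>. ereal (\<beta> \<omega>)) < ereal r" "ereal r < 1"
      using ereal_dense2[OF assms(5)] by blast
    have "AE \<omega> in P. ereal (\<beta> \<omega>) \<le> esssup P (\<lambda>\<omega>. ereal (\<beta> \<omega>))" by (rule esssup_AE)
    then have "AE \<omega> in P. \<beta> \<omega> \<le> max r (1/2)"
    proof eventually_elim
      case (elim \<omega>)
      then have "ereal (\<beta> \<omega>) < ereal r" using r(1) by (rule order_le_less_trans)
      then show ?case by simp
    qed
    moreover have "max r (1/2) < 1" using r(2) by simp
    ultimately show thesis by (intro that[of "max r (1/2)"]) auto
  qed
  obtain \<epsilon>0 C where \<epsilon>0: "0 < \<epsilon>0" "\<epsilon>0 < 1/2" and C: "0 < C"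
    and loss: "\<And>b I N \<epsilon> a w U D. (\<And>k. 0 < b k \<and> b k \<le> \<alpha>) \<Longrightarrow> 0 < \<epsilon> \<Longrightarrow> \<epsilon> \<le> \<epsilon>0 \<Longrightarrow>
      (\<And>n. N < n \<Longrightarrow> visit_prob P \<beta> \<gamma> * (1 - \<epsilon>) * real n \<le> real (visits b \<gamma> I (I + n))) \<Longrightarrow>
      (\<And>n. N < n \<Longrightarrow> real (visits b \<gamma> I (I + n)) \<le> visit_prob P \<beta> \<gamma> * (1 + \<epsilon>) * real n) \<Longrightarrow>
      (\<And>n. N < n \<Longrightarrow> n \<le> Suc I \<Longrightarrow> visit_prob P \<beta> \<gamma> * (1 - \<epsilon>) * real n \<le> real (visits b \<gamma> (Suc I - n) (Suc I))) \<Longrightarrow>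
      coupled b I D w U \<Longrightarrow> 1 \<le> a \<Longrightarrow>
      (\<integral>x. \<bar>evolve b a I w x\<bar> \<partial>leb) \<le> C * (1 + real N) powr ?S * real a powr (- ?S) * D"
    by (rule memory_loss_deviation[OF assms(6,7) \<alpha> assms(8)]) blast
  show ?thesis
    unfolding Let_def
  proof (rule exI[of _ \<epsilon>0], intro conjI allI impI \<epsilon>0)
    fix p :: real assume p: "1 \<le> p"
    show "\<exists>C::real. 0 < C \<and>
      (\<forall>(g\<^sub>1::real \<Rightarrow> real) (g\<^sub>2::real \<Rightarrow> real) (\<epsilon>::real) (s::nat) (i::nat) (j::nat).
        lipschitz_fun g\<^sub>1 \<and> lipschitz_fun g\<^sub>2 \<and> 0 < \<epsilon> \<and> \<epsilon> \<le> \<epsilon>0 \<and> s \<le> i \<and> i < j \<longrightarrow>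
        (AE \<omega> in P. in_Lp (fiber_measure h ((\<sigma> ^^ j) \<omega>)) p (?F g\<^sub>1 g\<^sub>2 s i j \<omega>) \<and>
             Lp_norm (fiber_measure h ((\<sigma> ^^ j) \<omega>)) p (?F g\<^sub>1 g\<^sub>2 s i j \<omega>)
             \<le> C * (1 + lip_norm g\<^sub>1) * (1 + lip_norm g\<^sub>2)
                 * (1 + real (deviation_time P \<sigma> \<beta> \<gamma> \<epsilon> ((\<sigma> ^^ i) \<omega>))) powr (1 / p * max 1 ?S)
                 * real (j - i) powr (- (1 / p) * ?S)))"
    proof (rule exI[of _ "2 * (9 * C) powr (1 / p)"], intro conjI allI impI)
      show "0 < 2 * (9 * C) powr (1 / p)" using C by simp
      fix g1 g2 :: "real \<Rightarrow> real" and \<epsilon> :: real and s i j :: nat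
      assume "lipschitz_fun g1 \<and> lipschitz_fun g2 \<and> 0 < \<epsilon> \<and> \<epsilon> \<le> \<epsilon>0 \<and> s \<le> i \<and> i < j"
      then have lip: "lipschitz_fun g1" "lipschitz_fun g2" and \<epsilon>: "0 < \<epsilon>" "\<epsilon> \<le> \<epsilon>0" and sij: "s \<le> i" "i < j" by auto
      obtain B1 L1 where g1: "L1-lipschitz_on {0..1} g1" "\<And>x. x \<in> {0..1} \<Longrightarrow> \<bar>g1 x\<bar> \<le> B1" "B1 + L1 \<le> 1 + lip_norm g1"
        using lip_norm_witness[OF lip(1)] by blast
      obtain B2 L2 where g2: "L2-lipschitz_on {0..1} g2" "\<And>x. x \<in> {0..1} \<Longrightarrow> \<bar>g2 x\<bar> \<le> B2" "B2 + L2 \<le> 1 + lip_norm g2"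
        using lip_norm_witness[OF lip(2)] by blast
      have B: "0 \<le> B1" "0 \<le> B2" using g1(2)[of 0] g2(2)[of 0] by auto
      have L: "0 \<le> L1" "0 \<le> L2" using lipschitz_on_nonneg[OF g1(1)] lipschitz_on_nonneg[OF g2(1)] by auto
      define d a where "d = i - s" and "a = j - i"
      have ij: "i = s + d" "j = s + d + a" "1 \<le> a" using sij by (auto simp: d_def a_def)
      have A1: "AE \<omega> in P. \<forall>k. integrable leb (h ((\<sigma> ^^ k) \<omega>)) \<and>
        (\<lambda>n. \<integral>\<^sup>+ x. ennreal \<bar>cocycle \<sigma> (\<lambda>\<omega>. lsv_transfer (\<beta> \<omega>)) n
                 ((?inv ^^ n) ((\<sigma> ^^ k) \<omega>)) (\<lambda>_. 1) x - h ((\<sigma> ^^ k) \<omega>) x\<bar> \<partial>leb) \<longlonglongrightarrow> 0"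
        unfolding AE_all_countable
      proof
        fix k
        have "AE \<omega> in P. integrable leb (h \<omega>) \<and>
          (\<lambda>n. \<integral>\<^sup>+ x. ennreal \<bar>cocycle \<sigma> (\<lambda>\<omega>. lsv_transfer (\<beta> \<omega>)) n
                 ((?inv ^^ n) \<omega>) (\<lambda>_. 1) x - h \<omega> x\<bar> \<partial>leb) \<longlonglongrightarrow> 0"
          using assms(9) unfolding random_acim_density_def by eventually_elim blast
        from fw.AE_compose_funpow[OF this, of k] show "AE \<omega> in P. integrable leb (h ((\<sigma> ^^ k) \<omega>)) \<and>
          (\<lambda>n. \<integral>\<^sup>+ x. ennreal \<bar>cocycle \<sigma> (\<lambda>\<omega>. lsv_transfer (\<beta> \<omega>)) n
                 ((?inv ^^ n) ((\<sigma> ^^ k) \<omega>)) (\<lambda>_. 1) x - h ((\<sigma> ^^ k) \<omega>) x\<bar> \<partial>leb) \<longlonglongrightarrow> 0" .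
      qed
      have A2: "AE \<omega> in P. \<forall>m k. \<beta> ((\<sigma> ^^ k) ((?inv ^^ m) ((\<sigma> ^^ s) \<omega>))) \<le> \<alpha>"
        unfolding AE_all_countable
        by (intro allI fw.AE_compose_funpow bw.AE_compose_funpow \<alpha>\<beta>)
      have D: "AE \<omega> in P. finite {n. 1 \<le> n \<and> visit_sum \<beta> \<gamma> \<delta> n \<omega> / real n
          \<notin> {visit_prob P \<beta> \<gamma> * (1 - \<epsilon>)..visit_prob P \<beta> \<gamma> * (1 + \<epsilon>)}}" if "\<delta> \<in> {\<sigma>, ?inv}" for \<delta>
        using that fw.AE_finite_deviations[OF assms(3) _ assms(8) \<epsilon>(1)]
          bw.AE_finite_deviations[OF assms(3) _ assms(8) \<epsilon>(1)] pos by blast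
      note dev = fw.AE_compose_funpow[OF D[OF insertI1], of i]
        fw.AE_compose_funpow[OF D[OF insertI2[OF singletonI]], of i]
      show "AE \<omega> in P. in_Lp (fiber_measure h ((\<sigma> ^^ j) \<omega>)) p (?F g1 g2 s i j \<omega>) \<and>
             Lp_norm (fiber_measure h ((\<sigma> ^^ j) \<omega>)) p (?F g1 g2 s i j \<omega>)
             \<le> 2 * (9 * C) powr (1 / p) * (1 + lip_norm g1) * (1 + lip_norm g2)
                 * (1 + real (deviation_time P \<sigma> \<beta> \<gamma> \<epsilon> ((\<sigma> ^^ i) \<omega>))) powr (1 / p * max 1 ?S)
                 * real (j - i) powr (- (1 / p) * ?S)"
        using A1 A2 dev AE_space
      proof eventually_elim
        case (elim \<omega>)
        have \<omega>: "\<omega> \<in> space P" by fact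
        have orbit: "(\<sigma> ^^ k) \<omega> \<in> space P" for k by (rule funpow_inv_into(1)[OF bij \<omega>])
        define N where "N = deviation_time P \<sigma> \<beta> \<gamma> \<epsilon> ((\<sigma> ^^ i) \<omega>)"
        define Y where "Y = (1 + real N) powr ?S * real a powr (- ?S)"
        \<comment> \<open>The sequence starts \<open>m\<close> steps before \<open>\<sigma>\<^sup>s \<omega>\<close>, so \<open>m + d\<close> is the time of \<open>\<sigma>\<^sup>i \<omega>\<close>, the base
          point of the deviation time.\<close>
        have X: "(\<integral>x. \<bar>evolve (\<lambda>k. \<beta> ((\<sigma> ^^ k) ((?inv ^^ m) ((\<sigma> ^^ s) \<omega>)))) a (m + d) w x\<bar> \<partial>leb) \<le> C * Y * D"
          if cp: "coupled (\<lambda>k. \<beta> ((\<sigma> ^^ k) ((?inv ^^ m) ((\<sigma> ^^ s) \<omega>)))) (m + d) D w U" for m w U D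
        proof -
          define \<omega>' where "\<omega>' = (?inv ^^ m) ((\<sigma> ^^ s) \<omega>)"
          define b where "b = (\<lambda>k. \<beta> ((\<sigma> ^^ k) \<omega>'))"
          have \<omega>': "\<omega>' \<in> space P" unfolding \<omega>'_def by (rule funpow_inv_into(2)[OF bij orbit])
          have b0: "0 < b k" for k unfolding b_def by (intro pos funpow_inv_into(1)[OF bij] \<omega>')
          have b: "0 < b k \<and> b k \<le> \<alpha>" for k using b0 elim(2) unfolding b_def \<omega>'_def by auto
          have start: "(\<sigma> ^^ (m + d)) \<omega>' = (\<sigma> ^^ i) \<omega>"
          proof -
            have "(\<sigma> ^^ m) \<omega>' = (\<sigma> ^^ s) \<omega>"
              unfolding \<omega>'_def using funpow_inv_into(3)[OF bij orbit, of m m] by simp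
            then have "(\<sigma> ^^ d) ((\<sigma> ^^ m) \<omega>') = (\<sigma> ^^ d) ((\<sigma> ^^ s) \<omega>)" by simp
            then show ?thesis by (simp add: ij(1) add.commute[of _ d] funpow_add)
          qed
          have fwd: "real (visits b \<gamma> (m + d) (m + d + n)) = visit_sum \<beta> \<gamma> \<sigma> n ((\<sigma> ^^ i) \<omega>)" for n
          proof -
            have "of_bool (b (m + d + k) \<le> \<gamma>) = (indicator {0<..\<gamma>} (\<beta> ((\<sigma> ^^ k) ((\<sigma> ^^ i) \<omega>))) :: real)" for k
            proof -
              have "(\<sigma> ^^ k) ((\<sigma> ^^ i) \<omega>) = (\<sigma> ^^ (m + d + k)) \<omega>'"
                unfolding start[symmetric] by (simp add: add.commute[of _ k] funpow_add)
              then show ?thesis using b0[of "m + d + k"] by (simp add: b_def indicator_def)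
            qed
            then show ?thesis unfolding visits_sum_forward visit_sum_def by simp
          qed
          have bwd: "real (visits b \<gamma> (Suc (m + d) - n) (Suc (m + d))) = visit_sum \<beta> \<gamma> ?inv n ((\<sigma> ^^ i) \<omega>)"
            if n: "n \<le> Suc (m + d)" for n
            unfolding visits_sum_backward[OF n] visit_sum_def
          proof (rule sum.cong)
            fix k assume "k \<in> {..<n}"
            then have "k \<le> m + d" using n by auto
            then have "(?inv ^^ k) ((\<sigma> ^^ i) \<omega>) = (\<sigma> ^^ (m + d - k)) \<omega>'"
              unfolding start[symmetric] by (rule funpow_inv_into(4)[OF bij \<omega>'])
            then show "of_bool (b (m + d - k) \<le> \<gamma>) = (indicator {0<..\<gamma>} (\<beta> ((?inv ^^ k) ((\<sigma> ^^ i) \<omega>))) :: real)"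
              using b0[of "m + d - k"] by (simp add: b_def indicator_def)
          qed simp
          have "(\<integral>x. \<bar>evolve b a (m + d) w x\<bar> \<partial>leb) \<le> C * (1 + real N) powr ?S * real a powr (- ?S) * D"
          proof (rule loss[of b, OF b \<epsilon> _ _ _ cp[folded \<omega>'_def, folded b_def] ij(3)])
            fix n assume n: "N < n"
            then have *: "last_deviation P \<beta> \<gamma> \<epsilon> \<sigma> ((\<sigma> ^^ i) \<omega>) < n" "last_deviation P \<beta> \<gamma> \<epsilon> ?inv ((\<sigma> ^^ i) \<omega>) < n"
              unfolding N_def deviation_time_def by auto
            show "visit_prob P \<beta> \<gamma> * (1 - \<epsilon>) * real n \<le> real (visits b \<gamma> (m + d) (m + d + n))"
              "real (visits b \<gamma> (m + d) (m + d + n)) \<le> visit_prob P \<beta> \<gamma> * (1 + \<epsilon>) * real n"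
              unfolding fwd by (rule last_deviation_bounds[OF elim(3) *(1)])+
            assume "n \<le> Suc (m + d)"
            then show "visit_prob P \<beta> \<gamma> * (1 - \<epsilon>) * real n \<le> real (visits b \<gamma> (Suc (m + d) - n) (Suc (m + d)))"
              by (simp only: bwd) (rule last_deviation_bounds[OF elim(4) *(2)])
          qed
          then show ?thesis by (simp add: Y_def b_def \<omega>'_def mult_ac)
        qed
        have acim: "integrable leb (h ((\<sigma> ^^ k) \<omega>))"
          "(\<lambda>n. \<integral>\<^sup>+ x. ennreal \<bar>cocycle \<sigma> (\<lambda>\<omega>. lsv_transfer (\<beta> \<omega>)) n
                 ((?inv ^^ n) ((\<sigma> ^^ k) \<omega>)) (\<lambda>_. 1) x - h ((\<sigma> ^^ k) \<omega>) x\<bar> \<partial>leb) \<longlonglongrightarrow> 0" for k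
          using elim(1) by auto
        have le1: "\<beta> ((\<sigma> ^^ k) ((?inv ^^ m) ((\<sigma> ^^ s) \<omega>))) \<le> 1" for m k
          using elim(2) \<alpha> by (meson less_imp_le order_trans)
        let ?G = "centred (fiber_measure h ((\<sigma> ^^ j) \<omega>))
                (cocycle \<sigma> (normalised_transfer \<sigma> \<beta> h) a ((\<sigma> ^^ i) \<omega>)
                  (\<lambda>x. g2 x * cocycle \<sigma> (normalised_transfer \<sigma> \<beta> h) d ((\<sigma> ^^ s) \<omega>) g1 x))"
        have est: "in_Lp (fiber_measure h ((\<sigma> ^^ j) \<omega>)) p ?G"
          "Lp_norm (fiber_measure h ((\<sigma> ^^ j) \<omega>)) p ?G
            \<le> ((2 * (B1 * B2)) powr (p - 1) * (9 * (B1 + L1) * (B2 + L2) * (C * Y))) powr (1 / p)"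
          unfolding ij(1,2)
          by (rule fibre_estimate; (rule bij \<omega> pos acim le1 g1(1,2) g2(1,2) X p | assumption)+)+
        have Y: "0 \<le> Y" by (simp add: Y_def)
        define A where "A = (B1 + L1) * (B2 + L2)"
        have A: "B1 * B2 \<le> A" "A \<le> (1 + lip_norm g1) * (1 + lip_norm g2)" "0 \<le> A"
          unfolding A_def using B L g1(3) g2(3) by (intro mult_mono mult_nonneg_nonneg; simp)+
        have A9: "9 * (B1 + L1) * (B2 + L2) * (C * Y) = 9 * A * (C * Y)" by (simp only: A_def mult.assoc)
        have "Lp_norm (fiber_measure h ((\<sigma> ^^ j) \<omega>)) p ?G \<le> ((2 * (B1 * B2)) powr (p - 1) * (9 * A * (C * Y))) powr (1 / p)"
          by (rule est(2)[unfolded A9])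
        also have "\<dots> \<le> 2 * (9 * C) powr (1 / p) * A * Y powr (1 / p)"
          by (rule Lp_constant[OF p C Y _ A(1)]) (use B in simp)
        also have "\<dots> \<le> 2 * (9 * C) powr (1 / p) * ((1 + lip_norm g1) * (1 + lip_norm g2))
            * ((1 + real N) powr (1 / p * max 1 ?S) * real a powr (- (1 / p) * ?S))"
        proof (intro mult_mono A)
          have "Y powr (1 / p) = (1 + real N) powr (?S * (1 / p)) * real a powr (- ?S * (1 / p))"
            unfolding Y_def by (simp add: powr_mult powr_powr)
          also have "\<dots> = (1 + real N) powr (1 / p * ?S) * real a powr (- (1 / p) * ?S)"
          proof -
            have "?S * (1 / p) = 1 / p * ?S" by (rule mult.commute)
            moreover have "- ?S * (1 / p) = - (1 / p) * ?S" by (subst minus_mult_commute) (rule mult.commute)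
            ultimately show ?thesis by (simp only:)
          qed
          also have "\<dots> \<le> (1 + real N) powr (1 / p * max 1 ?S) * real a powr (- (1 / p) * ?S)"
            using p by (intro mult_right_mono powr_mono mult_left_mono) auto
          finally show "Y powr (1 / p) \<le> (1 + real N) powr (1 / p * max 1 ?S) * real a powr (- (1 / p) * ?S)" .
        qed (use A C in auto)
        finally show ?case using est(1) unfolding N_def a_def[symmetric] d_def[symmetric] by (simp add: mult.assoc)
      qed
    qed
  qed
qed

end
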